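(* Let $G$ be a Hausdorff topological group. The following are equivalent. (1) $G$ is not amenable. (2) There exists $U \in \mathcal{U}_{e}(G)$ such that, for every $\alpha \in \mathcal{N}_{G}(U)$, the free group $F_{2}$ on two generators is isomorphic to a semi-regular subgroup of $W(\alpha)$. (3) $F_{2}$ is isomorphic to a semi-regular subgroup of $W_{U}(G)$ for some $U \in \mathcal{U}_{e}(G)$.
   Context: $\mathcal{U}_{e}(G)$ denotes the neighborhood filter of the neutral element $e$ of $G$. Amenable topological group: for $g \in G$ let $\lambda_{g}(x) = gx$. $\mathrm{RUC}_{b}(G)$ is the space of bounded real-valued functions on $G$ that are uniformly continuous with respect to the right uniformity (whose entourages are the sets containing $\{(x,y) \mid xy^{-1} \in U\}$ for some $U \in \mathcal{U}_{e}(G)$). $G$ is amenable if there is a positive linear map $\mu \colon \mathrm{RUC}_{b}(G) \to \mathbb{R}$ with $\mu(\mathbf{1}) = 1$ and $\mu(f \circ \lambda_{g}) = \mu(f)$ for all $f \in \mathrm{RUC}_{b}(G)$, $g \in G$. For a set $X$, $\mathrm{Sym}(X)$ is the group of all bijections of $X$; a subgroup of $\mathrm{Sym}(X)$ is semi-regular if none of its non-identity elements has a fixed point in $X$. For $U \in \mathcal{U}_{e}(G)$, $\mathcal{N}_{G}(U)$ is the set of all maps $\alpha \colon G \to \mathrm{Sym}(G)$ (not necessarily homomorphisms) such that $\alpha(g)(h) \in Ugh$ for all $g,h \in G$. For sets $I,X$ and a map $\alpha \colon I \to \mathrm{Sym}(X)$, $\Gamma(\alpha)$ is the subgroup of $\mathrm{Sym}(X)$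 generated by $\{\alpha(i) \mid i \in I\}$. For a family of maps $\alpha_{j} \colon I \to \mathrm{Sym}(X)$ $(j \in J)$, the map $\bigoplus_{j \in J} \alpha_{j} \colon I \to \mathrm{Sym}(X \times J)$ is defined by $(\bigoplus_{j \in J} \alpha_{j})(i)(x,j) = (\alpha_{j}(i)(x),j)$. Wobbling groups: for a group $\Gamma$ acting on a set $X$, $W(\Gamma,X)$ is the group of all $\gamma \in \mathrm{Sym}(X)$ for which there is a finite set $E \subseteq \Gamma$ such that for every $x \in X$ there is $g \in E$ with $\gamma(x) = gx$. For $\alpha \colon I \to \mathrm{Sym}(X)$ put $W(\alpha) = W(\Gamma(\alpha),X)$. For $U \in \mathcal{U}_{e}(G)$ put $W_{U}(G) = W\big(\bigoplus_{\alpha \in \mathcal{N}_{G}(U)} \alpha\big)$, a subgroup of $\mathrm{Sym}(G \times \mathcal{N}_{G}(U))$. *)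

theory Defs
  imports
    "HOL-Analysis.Analysis"
    "HOL-Algebra.Generated_Groups"
    "HOL-Algebra.Group_Action"
begin

text \<open>
  Topological groups are types of class \<open>topological_group_add\<close>. This class does not assume
  commutativity, but it is written additively: \<open>g + h\<close> is the product \<open>gh\<close>, \<open>- g\<close> is the
  inverse of \<open>g\<close>, \<open>0\<close> is the neutral element, and \<open>x - y\<close> is the product of \<open>x\<close> with the
  inverse of \<open>y\<close>. Permutation groups are multiplicative: \<open>BijGroup X\<close> is Sym(X), whose
  elements are the bijections of \<open>X\<close>, made \<open>undefined\<close> outside \<open>X\<close>.
\<close>

section \<open>Amenability\<close>

definition nhd_filter_e :: "'a::topological_group_add set set" where
  "nhd_filter_e = {U. eventually (\<lambda>x. x \<in> U) (nhds 0)}"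

text \<open>
  A filter on pairs, as in the class \<open>uniform_space\<close>; the topology of \<open>'a\<close> need not come
  with an instance of that class.
\<close>

definition right_uniformity :: "('a::topological_group_add \<times> 'a) filter" where
  "right_uniformity = filtercomap (\<lambda>(x, y). x - y) (nhds 0)"

lemma eventually_right_uniformity:
  "eventually P right_uniformity \<longleftrightarrow>
     (\<exists>U\<in>nhd_filter_e. {(x, y). x - y \<in> U} \<subseteq> {p. P p})"
proof
  assume "eventually P right_uniformity"
  then obtain Q where Q: "eventually Q (nhds 0)" "\<And>p. Q (case p of (x, y) \<Rightarrow> x - y) \<Longrightarrow> P p"
    unfolding right_uniformity_def eventually_filtercomap by blast
  show "\<exists>U\<in>nhd_filter_e. {(x, y). x - y \<in> U} \<subseteq> {p. P p}"
    by (rule bexI [of _ "{x. Q x}"]) (use Q in \<open>auto simp: nhd_filter_e_def\<close>)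
next
  assume "\<exists>U\<in>nhd_filter_e. {(x, y). x - y \<in> U} \<subseteq> {p. P p}"
  then obtain U where "eventually (\<lambda>x. x \<in> U) (nhds 0)" "{(x, y). x - y \<in> U} \<subseteq> {p. P p}"
    by (auto simp: nhd_filter_e_def)
  thus "eventually P right_uniformity"
    unfolding right_uniformity_def eventually_filtercomap
    by (intro exI [of _ "\<lambda>x. x \<in> U"]) auto
qed

definition RUC_b :: "('a::topological_group_add \<Rightarrow> real) set" where
  "RUC_b = {f. bounded (range f) \<and>
     filterlim (\<lambda>(x, y). (f x, f y)) uniformity right_uniformity}"

lemma RUC_b_iff:
  "f \<in> RUC_b \<longleftrightarrow> bounded (range f) \<and>
     (\<forall>\<epsilon>>0. \<exists>U\<in>nhd_filter_e. \<forall>x y. x - y \<in> U \<longrightarrow> \<bar>f x - f y\<bar> < \<epsilon>)"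
proof -
  let ?F = "\<lambda>(x, y). (f x, f y)"
  let ?E = "\<lambda>\<epsilon> (p :: real \<times> real). dist (fst p) (snd p) < \<epsilon>"
  have "filterlim ?F uniformity right_uniformity \<longleftrightarrow>
      (\<forall>\<epsilon>>0. eventually (\<lambda>p. ?E \<epsilon> (?F p)) right_uniformity)"
  proof (intro iffI allI impI)
    fix \<epsilon> :: real assume *: "filterlim ?F uniformity right_uniformity" and "\<epsilon> > 0"
    hence "eventually (?E \<epsilon>) uniformity" by (auto simp: eventually_uniformity_metric)
    thus "eventually (\<lambda>p. ?E \<epsilon> (?F p)) right_uniformity"
      using * [unfolded filterlim_iff, THEN spec [of _ "?E \<epsilon>"]] by simp
  next
    assume *: "\<forall>\<epsilon>>0. eventually (\<lambda>p. ?E \<epsilon> (?F p)) right_uniformity"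
    show "filterlim ?F uniformity right_uniformity"
      unfolding filterlim_iff
    proof (intro allI impI)
      fix P :: "real \<times> real \<Rightarrow> bool" assume "eventually P uniformity"
      then obtain \<epsilon> where "\<epsilon> > 0" "\<And>x y. dist x y < \<epsilon> \<Longrightarrow> P (x, y)"
        by (auto simp: eventually_uniformity_metric)
      thus "eventually (\<lambda>p. P (?F p)) right_uniformity"
        using * by (auto elim!: allE [of _ \<epsilon>] eventually_mono)
    qed
  qed
  also have "\<dots> \<longleftrightarrow> (\<forall>\<epsilon>>0. \<exists>U\<in>nhd_filter_e. \<forall>x y. x - y \<in> U \<longrightarrow> \<bar>f x - f y\<bar> < \<epsilon>)"
    unfolding eventually_right_uniformity by (simp add: subset_iff dist_real_def)
  finally show ?thesis by (simp add: RUC_b_def)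
qed

definition amenable :: "'a::topological_group_add itself \<Rightarrow> bool" where
  "amenable _ \<longleftrightarrow> (\<exists>\<mu> :: ('a \<Rightarrow> real) \<Rightarrow> real.
     (\<forall>f\<in>RUC_b. \<forall>g\<in>RUC_b. \<mu> (\<lambda>x. f x + g x) = \<mu> f + \<mu> g) \<and>
     (\<forall>c. \<forall>f\<in>RUC_b. \<mu> (\<lambda>x. c * f x) = c * \<mu> f) \<and>
     (\<forall>f\<in>RUC_b. (\<forall>x. f x \<ge> 0) \<longrightarrow> \<mu> f \<ge> 0) \<and>
     \<mu> (\<lambda>x. 1) = 1 \<and>
     (\<forall>f\<in>RUC_b. \<forall>g. \<mu> (f \<circ> (\<lambda>x. g + x)) = \<mu> f))"

section \<open>Wobbling groups\<close>

definition semi_regular :: "'x set \<Rightarrow> ('x \<Rightarrow> 'x) set \<Rightarrow> bool" where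
  "semi_regular X H \<longleftrightarrow> subgroup H (BijGroup X) \<and>
     (\<forall>h\<in>H. h \<noteq> \<one>\<^bsub>BijGroup X\<^esub> \<longrightarrow> (\<forall>x\<in>X. h x \<noteq> x))"

text \<open>The group \<open>\<Gamma>\<close> acts on \<open>X\<close> through \<open>\<phi>\<close>, in the sense of \<open>group_action \<Gamma> X \<phi>\<close>.\<close>

definition wobbling_group ::
    "('g, 'b) monoid_scheme \<Rightarrow> 'x set \<Rightarrow> ('g \<Rightarrow> 'x \<Rightarrow> 'x) \<Rightarrow> ('x \<Rightarrow> 'x) monoid" where
  "wobbling_group \<Gamma> X \<phi> = (BijGroup X)\<lparr>carrier :=
     {\<gamma> \<in> carrier (BijGroup X).
        \<exists>E. finite E \<and> E \<subseteq> carrier \<Gamma> \<and> (\<forall>x\<in>X. \<exists>g\<in>E. \<gamma> x = \<phi> g x)}\<rparr>"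

definition perm_gen :: "'i set \<Rightarrow> 'x set \<Rightarrow> ('i \<Rightarrow> 'x \<Rightarrow> 'x) \<Rightarrow> ('x \<Rightarrow> 'x) monoid" where
  "perm_gen I X \<alpha> = (BijGroup X)\<lparr>carrier := generate (BijGroup X) (\<alpha> ` I)\<rparr>"

definition wobbling_of :: "'i set \<Rightarrow> 'x set \<Rightarrow> ('i \<Rightarrow> 'x \<Rightarrow> 'x) \<Rightarrow> ('x \<Rightarrow> 'x) monoid" where
  "wobbling_of I X \<alpha> = wobbling_group (perm_gen I X \<alpha>) X (\<lambda>\<gamma>. \<gamma>)"

definition perm_sum ::
    "'x set \<Rightarrow> 'j set \<Rightarrow> ('j \<Rightarrow> 'i \<Rightarrow> 'x \<Rightarrow> 'x) \<Rightarrow> 'i \<Rightarrow> 'x \<times> 'j \<Rightarrow> 'x \<times> 'j" where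
  "perm_sum X J \<alpha> i = restrict (\<lambda>(x, j). (\<alpha> j i x, j)) (X \<times> J)"

definition near_translations ::
    "'a::topological_group_add set \<Rightarrow> ('a \<Rightarrow> 'a \<Rightarrow> 'a) set" where
  "near_translations U =
     {\<alpha>. \<forall>g. \<alpha> g \<in> carrier (BijGroup UNIV) \<and> (\<forall>h. \<alpha> g h \<in> {u + g + h | u. u \<in> U})}"

definition wobbling_nhd ::
    "'a::topological_group_add set \<Rightarrow>
       ('a \<times> ('a \<Rightarrow> 'a \<Rightarrow> 'a) \<Rightarrow> 'a \<times> ('a \<Rightarrow> 'a \<Rightarrow> 'a)) monoid" where
  "wobbling_nhd U = wobbling_of UNIV (UNIV \<times> near_translations U)
     (perm_sum UNIV (near_translations U) (\<lambda>\<alpha>. \<alpha>))"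

lemma wobbling_group_subgroup:
  assumes "group \<Gamma>" "group_action \<Gamma> X \<phi>"
  shows "subgroup (carrier (wobbling_group \<Gamma> X \<phi>)) (BijGroup X)"
proof -
  interpret A: group_action \<Gamma> X \<phi> by fact
  interpret \<Gamma>: group \<Gamma> by fact
  interpret B: group "BijGroup X" by (rule group_BijGroup)
  have maps: "\<gamma> x \<in> X" if "\<gamma> \<in> Bij X" "x \<in> X" for \<gamma> x
    using that by (auto simp: Bij_def bij_betw_def)
  show ?thesis
  proof (rule B.subgroupI)
    show "carrier (wobbling_group \<Gamma> X \<phi>) \<subseteq> carrier (BijGroup X)"
      by (auto simp: wobbling_group_def)
    have "\<one>\<^bsub>BijGroup X\<^esub> \<in> carrier (wobbling_group \<Gamma> X \<phi>)"
      unfolding wobbling_group_def using A.id_eq_one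
      by (auto intro!: exI [of _ "{\<one>\<^bsub>\<Gamma>\<^esub>}"] simp: BijGroup_def id_Bij simp flip: A.id_eq_one)
    thus "carrier (wobbling_group \<Gamma> X \<phi>) \<noteq> {}" by blast
  next
    fix a assume "a \<in> carrier (wobbling_group \<Gamma> X \<phi>)"
    then obtain E where a: "a \<in> Bij X" and E: "finite E" "E \<subseteq> carrier \<Gamma>"
      and aE: "\<And>x. x \<in> X \<Longrightarrow> \<exists>g\<in>E. a x = \<phi> g x"
      by (auto simp: wobbling_group_def BijGroup_def)
    have ia: "inv\<^bsub>BijGroup X\<^esub> a = (\<lambda>x\<in>X. inv_into X a x)" by (rule inv_BijGroup [OF a])
    have "\<exists>g\<in>m_inv \<Gamma> ` E. inv_into X a x = \<phi> g x" if x: "x \<in> X" for x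
    proof -
      define y where "y = inv_into X a x"
      have y: "y \<in> X" "a y = x"
        using a x unfolding y_def by (auto simp: Bij_def bij_betw_def inv_into_into f_inv_into_f)
      then obtain g where g: "g \<in> E" "x = \<phi> g y" using aE by metis
      hence "\<phi> (inv\<^bsub>\<Gamma>\<^esub> g) x = y"
        using A.orbit_sym_aux [of g y x] E y by auto
      hence "inv_into X a x = \<phi> (inv\<^bsub>\<Gamma>\<^esub> g) x" by (simp only: y_def)
      thus ?thesis using g(1) by blast
    qed
    thus "inv\<^bsub>BijGroup X\<^esub> a \<in> carrier (wobbling_group \<Gamma> X \<phi>)"
      unfolding wobbling_group_def ia using E restrict_inv_into_Bij [OF a]
      by (auto intro!: exI [of _ "m_inv \<Gamma> ` E"] simp: BijGroup_def)
  next
    fix a b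
    assume "a \<in> carrier (wobbling_group \<Gamma> X \<phi>)" "b \<in> carrier (wobbling_group \<Gamma> X \<phi>)"
    then obtain E F where a: "a \<in> Bij X" and E: "finite E" "E \<subseteq> carrier \<Gamma>"
      and aE: "\<And>x. x \<in> X \<Longrightarrow> \<exists>g\<in>E. a x = \<phi> g x"
      and b: "b \<in> Bij X" and F: "finite F" "F \<subseteq> carrier \<Gamma>"
      and bF: "\<And>x. x \<in> X \<Longrightarrow> \<exists>g\<in>F. b x = \<phi> g x"
      by (auto simp: wobbling_group_def BijGroup_def)
    let ?EF = "(\<lambda>(g, h). g \<otimes>\<^bsub>\<Gamma>\<^esub> h) ` (E \<times> F)"
    have "\<exists>k\<in>?EF. a (b x) = \<phi> k x" if x: "x \<in> X" for x
    proof -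
      obtain h where h: "h \<in> F" "b x = \<phi> h x" using bF x by blast
      obtain g where g: "g \<in> E" "a (b x) = \<phi> g (b x)" using aE maps [OF b x] by blast
      have "a (b x) = \<phi> (g \<otimes>\<^bsub>\<Gamma>\<^esub> h) x"
        using A.composition_rule [OF x, of g h] g h E(2) F(2) by (simp add: subset_iff)
      moreover have "g \<otimes>\<^bsub>\<Gamma>\<^esub> h \<in> ?EF" using g(1) h(1) by force
      ultimately show ?thesis by blast
    qed
    moreover have "finite ?EF" "?EF \<subseteq> carrier \<Gamma>" using E F by auto
    ultimately show "a \<otimes>\<^bsub>BijGroup X\<^esub> b \<in> carrier (wobbling_group \<Gamma> X \<phi>)"
      unfolding wobbling_group_def using a b compose_Bij [OF a b]
      by (auto intro!: exI [of _ ?EF] simp: BijGroup_def compose_def)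
  qed
qed

lemma group_action_perm_gen:
  assumes "\<alpha> ` I \<subseteq> carrier (BijGroup X)"
  shows "group_action (perm_gen I X \<alpha>) X (\<lambda>\<gamma>. \<gamma>)"
proof -
  interpret B: group "BijGroup X" by (rule group_BijGroup)
  have sub: "subgroup (generate (BijGroup X) (\<alpha> ` I)) (BijGroup X)"
    by (rule B.generate_is_subgroup [OF assms])
  have "group (perm_gen I X \<alpha>)"
    unfolding perm_gen_def by (rule subgroup.subgroup_is_group [OF sub B.is_group])
  moreover have "(\<lambda>\<gamma>. \<gamma>) \<in> hom (perm_gen I X \<alpha>) (BijGroup X)"
    using subgroup.subset [OF sub] by (auto simp: perm_gen_def hom_def)
  ultimately show ?thesis
    by (simp add: group_action_def group_hom_def group_hom_axioms_def group_BijGroup)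
qed

lemma perm_sum_Bij:
  assumes "\<And>j. j \<in> J \<Longrightarrow> \<alpha> j i \<in> carrier (BijGroup X)"
  shows "perm_sum X J \<alpha> i \<in> carrier (BijGroup (X \<times> J))"
proof -
  have \<alpha>: "inj_on (\<alpha> j i) X" "\<alpha> j i ` X = X" if "j \<in> J" for j
    using assms [OF that] by (auto simp: BijGroup_def Bij_def bij_betw_def)
  have "inj_on (\<lambda>(x, j). (\<alpha> j i x, j)) (X \<times> J)"
    using \<alpha>(1) by (auto simp: inj_on_def)
  moreover have "(\<lambda>(x, j). (\<alpha> j i x, j)) ` (X \<times> J) = X \<times> J"
  proof (intro equalityI subsetI)
    fix p assume "p \<in> X \<times> J"
    then obtain y j where p: "p = (y, j)" "y \<in> X" "j \<in> J" by auto
    then obtain x where "x \<in> X" "y = \<alpha> j i x" using \<alpha>(2) by blast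
    with p show "p \<in> (\<lambda>(x, j). (\<alpha> j i x, j)) ` (X \<times> J)" by force
  qed (use \<alpha>(2) in auto)
  ultimately show ?thesis
    by (simp add: perm_sum_def BijGroup_def Bij_def bij_betw_def)
qed

section \<open>Free groups\<close>

text \<open>
  The letters are \<open>(True, a)\<close>, the generator \<open>a\<close>, and \<open>(False, a)\<close>, its formal inverse. The
  elements of the free group are the reduced words; the product \<open>u v\<close> prepends the letters
  of \<open>u\<close> to \<open>v\<close> one at a time, from the last to the first, cancelling where possible.
\<close>

definition inv_letter :: "bool \<times> 'a \<Rightarrow> bool \<times> 'a" where
  "inv_letter x = (\<not> fst x, snd x)"

fun prepend :: "bool \<times> 'a \<Rightarrow> (bool \<times> 'a) list \<Rightarrow> (bool \<times> 'a) list" where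
  "prepend x [] = [x]"
| "prepend x (y # ys) = (if y = inv_letter x then ys else x # y # ys)"

definition reduced_word :: "(bool \<times> 'a) list \<Rightarrow> bool" where
  "reduced_word = successively (\<lambda>x y. y \<noteq> inv_letter x)"

definition free_group :: "'a set \<Rightarrow> (bool \<times> 'a) list monoid" where
  "free_group S = \<lparr>carrier = {w. reduced_word w \<and> snd ` set w \<subseteq> S},
     mult = (\<lambda>u v. foldr prepend u v), one = []\<rparr>"

lemma inv_letter_inv_letter [simp]: "inv_letter (inv_letter x) = x"
  by (simp add: inv_letter_def)

lemma snd_inv_letter [simp]: "snd (inv_letter x) = snd x"
  by (simp add: inv_letter_def)

lemma inv_letter_neq [simp]: "inv_letter x \<noteq> x" "x \<noteq> inv_letter x"
  by (cases x; simp add: inv_letter_def)+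

lemma reduced_Cons:
  "reduced_word (x # xs) \<longleftrightarrow> reduced_word xs \<and> (xs = [] \<or> hd xs \<noteq> inv_letter x)"
  by (cases xs) (auto simp: reduced_word_def)

lemma reduced_Nil [simp]: "reduced_word []"
  by (simp add: reduced_word_def)

lemma reduced_prepend: "reduced_word w \<Longrightarrow> reduced_word (prepend x w)"
  by (cases w) (auto simp: reduced_Cons)

lemma prepend_reduced: "reduced_word (x # w) \<Longrightarrow> prepend x w = x # w"
  by (cases w) (auto simp: reduced_Cons)

lemma prepend_inv [simp]: "reduced_word w \<Longrightarrow> prepend x (prepend (inv_letter x) w) = w"
  by (cases w) (auto simp: prepend_reduced)

lemma prepend_inv' [simp]: "reduced_word w \<Longrightarrow> prepend (inv_letter x) (prepend x w) = w"
  using prepend_inv [of w "inv_letter x"] by simp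

lemma reduced_foldr: "reduced_word v \<Longrightarrow> reduced_word (foldr prepend u v)"
  by (induction u) (auto intro: reduced_prepend)

lemma set_prepend: "set (prepend x w) \<subseteq> insert x (set w)"
  by (cases w) auto

lemma set_foldr_prepend: "set (foldr prepend u v) \<subseteq> set u \<union> set v"
proof (induction u)
  case (Cons x u)
  thus ?case using set_prepend [of x "foldr prepend u v"] by auto
qed auto

lemma foldr_prepend_prepend:
  "reduced_word w \<Longrightarrow> foldr prepend (prepend x v) w = prepend x (foldr prepend v w)"
  by (cases v) (auto simp: reduced_foldr)

lemma foldr_prepend_assoc:
  "reduced_word w \<Longrightarrow> foldr prepend (foldr prepend u v) w = foldr prepend u (foldr prepend v w)"
  by (induction u) (auto simp: foldr_prepend_prepend)

lemma foldr_prepend_Nil: "reduced_word v \<Longrightarrow> foldr prepend v [] = v"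
  by (induction v) (auto simp: prepend_reduced reduced_Cons)

lemma foldr_prepend_inv:
  "reduced_word w \<Longrightarrow> foldr prepend (rev (map inv_letter v)) (foldr prepend v w) = w"
  by (induction v) (auto simp: reduced_foldr)

lemma group_free_group: "group (free_group S)"
proof (rule groupI)
  fix x assume x: "x \<in> carrier (free_group S)"
  let ?r = "rev (map inv_letter x)"
  let ?y = "foldr prepend ?r []"
  have "?y \<in> carrier (free_group S)"
    using x set_foldr_prepend [of ?r "[]"] by (fastforce simp: free_group_def reduced_foldr)
  moreover have "foldr prepend ?y x = []"
    using x foldr_prepend_inv [of "[]" x]
    by (auto simp: free_group_def foldr_prepend_assoc foldr_prepend_Nil)
  ultimately show "\<exists>y\<in>carrier (free_group S). y \<otimes>\<^bsub>free_group S\<^esub> x = \<one>\<^bsub>free_group S\<^esub>"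
    by (auto simp: free_group_def)
next
  fix x y assume "x \<in> carrier (free_group S)" "y \<in> carrier (free_group S)"
  thus "x \<otimes>\<^bsub>free_group S\<^esub> y \<in> carrier (free_group S)"
    using set_foldr_prepend [of x y] by (fastforce simp: free_group_def reduced_foldr)
qed (auto simp: free_group_def foldr_prepend_assoc)

lemma free_group_universal:
  assumes "group H" "f \<in> S \<rightarrow> carrier H"
  shows "\<exists>h\<in>hom (free_group S) H. \<forall>a\<in>S. h [(True, a)] = f a"
    and "\<lbrakk>h \<in> hom (free_group S) H; k \<in> hom (free_group S) H;
          \<forall>a\<in>S. h [(True, a)] = k [(True, a)]; w \<in> carrier (free_group S)\<rbrakk> \<Longrightarrow> h w = k w"
proof -
  interpret H: group H by fact
  define l where "l = (\<lambda>x. if fst x then f (snd x) else inv\<^bsub>H\<^esub> f (snd x))"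
  define e where "e = (\<lambda>w. foldr (\<lambda>x y. l x \<otimes>\<^bsub>H\<^esub> y) w \<one>\<^bsub>H\<^esub>)"
  have l: "l x \<in> carrier H" if "snd x \<in> S" for x
    using that assms(2) by (auto simp: l_def)
  have l_inv: "l x \<otimes>\<^bsub>H\<^esub> l (inv_letter x) = \<one>\<^bsub>H\<^esub>" if "snd x \<in> S" for x
    using funcset_mem [OF assms(2) that] by (simp add: l_def inv_letter_def)
  have e: "e w \<in> carrier H" if "snd ` set w \<subseteq> S" for w
    using that by (induction w) (auto simp: e_def l)
  have e_prepend: "e (prepend x w) = l x \<otimes>\<^bsub>H\<^esub> e w"
    if "snd x \<in> S" "snd ` set w \<subseteq> S" for x w
  proof (cases w)
    case (Cons y ys)
    have "l x \<otimes>\<^bsub>H\<^esub> (l (inv_letter x) \<otimes>\<^bsub>H\<^esub> e ys) = e ys"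
      using that Cons l [of x] l [of "inv_letter x"] e [of ys] l_inv [of x]
      by (simp flip: H.m_assoc)
    thus ?thesis using Cons by (auto simp: e_def)
  qed (auto simp: e_def)
  have e_mult: "e (foldr prepend u v) = e u \<otimes>\<^bsub>H\<^esub> e v"
    if "snd ` set u \<subseteq> S" "snd ` set v \<subseteq> S" for u v
    using that(1)
  proof (induction u)
    case Nil
    show ?case using e [OF that(2)] by (simp add: e_def)
  next
    case (Cons x u)
    have "snd ` set (foldr prepend u v) \<subseteq> S"
      using Cons.prems that(2) set_foldr_prepend [of u v] by fastforce
    hence "e (prepend x (foldr prepend u v)) = l x \<otimes>\<^bsub>H\<^esub> (e u \<otimes>\<^bsub>H\<^esub> e v)"
      using Cons e_prepend by simp
    also have "\<dots> = (l x \<otimes>\<^bsub>H\<^esub> e u) \<otimes>\<^bsub>H\<^esub> e v"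
      using Cons.prems l [of x] e [of u] e [OF that(2)] by (simp add: H.m_assoc)
    also have "l x \<otimes>\<^bsub>H\<^esub> e u = e (x # u)" by (simp add: e_def)
    finally show ?case by simp
  qed
  have "e \<in> hom (free_group S) H"
    by (rule homI) (auto simp: free_group_def e e_mult)
  moreover have "\<forall>a\<in>S. e [(True, a)] = f a"
    using funcset_mem [OF assms(2)] by (simp add: e_def l_def)
  ultimately show "\<exists>h\<in>hom (free_group S) H. \<forall>a\<in>S. h [(True, a)] = f a" by blast
next
  assume h: "h \<in> hom (free_group S) H" and k: "k \<in> hom (free_group S) H"
    and hk: "\<forall>a\<in>S. h [(True, a)] = k [(True, a)]" and w: "w \<in> carrier (free_group S)"
  interpret F: group "free_group S" by (rule group_free_group)
  interpret h: group_hom "free_group S" H h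
    using assms(1) h by (simp add: group_hom_def group_hom_axioms_def group_free_group)
  interpret k: group_hom "free_group S" H k
    using assms(1) k by (simp add: group_hom_def group_hom_axioms_def group_free_group)
  have letter: "[x] \<in> carrier (free_group S)" if "snd x \<in> S" for x
    using that by (simp add: free_group_def reduced_Cons)
  have eq: "h [x] = k [x]" if x: "snd x \<in> S" for x
  proof (cases "fst x")
    case True
    thus ?thesis using hk x by (cases x) auto
  next
    case False
    let ?y = "(True, snd x)"
    have "[x] \<otimes>\<^bsub>free_group S\<^esub> [?y] = \<one>\<^bsub>free_group S\<^esub>"
      using False by (cases x) (simp add: free_group_def inv_letter_def)
    hence "inv\<^bsub>free_group S\<^esub> [?y] = [x]"
      using F.inv_equality letter [of x] letter [of ?y] x by simp
    moreover have "h (inv\<^bsub>free_group S\<^esub> [?y]) = k (inv\<^bsub>free_group S\<^esub> [?y])"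
      using hk x letter [of ?y] by simp
    ultimately show ?thesis by simp
  qed
  show "h w = k w"
    using w
  proof (induction w)
    case Nil
    show ?case using h.hom_one k.hom_one by (simp add: free_group_def)
  next
    case (Cons x w)
    have w: "w \<in> carrier (free_group S)" and x: "snd x \<in> S"
      using Cons.prems by (auto simp: free_group_def reduced_Cons)
    have "x # w = [x] \<otimes>\<^bsub>free_group S\<^esub> w"
      using Cons.prems by (simp add: free_group_def prepend_reduced)
    thus ?case using Cons.IH [OF w] eq [OF x] w letter [OF x] by simp
  qed
qed

definition F2 :: "(bool \<times> nat) list monoid" where
  "F2 = free_group {0, 1}"

definition F2_semi_regular_in :: "'x set \<Rightarrow> ('x \<Rightarrow> 'x) monoid \<Rightarrow> bool" where
  "F2_semi_regular_in X W \<longleftrightarrow>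
     (\<exists>H. subgroup H W \<and> semi_regular X H \<and> F2 \<cong> W\<lparr>carrier := H\<rparr>)"

end

theory Submission
  imports Defs
begin

text \<open>
  If \<open>G\<close> is not amenable, Hahn--Banach provides finitely many \<open>f\<^sub>i \<in> RUC_b\<close> and \<open>g\<^sub>i \<in> G\<close> such that
  the sum of the functions \<open>f\<^sub>i (g\<^sub>i x) - f\<^sub>i x\<close> is bounded below by a positive constant. By
  uniform continuity this persists when each \<open>g\<^sub>i x\<close> is perturbed by a small \<open>U\<close>, so that the
  permutations that define \<open>W\<^sub>U(G)\<close> expand all finite sets by a fixed factor. By the marriage
  theorem there is a three-to-one map of bounded displacement, which can be made aperiodic; its
  fibres form a 4-regular forest, and labelling the edges gives a free action of \<open>F\<^sub>2\<close> by
  elements of \<open>W\<^sub>U(G)\<close>. Restricting the action to a single \<open>\<alpha>\<close> settles \<open>W(\<alpha>)\<close>.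

  If \<open>G\<close> is amenable and not discrete, it has finite sets \<open>F\<close> such that \<open>gF\<close> can be matched
  with most of \<open>F\<close> within \<open>U\<close>, for all \<open>g\<close> in a given finite set. Right translation makes
  these sets disjoint for the different data, so that the matchings can be glued to one
  \<open>\<alpha> \<in> N\<^sub>G(U)\<close> for which all of them are almost invariant sets. Hence there is a mean invariant
  under \<open>W(\<alpha>)\<close>, which excludes a free action of \<open>F\<^sub>2\<close>. In a discrete group the left
  translations can serve as \<open>\<alpha>\<close>.
\<close>

text \<open>The forest has degree 4 because this is the shape of the Cayley graph of
  \<open>F2\<close>: one edge to the image and three to the preimages. A cycle in it would spell a
  nonempty reduced word that fixes a point, so periodic points have to go before the edges are
  labelled. In the amenable direction the given mean lives on \<open>RUC_b\<close>, but an element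
  of a wobbling group cuts the space into arbitrary pieces, whose indicator functions need not be
  uniformly continuous. The detour through finite sets produces a mean on all bounded functions; it
  is invariant only under permutations near the translations, and \<open>U\<close> is the room that
  this takes. The finite sets arise from lists in which points may repeat, and their entries are
  moved apart within a small neighbourhood. This needs infinite neighbourhoods, hence the separate
  discrete case, in which every bounded function is in \<open>RUC_b\<close>. No countability is
  assumed: the data are finite lists of group elements, and an infinite group has no more of these
  than elements, so the disjoint translates are found by transfinite recursion.\<close>

section \<open>Hall's marriage theorem\<close>

text \<open>
  Rado's argument: in a minimal family that satisfies Hall's condition, no set has two elements
  \<open>x \<noteq> y\<close>. Otherwise removing either one violates the condition, and the two witnesses
  contradict the condition for their union and their intersection.
\<close>

lemma hall_infinite:
  fixes A :: "'i \<Rightarrow> 'b set"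
  assumes fin: "\<And>i. i \<in> I \<Longrightarrow> finite (A i)"
    and hall: "\<And>J. finite J \<Longrightarrow> J \<subseteq> I \<Longrightarrow> card J \<le> card (\<Union>(A ` J))"
  shows "\<exists>f. inj_on f I \<and> (\<forall>i\<in>I. f i \<in> A i)"
proof -
  define H where "H = {B. (\<forall>i. B i \<subseteq> A i) \<and> (\<forall>J. finite J \<longrightarrow> J \<subseteq> I \<longrightarrow> card J \<le> card (\<Union>(B ` J)))}"
  have "\<exists>B\<in>H. \<forall>B'\<in>H. (\<forall>i. B' i \<subseteq> B i) \<longrightarrow> B' = B"
  proof (rule predicate_Zorn)
    show "partial_order_on H (relation_of (\<lambda>B B'. \<forall>i. B' i \<subseteq> B i) H)"
      by (rule partial_order_on_relation_ofI) (auto simp: fun_eq_iff)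
  next
    fix \<C> assume \<C>: "\<C> \<in> Chains (relation_of (\<lambda>B B'. \<forall>i. B' i \<subseteq> B i) H)"
    show "\<exists>u\<in>H. \<forall>B\<in>\<C>. \<forall>i. u i \<subseteq> B i"
    proof (cases "\<C> = {}")
      case True
      have "A \<in> H" using hall by (auto simp: H_def)
      with True show ?thesis by auto
    next
      case False
      define u where "u i = (\<Inter>B\<in>\<C>. B i)" for i
      have CH: "\<C> \<subseteq> H" using \<C> by (auto simp: Chains_def relation_of_def)
      have tot: "(\<forall>i. B i \<subseteq> B' i) \<or> (\<forall>i. B' i \<subseteq> B i)" if "B \<in> \<C>" "B' \<in> \<C>" for B B'
        using \<C> that by (auto simp: Chains_def relation_of_def)
      \<comment> \<open>The total size on the finite set \<open>J\<close> is a natural number, so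
        some member of the chain minimises it; on \<open>J\<close> this member is already the
        intersection. Thus Hall's condition passes to \<open>u\<close>.\<close>
      have stab: "\<exists>B\<in>\<C>. \<forall>i\<in>J. B i = u i" if J: "finite J" "J \<subseteq> I" for J
      proof -
        have finB: "finite (B i)" if "B \<in> \<C>" "i \<in> I" for B i
        proof -
          have "B i \<subseteq> A i" using that CH by (auto simp: H_def)
          thus ?thesis using fin that(2) finite_subset by blast
        qed
        define B where "B = arg_min (\<lambda>B. \<Sum>i\<in>J. card (B i)) (\<lambda>B. B \<in> \<C>)"
        obtain B0 where B0: "B0 \<in> \<C>" using False by blast
        have B: "B \<in> \<C>" and Bmin: "(\<Sum>i\<in>J. card (B i)) \<le> (\<Sum>i\<in>J. card (B' i))"
          if "B' \<in> \<C>" for B'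
          unfolding B_def by (rule arg_min_natI [of "\<lambda>B. B \<in> \<C>", OF B0])
            (rule arg_min_nat_le [of "\<lambda>B. B \<in> \<C>", OF that])
        hence B: "B \<in> \<C>" using B0 by blast
        have "B i \<subseteq> B' i" if "B' \<in> \<C>" "i \<in> J" for B' i
        proof (rule ccontr)
          assume n: "\<not> B i \<subseteq> B' i"
          hence sub: "\<forall>i. B' i \<subseteq> B i" using tot [OF B that(1)] by blast
          have "(\<Sum>i\<in>J. card (B' i)) < (\<Sum>i\<in>J. card (B i))"
          proof (rule sum_strict_mono_ex1 [OF J(1)])
            show "\<forall>i\<in>J. card (B' i) \<le> card (B i)"
              using sub finB [OF B] J(2) by (auto intro!: card_mono)
            show "\<exists>i\<in>J. card (B' i) < card (B i)"
              using sub n finB [OF B, of i] J(2) that(2)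
              by (intro bexI [of _ i] psubset_card_mono) auto
          qed
          with Bmin [OF that(1)] show False by simp
        qed
        hence "\<forall>i\<in>J. B i = u i" using B by (fastforce simp: u_def)
        thus ?thesis using B by blast
      qed
      have "u \<in> H"
        unfolding H_def
      proof (intro CollectI conjI allI impI)
        fix i
        obtain B where "B \<in> \<C>" using False by blast
        thus "u i \<subseteq> A i" using CH by (auto simp: u_def H_def subset_iff)
      next
        fix J assume J: "finite J" "J \<subseteq> I"
        then obtain B where B: "B \<in> \<C>" "\<forall>i\<in>J. B i = u i" using stab by blast
        have "card J \<le> card (\<Union>(B ` J))" using B(1) CH J by (auto simp: H_def)
        also have "\<Union>(B ` J) = \<Union>(u ` J)" using B(2) by auto
        finally show "card J \<le> card (\<Union>(u ` J))" .
      qed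
      thus ?thesis by (intro bexI [of _ u]) (auto simp: u_def)
    qed
  qed
  then obtain B where B: "B \<in> H" and Bmin: "\<And>B'. B' \<in> H \<Longrightarrow> (\<forall>i. B' i \<subseteq> B i) \<Longrightarrow> B' = B"
    by blast
  have Bh: "card J \<le> card (\<Union>(B ` J))" if "finite J" "J \<subseteq> I" for J
    using B that by (auto simp: H_def)
  have finB: "finite (B i)" if "i \<in> I" for i
    using B fin [OF that] finite_subset by (auto simp: H_def)
  have single: "x = y" if i: "i \<in> I" and x: "x \<in> B i" and y: "y \<in> B i" for i x y
  proof (rule ccontr)
    assume "x \<noteq> y"
    have ex: "\<exists>J. finite J \<and> J \<subseteq> I \<and> i \<notin> J \<and> card (\<Union>(B ` J) \<union> (B i - {z})) \<le> card J"
      if z: "z \<in> B i" for z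
    proof -
      let ?B = "B(i := B i - {z})"
      have "?B \<noteq> B" using z by (metis Diff_iff fun_upd_same singletonI)
      hence "?B \<notin> H" using Bmin [of ?B] by (metis Diff_subset fun_upd_apply order_refl)
      moreover have "\<forall>j. ?B j \<subseteq> A j" using B by (auto simp: H_def)
      ultimately obtain K where K: "finite K" "K \<subseteq> I" "card (\<Union>(?B ` K)) < card K"
        unfolding H_def by (auto simp: not_le)
      have iK: "i \<in> K"
      proof (rule ccontr)
        assume "i \<notin> K"
        hence "\<Union>(?B ` K) = \<Union>(B ` K)" by auto
        thus False using K Bh [of K] by simp
      qed
      have "\<Union>(?B ` K) = \<Union>(B ` (K - {i})) \<union> (B i - {z})" using iK by (auto split: if_splits)
      thus ?thesis using K iK by (intro exI [of _ "K - {i}"]) auto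
    qed
    obtain J where J: "finite J" "J \<subseteq> I" "i \<notin> J" "card (\<Union>(B ` J) \<union> (B i - {x})) \<le> card J"
      using ex [OF x] by blast
    obtain K where K: "finite K" "K \<subseteq> I" "i \<notin> K" "card (\<Union>(B ` K) \<union> (B i - {y})) \<le> card K"
      using ex [OF y] by blast
    let ?P = "\<Union>(B ` J) \<union> (B i - {x})" and ?Q = "\<Union>(B ` K) \<union> (B i - {y})"
    have fP: "finite ?P" "finite ?Q" using J K finB i by auto
    have "card (insert i (J \<union> K)) \<le> card (\<Union>(B ` insert i (J \<union> K)))"
      using J K i by (intro Bh) auto
    also have "\<Union>(B ` insert i (J \<union> K)) = ?P \<union> ?Q" using \<open>x \<noteq> y\<close> by auto
    finally have 1: "Suc (card (J \<union> K)) \<le> card (?P \<union> ?Q)" using J K by simp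
    have "card (J \<inter> K) \<le> card (\<Union>(B ` (J \<inter> K)))" using J K by (intro Bh) auto
    also have "\<dots> \<le> card (?P \<inter> ?Q)" using fP by (intro card_mono) auto
    finally have 2: "card (J \<inter> K) \<le> card (?P \<inter> ?Q)" .
    show False
      using 1 2 card_Un_Int [OF fP] card_Un_Int [OF J(1) K(1)] J(4) K(4) by linarith
  qed
  define f where "f i = (SOME x. x \<in> B i)" for i
  have f: "f i \<in> B i" if "i \<in> I" for i
  proof -
    have "B i \<noteq> {}" using Bh [of "{i}"] that by auto
    thus ?thesis unfolding f_def by (metis ex_in_conv someI)
  qed
  have "inj_on f I"
  proof (rule inj_onI, rule ccontr)
    fix i j assume ij: "i \<in> I" "j \<in> I" "f i = f j" "i \<noteq> j"
    have "B i = {f i}" "B j = {f i}" using single f ij by fastforce+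
    thus False using Bh [of "{i, j}"] ij by simp
  qed
  moreover have "f i \<in> A i" if "i \<in> I" for i using f [OF that] B by (auto simp: H_def)
  ultimately show ?thesis by blast
qed

text \<open>Give every index the same \<open>d\<close> dummy values in addition. Hall's condition
  then holds exactly, and injectivity lets at most \<open>d\<close> indices receive a dummy.\<close>

lemma hall_deficiency:
  fixes A :: "'i \<Rightarrow> 'b set"
  assumes I: "finite I" and fin: "\<And>i. i \<in> I \<Longrightarrow> finite (A i)"
    and hall: "\<And>J. J \<subseteq> I \<Longrightarrow> card J \<le> card (\<Union>(A ` J)) + d"
  shows "\<exists>f D. D \<subseteq> I \<and> card (I - D) \<le> d \<and> inj_on f D \<and> (\<forall>i\<in>D. f i \<in> A i)"
proof -
  have "\<exists>f. inj_on f I \<and> (\<forall>i\<in>I. f i \<in> A i <+> {..<d})"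
  proof (rule hall_infinite)
    fix J assume J: "finite J" "J \<subseteq> I"
    show "card J \<le> card (\<Union>i\<in>J. A i <+> {..<d})"
    proof (cases "J = {}")
      case False
      hence "(\<Union>i\<in>J. A i <+> {..<d}) = \<Union>(A ` J) <+> {..<d}" by auto
      moreover have "finite (\<Union>(A ` J))" using J fin by auto
      ultimately show ?thesis using hall [OF J(2)] by (simp add: card_Plus)
    qed simp
  qed (use fin in simp)
  then obtain f where f: "inj_on f I" "\<And>i. i \<in> I \<Longrightarrow> f i \<in> A i <+> {..<d}" by blast
  define D where "D = {i \<in> I. f i \<in> range Inl}"
  have "f ` (I - D) \<subseteq> Inr ` {..<d}" using f(2) by (fastforce simp: D_def)
  hence "card (f ` (I - D)) \<le> card (Inr ` {..<d} :: ('b + nat) set)" by (intro card_mono) auto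
  hence "card (I - D) \<le> d"
    using card_image [of f "I - D"] inj_on_subset [OF f(1)] by (simp add: card_image)
  moreover have "inj_on (projl \<circ> f) D"
    using f(1) by (intro inj_onI) (force simp: D_def inj_on_def)
  moreover have "(projl \<circ> f) i \<in> A i" if "i \<in> D" for i
    using f(2) [of i] that by (auto simp: D_def)
  ultimately show ?thesis
    by (intro exI [of _ "projl \<circ> f"] exI [of _ D]) (auto simp: D_def)
qed

text \<open>Schroeder-Bernstein in Banach's form. The pointwise description of \<open>h\<close> is
  what matters later: if \<open>f\<close> and \<open>g\<close> move points by a bounded amount, so
  does \<open>h\<close>.\<close>

lemma banach_mapping:
  assumes f: "inj_on f P" "f ` P \<subseteq> Q" and g: "inj_on g Q" "g ` Q \<subseteq> P"
  shows "\<exists>h. bij_betw h P Q \<and> (\<forall>x\<in>P. h x = f x \<or> (h x \<in> Q \<and> g (h x) = x))"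
proof -
  define A where "A = lfp (\<lambda>A. P - g ` (Q - f ` A))"
  have "mono (\<lambda>A. P - g ` (Q - f ` A))" by (intro monoI) blast
  hence A: "A = P - g ` (Q - f ` A)" unfolding A_def by (rule lfp_unfold)
  have PA: "P - A = g ` (Q - f ` A)" using A g(2) by blast
  have AP: "A \<subseteq> P" using A by blast
  define h where "h x = (if x \<in> A then f x else inv_into Q g x)" for x
  have g1: "inv_into Q g ` (P - A) = Q - f ` A"
  proof -
    have "inv_into Q g (g y) = y" if "y \<in> Q - f ` A" for y using g(1) that by simp
    thus ?thesis unfolding PA by (simp add: image_image)
  qed
  have "bij_betw h A (f ` A)"
    using inj_on_subset [OF f(1) AP] by (auto simp: bij_betw_def h_def inj_on_def)
  moreover have "bij_betw h (P - A) (Q - f ` A)"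
  proof -
    have "inj_on (inv_into Q g) (P - A)" by (rule inj_on_inv_into) (use PA in blast)
    thus ?thesis using g1 by (auto simp: bij_betw_def h_def inj_on_def image_def)
  qed
  ultimately have "bij_betw h (A \<union> (P - A)) (f ` A \<union> (Q - f ` A))"
    by (rule bij_betw_combine) blast
  moreover have "A \<union> (P - A) = P" "f ` A \<union> (Q - f ` A) = Q" using AP f(2) by auto
  moreover have "h x = f x \<or> (h x \<in> Q \<and> g (h x) = x)" if "x \<in> P" for x
  proof (cases "x \<in> A")
    case False
    hence "x \<in> g ` Q" using PA that by blast
    thus ?thesis using False by (simp add: h_def inv_into_into f_inv_into_f)
  qed (simp add: h_def)
  ultimately show ?thesis by metis
qed

section \<open>Means on spaces of functions\<close>

text \<open>Subspaces are sets of functions because means on \<open>RUC_b\<close> and on all bounded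
  functions over the same group are both constructed.\<close>

definition fun_subspace :: "('x \<Rightarrow> real) set \<Rightarrow> bool" where
  "fun_subspace V \<longleftrightarrow> V \<noteq> {} \<and> (\<forall>f\<in>V. \<forall>g\<in>V. (\<lambda>x. f x + g x) \<in> V) \<and> (\<forall>c. \<forall>f\<in>V. (\<lambda>x. c * f x) \<in> V)"

definition sublinear_on :: "('x \<Rightarrow> real) set \<Rightarrow> (('x \<Rightarrow> real) \<Rightarrow> real) \<Rightarrow> bool" where
  "sublinear_on V p \<longleftrightarrow> (\<forall>f\<in>V. \<forall>g\<in>V. p (\<lambda>x. f x + g x) \<le> p f + p g) \<and>
     (\<forall>c\<ge>0. \<forall>f\<in>V. p (\<lambda>x. c * f x) = c * p f)"

definition linear_on :: "('x \<Rightarrow> real) set \<Rightarrow> (('x \<Rightarrow> real) \<Rightarrow> real) \<Rightarrow> bool" where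
  "linear_on V m \<longleftrightarrow> (\<forall>f\<in>V. \<forall>g\<in>V. m (\<lambda>x. f x + g x) = m f + m g) \<and>
     (\<forall>c. \<forall>f\<in>V. m (\<lambda>x. c * f x) = c * m f)"

definition mean_on :: "('x \<Rightarrow> real) set \<Rightarrow> (('x \<Rightarrow> real) \<Rightarrow> real) \<Rightarrow> bool" where
  "mean_on V m \<longleftrightarrow> linear_on V m \<and> (\<forall>f\<in>V. (\<forall>x. f x \<ge> 0) \<longrightarrow> m f \<ge> 0) \<and> m (\<lambda>x. 1) = 1"

lemma fun_subspaceD:
  assumes "fun_subspace V"
  shows "f \<in> V \<Longrightarrow> g \<in> V \<Longrightarrow> (\<lambda>x. f x + g x) \<in> V"
    and "f \<in> V \<Longrightarrow> (\<lambda>x. c * f x) \<in> V"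
    and "f \<in> V \<Longrightarrow> (\<lambda>x. - f x) \<in> V"
    and "f \<in> V \<Longrightarrow> g \<in> V \<Longrightarrow> (\<lambda>x. f x - g x) \<in> V"
    and "(\<lambda>x. 0) \<in> V"
proof -
  have add: "(\<lambda>x. f x + g x) \<in> V" if "f \<in> V" "g \<in> V" for f g
    using assms that by (auto simp: fun_subspace_def)
  have scale: "(\<lambda>x. c * f x) \<in> V" if "f \<in> V" for f c
    using assms that by (auto simp: fun_subspace_def)
  have neg: "(\<lambda>x. - f x) \<in> V" if "f \<in> V" for f using scale [OF that, of "-1"] by simp
  show "f \<in> V \<Longrightarrow> g \<in> V \<Longrightarrow> (\<lambda>x. f x + g x) \<in> V" by (rule add)
  show "f \<in> V \<Longrightarrow> (\<lambda>x. c * f x) \<in> V" by (rule scale)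
  show "f \<in> V \<Longrightarrow> (\<lambda>x. - f x) \<in> V" by (rule neg)
  show "f \<in> V \<Longrightarrow> g \<in> V \<Longrightarrow> (\<lambda>x. f x - g x) \<in> V"
    using add [of f "\<lambda>x. - g x"] neg [of g] by simp
  obtain f where "f \<in> V" using assms by (auto simp: fun_subspace_def)
  thus "(\<lambda>x. 0) \<in> V" using scale [of f 0] by simp
qed

lemma sublinear_onD:
  assumes "sublinear_on V p"
  shows "f \<in> V \<Longrightarrow> g \<in> V \<Longrightarrow> p (\<lambda>x. f x + g x) \<le> p f + p g"
    and "f \<in> V \<Longrightarrow> c \<ge> 0 \<Longrightarrow> p (\<lambda>x. c * f x) = c * p f"
  using assms by (auto simp: sublinear_on_def)

lemma sublinear_zero:
  assumes "fun_subspace V" "sublinear_on V p"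
  shows "p (\<lambda>x. 0) = 0"
  using sublinear_onD(2) [OF assms(2) fun_subspaceD(5) [OF assms(1)], of 0] by simp

lemma sublinear_neg:
  assumes "fun_subspace V" "sublinear_on V p" "f \<in> V"
  shows "- p (\<lambda>x. - f x) \<le> p f"
  using sublinear_onD(1) [OF assms(2,3) fun_subspaceD(3) [OF assms(1,3)]]
    sublinear_zero [OF assms(1,2)] by simp

lemma linear_on_add:
  "linear_on V m \<Longrightarrow> f \<in> V \<Longrightarrow> g \<in> V \<Longrightarrow> m (\<lambda>x. f x + g x) = m f + m g"
  by (auto simp: linear_on_def)

lemma linear_on_scale: "linear_on V m \<Longrightarrow> f \<in> V \<Longrightarrow> m (\<lambda>x. c * f x) = c * m f"
  by (auto simp: linear_on_def)

lemma linear_on_zero: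
  assumes "fun_subspace V" "linear_on V m"
  shows "m (\<lambda>x. 0) = 0"
  using linear_on_scale [OF assms(2) fun_subspaceD(5) [OF assms(1)], of 0] by simp

lemma linear_on_diff:
  assumes "fun_subspace V" "linear_on V m" "f \<in> V" "g \<in> V"
  shows "m (\<lambda>x. f x - g x) = m f - m g"
  using linear_on_add [OF assms(2) fun_subspaceD(4) [OF assms(1,3,4)] assms(4)] by simp

lemma linear_on_sum:
  assumes V: "fun_subspace V" and m: "linear_on V m" and f: "\<And>i. i \<in> I \<Longrightarrow> f i \<in> V"
  shows "m (\<lambda>x. \<Sum>i\<in>I. f i x) = (\<Sum>i\<in>I. m (f i))" "(\<lambda>x. \<Sum>i\<in>I. f i x) \<in> V"
proof -
  have "m (\<lambda>x. \<Sum>i\<in>I. f i x) = (\<Sum>i\<in>I. m (f i)) \<and> (\<lambda>x. \<Sum>i\<in>I. f i x) \<in> V"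
    using f
  proof (induction I rule: infinite_finite_induct)
    case (insert i I)
    hence IH: "m (\<lambda>x. \<Sum>i\<in>I. f i x) = (\<Sum>i\<in>I. m (f i))" "(\<lambda>x. \<Sum>i\<in>I. f i x) \<in> V" by auto
    have "(\<lambda>x. \<Sum>i\<in>insert i I. f i x) = (\<lambda>x. f i x + (\<Sum>i\<in>I. f i x))" using insert by auto
    thus ?case
      using insert.hyps IH linear_on_add [OF m insert.prems [OF insertI1] IH(2)]
        fun_subspaceD(1) [OF V insert.prems [OF insertI1] IH(2)] by simp
  qed (use linear_on_zero [OF V m] fun_subspaceD(5) [OF V] in simp_all)
  thus "m (\<lambda>x. \<Sum>i\<in>I. f i x) = (\<Sum>i\<in>I. m (f i))" "(\<lambda>x. \<Sum>i\<in>I. f i x) \<in> V" by blast+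
qed

definition bounded_funs :: "('x \<Rightarrow> real) set" where
  "bounded_funs = {f. bounded (range f)}"

lemma bounded_funsI: "(\<And>x. \<bar>f x\<bar> \<le> B) \<Longrightarrow> f \<in> bounded_funs"
  by (auto simp: bounded_funs_def bounded_iff)

lemma bounded_funsE:
  assumes "f \<in> bounded_funs" obtains B where "\<And>x. \<bar>f x\<bar> \<le> B" "B \<ge> 0"
proof -
  obtain B where "\<forall>x. \<bar>f x\<bar> \<le> B" using assms by (auto simp: bounded_funs_def bounded_iff)
  moreover have "\<bar>f undefined\<bar> \<ge> 0" by simp
  ultimately show ?thesis using that [of B] by (meson order_trans)
qed

lemma bounded_funs_const: "(\<lambda>x. c) \<in> bounded_funs"
  by (rule bounded_funsI [of _ "\<bar>c\<bar>"]) simp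

lemma bounded_funs_comp: "f \<in> bounded_funs \<Longrightarrow> (\<lambda>x. f (h x)) \<in> bounded_funs"
  by (auto elim!: bounded_funsE intro: bounded_funsI)

lemma bounded_funs_restrict: "f \<in> bounded_funs \<Longrightarrow> (\<lambda>x. if P x then f x else 0) \<in> bounded_funs"
proof -
  assume "f \<in> bounded_funs"
  then obtain B where "\<And>x. \<bar>f x\<bar> \<le> B" "B \<ge> 0" using bounded_funsE by blast
  thus ?thesis by (intro bounded_funsI [of _ B]) auto
qed

lemma fun_subspace_bounded_funs: "fun_subspace bounded_funs"
  unfolding fun_subspace_def
proof (intro conjI ballI allI)
  show "bounded_funs \<noteq> {}" using bounded_funs_const by blast
  fix f g :: "'a \<Rightarrow> real" and c assume fg: "f \<in> bounded_funs"
  obtain B where B: "\<And>x. \<bar>f x\<bar> \<le> B" using bounded_funsE [OF fg] by blast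
  show "(\<lambda>x. c * f x) \<in> bounded_funs"
    by (rule bounded_funsI [of _ "\<bar>c\<bar> * B"]) (simp add: abs_mult B mult_left_mono)
  assume "g \<in> bounded_funs"
  then obtain D where D: "\<And>x. \<bar>g x\<bar> \<le> D" by (rule bounded_funsE) blast
  show "(\<lambda>x. f x + g x) \<in> bounded_funs"
  proof (rule bounded_funsI [of _ "B + D"])
    show "\<bar>f x + g x\<bar> \<le> B + D" for x using B [of x] D [of x] by linarith
  qed
qed

lemma mean_on_mono:
  assumes V: "fun_subspace V" and m: "mean_on V m" and fg: "f \<in> V" "g \<in> V" "\<And>x. f x \<le> g x"
  shows "m f \<le> m g"
proof -
  have "m (\<lambda>x. g x - f x) \<ge> 0"
    using m fun_subspaceD(4) [OF V fg(2,1)] fg(3) by (auto simp: mean_on_def)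
  moreover have "m (\<lambda>x. g x - f x) = m g - m f"
    using m fg by (intro linear_on_diff [OF V]) (auto simp: mean_on_def)
  ultimately show ?thesis by simp
qed

lemma bounded_funs_uniform_bound:
  assumes "finite S" "S \<subseteq> bounded_funs"
  shows "\<exists>B\<ge>0. \<forall>f\<in>S. \<forall>x. \<bar>f x\<bar> \<le> B"
  using assms
proof (induction S)
  case (insert f S)
  then obtain B where B: "B \<ge> 0" "\<forall>f\<in>S. \<forall>x. \<bar>f x\<bar> \<le> B" by auto
  have "f \<in> bounded_funs" using insert.prems by simp
  then obtain D where D: "\<And>x. \<bar>f x\<bar> \<le> D" by (rule bounded_funsE) blast
  show ?case
    using B D by (intro exI [of _ "max B D"]) (auto simp: le_max_iff_disj)
qed (auto intro: exI [of _ 0])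

text \<open>An infimum of functionals is subadditive when any two parameters can be merged into one
  that serves the sum. This covers the infimum of a chain, the infimum over \<open>t\<close> in
  \<open>hahn_banach\<close> and the infimum over a cone in \<open>mean_exists\<close>.\<close>

lemma sublinear_on_INF:
  assumes V: "fun_subspace V" and A: "A \<noteq> {}"
    and lower: "\<And>f. f \<in> V \<Longrightarrow> \<exists>b. \<forall>a\<in>A. b \<le> F f a"
    and add: "\<And>f g a b. f \<in> V \<Longrightarrow> g \<in> V \<Longrightarrow> a \<in> A \<Longrightarrow> b \<in> A \<Longrightarrow>
      \<exists>c\<in>A. F (\<lambda>x. f x + g x) c \<le> F f a + F g b"
    and scale: "\<And>f a t. f \<in> V \<Longrightarrow> a \<in> A \<Longrightarrow> t > 0 \<Longrightarrow> \<exists>b\<in>A. F (\<lambda>x. t * f x) b \<le> t * F f a"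
  shows "sublinear_on V (\<lambda>f. INF a\<in>A. F f a :: real)"
proof -
  define q where "q f = (INF a\<in>A. F f a)" for f
  have le: "q f \<le> F f a" if f: "f \<in> V" and a: "a \<in> A" for f a
  proof -
    obtain b where "\<forall>a\<in>A. b \<le> F f a" using lower [OF f] by blast
    hence "bdd_below (F f ` A)" by (intro bdd_belowI [of _ b]) auto
    thus ?thesis unfolding q_def using a by (intro cINF_lower)
  qed
  have add': "q (\<lambda>x. f x + g x) \<le> q f + q g" if fg: "f \<in> V" "g \<in> V" for f g
  proof -
    have *: "q (\<lambda>x. f x + g x) \<le> F f a + F g b" if "a \<in> A" "b \<in> A" for a b
      using add [OF fg that] le [OF fun_subspaceD(1) [OF V fg]] by (meson order_trans)
    have "q (\<lambda>x. f x + g x) - F g b \<le> q f" if "b \<in> A" for b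
      unfolding q_def [of f] using A *[OF _ that] by (intro cINF_greatest) (auto simp: algebra_simps)
    hence "q (\<lambda>x. f x + g x) - q f \<le> q g"
      unfolding q_def [of g] using A by (intro cINF_greatest) (auto simp: algebra_simps)
    thus ?thesis by simp
  qed
  have scale': "q (\<lambda>x. t * f x) \<le> t * q f" if f: "f \<in> V" and t: "t > 0" for f t
  proof -
    have "q (\<lambda>x. t * f x) \<le> t * F f a" if "a \<in> A" for a
      using scale [OF f that t] le [OF fun_subspaceD(2) [OF V f]] by (meson order_trans)
    hence "q (\<lambda>x. t * f x) / t \<le> q f"
      unfolding q_def [of f] using A t by (intro cINF_greatest) (auto simp: field_simps)
    thus ?thesis using t by (simp add: field_simps)
  qed
  \<comment> \<open>The factor 2 gives \<open>q 0 \<le> 2 * q 0\<close>, hence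
    \<open>q 0 \<ge> 0\<close>; the factor 1/2 gives the other inequality.\<close>
  have zero: "q (\<lambda>x. 0) = 0"
    using scale' [OF fun_subspaceD(5) [OF V], of 2] scale' [OF fun_subspaceD(5) [OF V], of "1/2"] by simp
  have "q (\<lambda>x. t * f x) = t * q f" if f: "f \<in> V" and t: "t \<ge> 0" for f t
  proof (cases "t = 0")
    case False
    hence t: "t > 0" using t by simp
    hence "q f \<le> (1/t) * q (\<lambda>x. t * f x)"
      using scale' [OF fun_subspaceD(2) [OF V f, of t], of "1/t"] by simp
    thus ?thesis using scale' [OF f t] t by (simp add: field_simps)
  qed (simp add: zero)
  thus ?thesis using add' unfolding sublinear_on_def q_def by blast
qed

section \<open>The Hahn-Banach theorem\<close>

lemma minimal_sublinear_below:
  assumes V: "fun_subspace V" and p: "sublinear_on V p"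
  shows "\<exists>q. sublinear_on V q \<and> (\<forall>f\<in>V. q f \<le> p f) \<and>
    (\<forall>r. sublinear_on V r \<longrightarrow> (\<forall>f\<in>V. r f \<le> q f) \<longrightarrow> (\<forall>f\<in>V. r f = q f))"
proof -
  \<comment> \<open>Normalising to 0 outside \<open>V\<close> turns comparison on \<open>V\<close>
    into comparison everywhere, so that minimality in the pointwise order is minimality on
    \<open>V\<close>.\<close>
  define S where "S = {q. sublinear_on V q \<and> (\<forall>f\<in>V. q f \<le> p f) \<and> (\<forall>f. f \<notin> V \<longrightarrow> q f = 0)}"
  have restr: "(\<lambda>f. if f \<in> V then q f else 0) \<in> S"
    if "sublinear_on V q" "\<forall>f\<in>V. q f \<le> p f" for q
    using that fun_subspaceD [OF V] by (auto simp: S_def sublinear_on_def)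
  have "\<exists>q\<in>S. \<forall>r\<in>S. (\<forall>f. r f \<le> q f) \<longrightarrow> r = q"
  proof (rule predicate_Zorn)
    show "partial_order_on S (relation_of (\<lambda>q r. \<forall>f. r f \<le> q f) S)"
      proof (rule partial_order_on_relation_ofI)
      fix q r s :: "('a \<Rightarrow> real) \<Rightarrow> real"
      assume "\<forall>f. r f \<le> q f" "\<forall>f. s f \<le> r f"
      thus "\<forall>f. s f \<le> q f" by (meson order_trans)
    qed (auto intro: antisym simp: fun_eq_iff)
  next
    fix \<C> assume \<C>: "\<C> \<in> Chains (relation_of (\<lambda>q r. \<forall>f. r f \<le> q f) S)"
    show "\<exists>u\<in>S. \<forall>q\<in>\<C>. \<forall>f. u f \<le> q f"
    proof (cases "\<C> = {}")
      case True
      thus ?thesis using restr [OF p] by auto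
    next
      case False
      have CS: "q \<in> S" if "q \<in> \<C>" for q using that \<C> by (auto simp: Chains_def relation_of_def)
      have tot: "(\<forall>f. q f \<le> r f) \<or> (\<forall>f. r f \<le> q f)" if "q \<in> \<C>" "r \<in> \<C>" for q r
        using \<C> that by (auto simp: Chains_def relation_of_def)
      have sub: "sublinear_on V q" if "q \<in> \<C>" for q using CS [OF that] by (auto simp: S_def)
      \<comment> \<open>This bound depends only on \<open>p\<close>, so it keeps the infimum of a
        chain finite.\<close>
      have lower: "- p (\<lambda>x. - f x) \<le> q f" if "q \<in> \<C>" "f \<in> V" for q f
      proof -
        have "q (\<lambda>x. - f x) \<le> p (\<lambda>x. - f x)"
          using CS [OF that(1)] fun_subspaceD(3) [OF V that(2)] by (auto simp: S_def)
        thus ?thesis using sublinear_neg [OF V sub [OF that(1)] that(2)] by linarith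
      qed
      define u where "u f = (INF q\<in>\<C>. q f)" for f
      have u0: "u f = 0" if "f \<notin> V" for f
      proof -
        have "(INF q\<in>\<C>. q f) = (INF q\<in>\<C>. 0)"
          using CS that by (intro INF_cong) (auto simp: S_def)
        thus ?thesis using False by (simp add: u_def)
      qed
      have bdd: "bdd_below ((\<lambda>q. q f) ` \<C>)" for f
      proof (cases "f \<in> V")
        case True thus ?thesis using lower by (intro bdd_belowI [of _ "- p (\<lambda>x. - f x)"]) auto
      next
        case F: False
        have "q f = 0" if "q \<in> \<C>" for q using CS [OF that] F by (auto simp: S_def)
        thus ?thesis by (intro bdd_belowI [of _ 0]) fastforce
      qed
      have ule: "u f \<le> q f" if "q \<in> \<C>" for q f
        unfolding u_def by (rule cINF_lower [OF bdd that])
      obtain q0 where q0: "q0 \<in> \<C>" using False by blast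
      have "sublinear_on V u"
        unfolding u_def
      proof (rule sublinear_on_INF [OF V False])
        fix f g q r assume fg: "f \<in> V" "g \<in> V" and qr: "q \<in> \<C>" "r \<in> \<C>"
        obtain s where s: "s \<in> \<C>" "s f \<le> q f" "s g \<le> r g" using tot [OF qr] qr by blast
        have "s (\<lambda>x. f x + g x) \<le> s f + s g" by (rule sublinear_onD(1) [OF sub [OF s(1)] fg])
        thus "\<exists>s\<in>\<C>. s (\<lambda>x. f x + g x) \<le> q f + r g" using s by (intro bexI [of _ s]) linarith+
      next
        show "\<exists>b. \<forall>q\<in>\<C>. b \<le> q f" if "f \<in> V" for f using lower that by blast
        show "\<exists>r\<in>\<C>. r (\<lambda>x. t * f x) \<le> t * q f" if "f \<in> V" "q \<in> \<C>" "t > 0" for f q t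
          using that sublinear_onD(2) [OF sub, of q f t] by (intro bexI [of _ q]) auto
      qed
      moreover have "u f \<le> p f" if "f \<in> V" for f
        using ule [OF q0, of f] CS [OF q0] that by (force simp: S_def)
      ultimately have "u \<in> S" using u0 by (auto simp: S_def)
      thus ?thesis using ule by blast
    qed
  qed
  then obtain q where q: "q \<in> S" and qmin: "\<And>r. r \<in> S \<Longrightarrow> (\<forall>f. r f \<le> q f) \<Longrightarrow> r = q" by blast
  show ?thesis
  proof (intro exI [of _ q] conjI allI impI)
    fix r assume r: "sublinear_on V r" "\<forall>f\<in>V. r f \<le> q f"
    let ?r = "\<lambda>f. if f \<in> V then r f else 0"
    have "\<forall>f\<in>V. r f \<le> p f" using r(2) q by (force simp: S_def)
    hence "?r \<in> S" using restr r(1) by blast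
    moreover have "\<forall>f. ?r f \<le> q f" using r(2) q by (auto simp: S_def)
    ultimately have "?r = q" using qmin by blast
    thus "\<forall>f\<in>V. r f = q f" by (simp add: fun_eq_iff split: if_splits)
  qed (use q in \<open>auto simp: S_def\<close>)
qed

text \<open>
  A minimal sublinear functional \<open>q\<close> is linear: it cannot exceed the sublinear functional
  \<open>f \<mapsto> INF t\<ge>0. q (f + t v) - t q v\<close>, hence it is superadditive.
\<close>

lemma hahn_banach:
  assumes V: "fun_subspace V" and p: "sublinear_on V p"
  shows "\<exists>m. linear_on V m \<and> (\<forall>f\<in>V. m f \<le> p f)"
proof -
  obtain q where q: "sublinear_on V q" and qp: "\<forall>f\<in>V. q f \<le> p f"
    and qmin: "\<And>r. sublinear_on V r \<Longrightarrow> (\<forall>f\<in>V. r f \<le> q f) \<Longrightarrow> (\<forall>f\<in>V. r f = q f)"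
    using minimal_sublinear_below [OF V p] by blast
  note VD = fun_subspaceD [OF V] and qD = sublinear_onD [OF q]
  have super: "q f + q v \<le> q (\<lambda>x. f x + v x)" if f: "f \<in> V" and v: "v \<in> V" for f v
  proof -
    define F where "F f t = q (\<lambda>x. f x + t * v x) - t * q v" for f t
    define r where "r f = (INF t\<in>{0..}. F f t)" for f
    have lower: "- q (\<lambda>x. - f x) \<le> F f t" if "f \<in> V" "t \<ge> 0" for f t
    proof -
      have "q (\<lambda>x. t * v x) = q (\<lambda>x. (f x + t * v x) + - f x)" by simp
      also have "\<dots> \<le> q (\<lambda>x. f x + t * v x) + q (\<lambda>x. - f x)"
        using that v by (intro qD VD)
      finally show ?thesis using qD(2) [OF v that(2)] by (simp add: F_def)
    qed
    have bdd: "bdd_below (F f ` {0..})" if "f \<in> V" for f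
      using lower [OF that] by (intro bdd_belowI [of _ "- q (\<lambda>x. - f x)"]) auto
    have rle: "r f \<le> F f t" if "f \<in> V" "t \<ge> 0" for f t
      unfolding r_def using that by (intro cINF_lower bdd) auto
    have "sublinear_on V r"
      unfolding r_def
    proof (rule sublinear_on_INF [OF V])
      fix f g and t s :: real assume fg: "f \<in> V" "g \<in> V" and ts: "t \<in> {0..}" "s \<in> {0..}"
      have "q (\<lambda>x. f x + g x + (t + s) * v x) = q (\<lambda>x. (f x + t * v x) + (g x + s * v x))"
        by (simp add: algebra_simps)
      hence "F (\<lambda>x. f x + g x) (t + s) \<le> F f t + F g s"
        using qD(1) [OF VD(1) [OF fg(1) VD(2) [OF v, of t]] VD(1) [OF fg(2) VD(2) [OF v, of s]]]
        by (simp add: F_def algebra_simps)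
      thus "\<exists>c\<in>{0..}. F (\<lambda>x. f x + g x) c \<le> F f t + F g s" using ts by (intro bexI [of _ "t + s"]) auto
    next
      fix f and t c :: real assume f: "f \<in> V" and t: "t \<in> {0..}" and c: "c > 0"
      have "q (\<lambda>x. c * f x + c * t * v x) = q (\<lambda>x. c * (f x + t * v x))"
        by (simp add: algebra_simps)
      also have "\<dots> = c * q (\<lambda>x. f x + t * v x)" using c f v by (intro qD VD) auto
      finally have "F (\<lambda>x. c * f x) (c * t) = c * F f t" by (simp add: F_def algebra_simps)
      thus "\<exists>b\<in>{0..}. F (\<lambda>x. c * f x) b \<le> c * F f t" using t c by (intro bexI [of _ "c * t"]) auto
    next
      show "\<exists>b. \<forall>t\<in>{0..}. b \<le> F f t" if "f \<in> V" for f using lower [OF that] by auto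
    qed simp
    \<comment> \<open>The parameter \<open>t = 0\<close> puts \<open>r\<close> below
      \<open>q\<close>; by minimality they agree, and \<open>t = 1\<close> then gives
      superadditivity.\<close>
    moreover have "r f \<le> q f" if "f \<in> V" for f
      using rle [OF that, of 0] by (simp add: F_def)
    ultimately have "r f = q f" using qmin f by blast
    thus ?thesis using rle [OF f, of 1] by (simp add: F_def)
  qed
  have add: "q (\<lambda>x. f x + g x) = q f + q g" if "f \<in> V" "g \<in> V" for f g
    using super [OF that] qD(1) [OF that] by linarith
  have neg: "q (\<lambda>x. - f x) = - q f" if "f \<in> V" for f
    using add [OF that VD(3) [OF that]] sublinear_zero [OF V q] by simp
  have "q (\<lambda>x. c * f x) = c * q f" if f: "f \<in> V" for c f
  proof (cases "c \<ge> 0")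
    case False
    have "q (\<lambda>x. c * f x) = - q (\<lambda>x. - c * f x)"
      using neg [OF VD(2) [OF f, of "- c"]] by simp
    thus ?thesis using qD(2) [OF f, of "- c"] False by simp
  qed (use qD(2) f in auto)
  thus ?thesis using add qp by (intro exI [of _ q]) (auto simp: linear_on_def)
qed

text \<open>
  Hahn--Banach is applied to \<open>f \<mapsto> INF c\<in>C. SUP x. f x + c x\<close>, which the condition on the cone \<open>C\<close>
  keeps finite.
\<close>

lemma mean_exists:
  assumes V: "fun_subspace V" and bnd: "\<And>f. f \<in> V \<Longrightarrow> bounded (range f)" and one: "(\<lambda>x. 1) \<in> V"
    and C: "C \<subseteq> V" "C \<noteq> {}" and Cadd: "\<And>f g. f \<in> C \<Longrightarrow> g \<in> C \<Longrightarrow> (\<lambda>x. f x + g x) \<in> C"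
    and Cscale: "\<And>c f. c \<ge> 0 \<Longrightarrow> f \<in> C \<Longrightarrow> (\<lambda>x. c * f x) \<in> C"
    and Csup: "\<And>f \<delta>. f \<in> C \<Longrightarrow> \<delta> > 0 \<Longrightarrow> \<exists>x. f x > - \<delta>"
  shows "\<exists>m. mean_on V m \<and> (\<forall>f\<in>C. m f \<ge> 0)"
proof -
  note VD = fun_subspaceD [OF V]
  have bddA: "bdd_above (range f)" if "f \<in> V" for f using bnd [OF that] by (rule bounded_imp_bdd_above)
  define F where "F h c = (SUP x. h x + c x)" for h c :: "'a \<Rightarrow> real"
  define p where "p h = (INF c\<in>C. F h c)" for h
  have Fub: "h x + c x \<le> F h c" if "h \<in> V" "c \<in> C" for h c x
    unfolding F_def using that C by (intro cSUP_upper bddA VD) auto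
  have Flub: "F h c \<le> b" if "\<And>x. h x + c x \<le> b" for h c b
    unfolding F_def using that by (intro cSUP_least) auto
  have zero: "(\<lambda>x. 0) \<in> C" using C(2) Cscale [of 0] by auto
  have sup0: "0 \<le> F (\<lambda>x. 0) c" if c: "c \<in> C" for c
  proof (rule ccontr)
    assume n: "\<not> 0 \<le> F (\<lambda>x. 0) c"
    then obtain x where "c x > F (\<lambda>x. 0) c" using Csup [OF c, of "- F (\<lambda>x. 0) c"] by auto
    thus False using Fub [OF VD(5) c, of x] by simp
  qed
  have lower: "\<exists>b. \<forall>c\<in>C. b \<le> F h c" if h: "h \<in> V" for h
  proof -
    obtain M where M: "\<And>x. \<bar>h x\<bar> \<le> M" using bnd [OF h] by (auto simp: bounded_iff)
    have "- M \<le> F h c" if c: "c \<in> C" for c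
    proof -
      have "F (\<lambda>x. 0) c \<le> F h c + M"
      proof (rule Flub)
        fix x show "0 + c x \<le> F h c + M" using Fub [OF h c, of x] M [of x] by linarith
      qed
      thus ?thesis using sup0 [OF c] by linarith
    qed
    thus ?thesis by blast
  qed
  have bdd: "bdd_below (F h ` C)" if "h \<in> V" for h
    using lower [OF that] by (auto intro: bdd_belowI)
  have ple: "p h \<le> F h c" if "h \<in> V" "c \<in> C" for h c
    unfolding p_def using that by (intro cINF_lower bdd)
  have "sublinear_on V p"
    unfolding p_def
  proof (rule sublinear_on_INF [OF V C(2) lower])
    fix f g c' d assume fg: "f \<in> V" "g \<in> V" and cd: "c' \<in> C" "d \<in> C"
    have "F (\<lambda>x. f x + g x) (\<lambda>x. c' x + d x) \<le> F f c' + F g d"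
    proof (rule Flub)
      fix x show "f x + g x + (c' x + d x) \<le> F f c' + F g d"
        using Fub [OF fg(1) cd(1), of x] Fub [OF fg(2) cd(2), of x] by linarith
    qed
    thus "\<exists>c\<in>C. F (\<lambda>x. f x + g x) c \<le> F f c' + F g d" using Cadd [OF cd] by blast
  next
    fix f c and t :: real assume f: "f \<in> V" and c: "c \<in> C" and t: "t > 0"
    have "F (\<lambda>x. t * f x) (\<lambda>x. t * c x) \<le> t * F f c"
    proof (rule Flub)
      fix x show "t * f x + t * c x \<le> t * F f c"
        using mult_left_mono [OF Fub [OF f c, of x], of t] t by (simp add: algebra_simps)
    qed
    thus "\<exists>b\<in>C. F (\<lambda>x. t * f x) b \<le> t * F f c" using Cscale [of t c] c t by force
  qed
  from hahn_banach [OF V this] obtain m where m: "linear_on V m" and mp: "\<And>f. f \<in> V \<Longrightarrow> m f \<le> p f"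
    by blast
  have mneg: "m (\<lambda>x. - f x) = - m f" if "f \<in> V" for f
  proof -
    have "m (\<lambda>x. (-1) * f x) = (-1) * m f" using m that unfolding linear_on_def by blast
    thus ?thesis by simp
  qed
  have msup: "m f \<le> b" if "f \<in> V" "\<And>x. f x \<le> b" for f b
    using mp [OF that(1)] ple [OF that(1) zero] Flub [of f "\<lambda>x. 0" b] that(2) by force
  have "m (\<lambda>x. 1) \<le> 1" by (rule msup [OF one]) simp
  moreover have "m (\<lambda>x. - 1) \<le> -1" by (rule msup [OF VD(3) [OF one]]) simp
  ultimately have "m (\<lambda>x. 1) = 1" using mneg [OF one] by simp
  moreover have "m f \<ge> 0" if "f \<in> V" "\<And>x. f x \<ge> 0" for f
  proof -
    have "m (\<lambda>x. - f x) \<le> 0" using that by (intro msup VD) auto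
    thus ?thesis using mneg [OF that(1)] by simp
  qed
  moreover have "m c \<ge> 0" if c: "c \<in> C" for c
  proof -
    have cV: "c \<in> V" using c C by blast
    \<comment> \<open>Testing \<open>p\<close> at \<open>- c\<close> with the cone element
      \<open>c\<close> itself leaves the supremum of the zero function.\<close>
    have "m (\<lambda>x. - c x) \<le> F (\<lambda>x. - c x) c" using mp [OF VD(3) [OF cV]] ple [OF VD(3) [OF cV] c] by simp
    also have "\<dots> = 0" by (simp add: F_def)
    finally show ?thesis using mneg [OF cV] by simp
  qed
  ultimately show ?thesis using m by (auto simp: mean_on_def)
qed

section \<open>Aperiodic three-to-one maps\<close>

definition periodic :: "('x \<Rightarrow> 'x) \<Rightarrow> 'x \<Rightarrow> bool" where
  "periodic \<pi> x \<longleftrightarrow> (\<exists>n>0. (\<pi> ^^ n) x = x)"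

lemma funpow_Suc_apply: "(f ^^ Suc n) x = (f ^^ n) (f x)"
  by (simp only: funpow_Suc_right comp_apply)

text \<open>With the common period \<open>n * m = Suc k\<close>, both points are recovered from
  their common image by the \<open>k\<close>-th iterate.\<close>

lemma periodic_unique_preimage:
  assumes "periodic \<pi> x" "periodic \<pi> y" "\<pi> x = \<pi> y"
  shows "x = y"
proof -
  obtain n m where n: "n > 0" "(\<pi> ^^ n) x = x" and m: "m > 0" "(\<pi> ^^ m) y = y"
    using assms by (auto simp: periodic_def)
  have "(\<pi> ^^ (n * m)) x = x"
    using n(2) by (induction m) (simp_all add: funpow_add)
  moreover have "(\<pi> ^^ (m * n)) y = y"
    using m(2) by (induction n) (simp_all add: funpow_add)
  moreover obtain k where k: "n * m = Suc k" "m * n = Suc k"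
    using n(1) m(1) by (metis gr0_implies_Suc mult.commute mult_pos_pos)
  ultimately have "(\<pi> ^^ Suc k) x = x" "(\<pi> ^^ Suc k) y = y" by metis+
  hence "(\<pi> ^^ k) (\<pi> x) = x" "(\<pi> ^^ k) (\<pi> y) = y" unfolding funpow_Suc_apply .
  thus ?thesis unfolding assms(3) by (rule trans [OF sym])
qed

lemma periodic_step:
  assumes "periodic \<pi> x"
  shows "periodic \<pi> (\<pi> x)"
proof -
  obtain n where n: "n > 0" "(\<pi> ^^ n) x = x" using assms by (auto simp: periodic_def)
  have "(\<pi> ^^ n) (\<pi> x) = \<pi> ((\<pi> ^^ n) x)" by (rule funpow_swap1 [symmetric])
  thus ?thesis using n unfolding periodic_def by auto
qed

lemma periodic_pred:
  assumes "periodic \<pi> x"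
  shows "\<exists>k. periodic \<pi> ((\<pi> ^^ k) x) \<and> \<pi> ((\<pi> ^^ k) x) = x"
proof -
  obtain n where n: "n > 0" "(\<pi> ^^ n) x = x" using assms by (auto simp: periodic_def)
  then obtain k where k: "n = Suc k" using gr0_implies_Suc by blast
  have "periodic \<pi> ((\<pi> ^^ k) x)" using assms by (induction k) (auto intro: periodic_step)
  moreover have "\<pi> ((\<pi> ^^ k) x) = x" using n k by simp
  ultimately show ?thesis by blast
qed

text \<open>
  A three-to-one map \<open>\<pi>\<close> becomes aperiodic without moving its values far: choose a
  non-periodic preimage \<open>f c\<close> of every periodic point \<open>c\<close> and iterate to get a ray
  \<open>c, f c, f (f c), \<dots>\<close> of successive preimages. Reverse the ray, so that it leads from \<open>c\<close> to
  infinity, and let the two other preimages of each point of the ray but \<open>c\<close> move one step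
  along the ray towards \<open>c\<close>, which makes up for the two preimages that \<open>c\<close> has lost.
\<close>

lemma aperiodic_three_to_one:
  assumes \<pi>: "\<pi> \<in> X \<rightarrow> X" and three: "\<And>x. x \<in> X \<Longrightarrow> card {y \<in> X. \<pi> y = x} = 3"
  shows "\<exists>\<rho>. \<rho> \<in> X \<rightarrow> X \<and> (\<forall>x\<in>X. card {y \<in> X. \<rho> y = x} = 3) \<and> (\<forall>x\<in>X. \<not> periodic \<rho> x) \<and>
    (\<forall>x\<in>X. \<rho> x = \<pi> x \<or> \<rho> x = \<pi> (\<pi> x) \<or> \<pi> (\<rho> x) = x)"
proof -
  define Ch where "Ch x = {y \<in> X. \<pi> y = x}" for x
  have Ch3: "card (Ch x) = 3" if "x \<in> X" for x using three [OF that] by (simp add: Ch_def)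
  have finCh: "finite (Ch x)" if "x \<in> X" for x using Ch3 [OF that] card.infinite by fastforce
  have "\<exists>y. y \<in> Ch x \<and> \<not> periodic \<pi> y" if x: "x \<in> X" for x
  proof (rule ccontr)
    assume "\<not> ?thesis"
    hence *: "\<forall>y\<in>Ch x. periodic \<pi> y" by blast
    have "y = z" if "y \<in> Ch x" "z \<in> Ch x" for y z
      by (rule periodic_unique_preimage [of \<pi>]) (use * that in \<open>auto simp: Ch_def\<close>)
    hence "card (Ch x) \<le> 1"
      unfolding One_nat_def card_le_Suc0_iff_eq [OF finCh [OF x]] by blast
    thus False using Ch3 [OF x] by simp
  qed
  hence "\<exists>f. \<forall>x\<in>X. f x \<in> Ch x \<and> \<not> periodic \<pi> (f x)" by (intro bchoice ballI)
  then obtain f where f: "\<And>x. x \<in> X \<Longrightarrow> f x \<in> Ch x" and fnp: "\<And>x. x \<in> X \<Longrightarrow> \<not> periodic \<pi> (f x)"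
    by blast
  have fX: "f x \<in> X" and \<pi>f: "\<pi> (f x) = x" if "x \<in> X" for x using f [OF that] by (auto simp: Ch_def)
  define C where "C = {x \<in> X. periodic \<pi> x}"
  define R where "R = {(f ^^ k) c | k c. c \<in> C}"
  have CX: "C \<subseteq> X" by (auto simp: C_def)
  have itX: "(f ^^ k) x \<in> X" if "x \<in> X" for k x using that fX by (induction k) auto
  have RX: "R \<subseteq> X" using itX CX by (auto simp: R_def)
  have CR: "C \<subseteq> R" unfolding R_def by (auto intro: exI [of _ 0])
  have fR: "f x \<in> R" if x: "x \<in> R" for x
  proof -
    obtain k c where "x = (f ^^ k) c" "c \<in> C" using x by (auto simp: R_def)
    hence "f x = (f ^^ Suc k) c" by simp
    thus ?thesis unfolding R_def using \<open>c \<in> C\<close> by blast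
  qed
  have fC: "f x \<notin> C" if "x \<in> X" for x using fnp [OF that] by (simp add: C_def)
  have RC: "\<pi> x \<in> R \<and> f (\<pi> x) = x" if x: "x \<in> R" "x \<notin> C" for x
  proof -
    obtain k c where k: "x = (f ^^ k) c" "c \<in> C" using x by (auto simp: R_def)
    then obtain l where l: "k = Suc l" using x(2) by (cases k) auto
    have "\<pi> x = (f ^^ l) c" using k l \<pi>f [OF itX] CX by auto
    thus ?thesis using k l unfolding R_def by auto
  qed
  have \<pi>X: "\<pi> x \<in> X" if "x \<in> X" for x using \<pi> that by auto
  have \<pi>C: "\<pi> x \<in> C" if "x \<in> C" for x using that \<pi>X periodic_step by (auto simp: C_def)
  have \<pi>R: "\<pi> x \<in> R" if "x \<in> R" for x using RC [OF that] \<pi>C CR by blast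
  define \<rho> where "\<rho> x = (if x \<in> R then f x else if \<pi> x \<in> R - C then \<pi> (\<pi> x) else \<pi> x)" for x
  have \<rho>X: "\<rho> x \<in> X" if "x \<in> X" for x using that \<pi>X fX by (auto simp: \<rho>_def)
  have card3: "card {y \<in> X. \<rho> y = x} = 3" if x: "x \<in> X" for x
  proof -
    have steal: "card (Ch (f x) - {f (f x)}) = 2"
      using Ch3 [OF fX [OF x]] finCh [OF fX [OF x]] f [OF fX [OF x]] by simp
    have stolen: "{y \<in> X. y \<notin> R \<and> \<pi> y \<in> R - C \<and> \<pi> (\<pi> y) = x} = Ch (f x) - {f (f x)}"
      if xR: "x \<in> R"
    proof (intro equalityI subsetI)
      fix y assume "y \<in> {y \<in> X. y \<notin> R \<and> \<pi> y \<in> R - C \<and> \<pi> (\<pi> y) = x}"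
      hence y: "y \<in> X" "y \<notin> R" "\<pi> y \<in> R" "\<pi> y \<notin> C" "\<pi> (\<pi> y) = x" by auto
      hence "\<pi> y = f x" using RC [OF y(3,4)] by simp
      moreover have "f (f x) \<in> R" using fR xR by blast
      ultimately show "y \<in> Ch (f x) - {f (f x)}" using y by (auto simp: Ch_def)
    next
      fix y assume y: "y \<in> Ch (f x) - {f (f x)}"
      have "y \<notin> R"
      proof
        assume yR: "y \<in> R"
        have "y \<notin> C" using y \<pi>C [of y] fC [OF x] by (auto simp: Ch_def)
        thus False using RC [OF yR] y by (auto simp: Ch_def)
      qed
      thus "y \<in> {y \<in> X. y \<notin> R \<and> \<pi> y \<in> R - C \<and> \<pi> (\<pi> y) = x}"
        using y fR [OF xR] fC [OF x] \<pi>f [OF x] by (auto simp: Ch_def)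
    qed
    consider "x \<in> C" | "x \<in> R" "x \<notin> C" | "x \<notin> R" using CR by blast
    thus ?thesis
    proof cases
      case 1
      hence xR: "x \<in> R" using CR by blast
      obtain k where k: "periodic \<pi> ((\<pi> ^^ k) x)" "\<pi> ((\<pi> ^^ k) x) = x"
        using periodic_pred [of \<pi> x] 1 by (auto simp: C_def)
      define d where "d = (\<pi> ^^ k) x"
      have d: "periodic \<pi> d" "\<pi> d = x" using k by (simp_all add: d_def)
      have dX: "d \<in> X" unfolding d_def using x \<pi>X by (induction k) auto
      have dC: "d \<in> C" using d dX by (simp add: C_def)
      \<comment> \<open>A periodic \<open>x\<close> loses its periodic preimage \<open>d\<close> and
        its ray successor \<open>f x\<close>, keeps one preimage, and gains the two that leave
        \<open>f x\<close>.\<close>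
      have eq: "{y \<in> X. \<rho> y = x} = (Ch x - {d, f x}) \<union> (Ch (f x) - {f (f x)})"
      proof -
        have "{y \<in> X. \<rho> y = x} = {y \<in> X. y \<notin> R \<and> \<pi> y = x} \<union> {y \<in> X. y \<notin> R \<and> \<pi> y \<in> R - C \<and> \<pi> (\<pi> y) = x}"
          using 1 fC RX by (auto simp: \<rho>_def)
        moreover have "{y \<in> X. y \<notin> R \<and> \<pi> y = x} = Ch x - {d, f x}"
        proof (intro equalityI subsetI)
          fix y assume "y \<in> {y \<in> X. y \<notin> R \<and> \<pi> y = x}"
          thus "y \<in> Ch x - {d, f x}" using dC CR fR [OF xR] by (auto simp: Ch_def)
        next
          fix y assume y: "y \<in> Ch x - {d, f x}"
          have "y \<notin> C" using y d periodic_unique_preimage [of \<pi> y d] by (auto simp: Ch_def C_def)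
          hence "y \<notin> R" using RC [of y] y by (auto simp: Ch_def)
          thus "y \<in> {y \<in> X. y \<notin> R \<and> \<pi> y = x}" using y by (auto simp: Ch_def)
        qed
        ultimately show ?thesis using stolen [OF xR] by simp
      qed
      have "f x \<noteq> d" using dC fC [OF x] by blast
      moreover have "d \<in> Ch x" "f x \<in> Ch x" using d dX f [OF x] by (auto simp: Ch_def)
      ultimately have "card (Ch x - {d, f x}) = 1"
        using Ch3 [OF x] finCh [OF x] by (simp add: card_Diff_subset)
      moreover have "(Ch x - {d, f x}) \<inter> (Ch (f x) - {f (f x)}) = {}"
        using fC [OF x] 1 by (auto simp: Ch_def)
      ultimately show ?thesis unfolding eq using steal finCh x fX
        by (subst card_Un_disjoint) auto
    next
      case 2
      have px: "\<pi> x \<in> R" "f (\<pi> x) = x" using RC 2 by auto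
      \<comment> \<open>None of the old preimages stays. The new ones are the predecessor
        \<open>\<pi> x\<close> on the ray and the two points that leave \<open>f x\<close>.\<close>
      have eq: "{y \<in> X. \<rho> y = x} = insert (\<pi> x) (Ch (f x) - {f (f x)})"
      proof -
        have "{y \<in> X. \<rho> y = x} = {y \<in> R. f y = x} \<union> {y \<in> X. y \<notin> R \<and> \<pi> y \<in> R - C \<and> \<pi> (\<pi> y) = x}"
          using 2 RX by (auto simp: \<rho>_def)
        moreover have "{y \<in> R. f y = x} = {\<pi> x}" using px \<pi>f RX by auto
        ultimately show ?thesis using stolen [OF 2(1)] by simp
      qed
      have "\<pi> x \<notin> Ch (f x)"
      proof
        assume "\<pi> x \<in> Ch (f x)"
        hence "\<pi> (\<pi> (\<pi> x)) = x" using \<pi>f [OF x] by (simp add: Ch_def)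
        hence "(\<pi> ^^ 3) x = x" by (simp add: numeral_3_eq_3)
        hence "x \<in> C" using x unfolding C_def periodic_def by (auto intro: exI [of _ 3])
        thus False using 2 by blast
      qed
      thus ?thesis unfolding eq using steal finCh fX x by simp
    next
      case 3
      have "{y \<in> X. \<rho> y = x} = Ch x"
      proof (intro equalityI subsetI)
        fix y assume y: "y \<in> {y \<in> X. \<rho> y = x}"
        show "y \<in> Ch x" using y 3 fR \<pi>R by (auto simp: \<rho>_def Ch_def split: if_splits)
      next
        fix y assume y: "y \<in> Ch x"
        hence "y \<notin> R" using \<pi>R [of y] 3 by (auto simp: Ch_def)
        thus "y \<in> {y \<in> X. \<rho> y = x}" using y 3 by (auto simp: Ch_def \<rho>_def)
      qed
      thus ?thesis using Ch3 [OF x] by simp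
    qed
  qed
  have aper: "\<not> periodic \<rho> x" if x: "x \<in> X" for x
  proof
    assume "periodic \<rho> x"
    then obtain n where n: "n > 0" "(\<rho> ^^ n) x = x" by (auto simp: periodic_def)
    have orbX: "(\<rho> ^^ k) x \<in> X" for k using x \<rho>X by (induction k) auto
    have orbit: "(\<rho> ^^ n) ((\<rho> ^^ k) x) = (\<rho> ^^ k) x" for k
      by (metis n(2) funpow_add add.commute comp_apply)
    \<comment> \<open>An orbit of \<open>\<rho>\<close> that meets a ray follows \<open>f\<close>
      for ever, and a return would make a value of \<open>f\<close> periodic for
      \<open>\<pi>\<close>. An orbit that avoids the rays is an orbit of \<open>\<pi>\<close>, so a
      return would put \<open>x\<close> into \<open>C\<close>, hence on a ray.\<close>
    show False
    proof (cases "\<exists>k. (\<rho> ^^ k) x \<in> R")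
      case True
      then obtain k where k: "(\<rho> ^^ k) x \<in> R" by blast
      define z where "z = (\<rho> ^^ k) x"
      have it: "(\<rho> ^^ m) z = (f ^^ m) z \<and> (f ^^ m) z \<in> R" for m
        using k fR by (induction m) (auto simp: z_def \<rho>_def)
      have retrace: "(\<pi> ^^ m) ((f ^^ m) z) = z" for m
      proof (induction m)
        case (Suc m)
        have "(\<pi> ^^ Suc m) ((f ^^ Suc m) z) = (\<pi> ^^ m) (\<pi> (f ((f ^^ m) z)))"
          unfolding funpow_Suc_apply [of m \<pi>] by simp
        also have "\<dots> = (\<pi> ^^ m) ((f ^^ m) z)" using \<pi>f it RX by (metis subsetD)
        finally show ?case using Suc by simp
      qed simp
      have fz: "(f ^^ n) z = z" using it [of n] orbit [of k] by (simp add: z_def)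
      hence "(\<pi> ^^ n) z = z" using retrace [of n] by simp
      hence "z \<in> C" using n(1) k RX by (auto simp: C_def periodic_def z_def)
      moreover obtain l where "n = Suc l" using n(1) gr0_implies_Suc by blast
      hence "z = f ((f ^^ l) z)" using fz by simp
      hence "z \<notin> C" using fC it RX by (metis subsetD)
      ultimately show False by blast
    next
      case False
      have step: "\<rho> ((\<rho> ^^ k) x) = \<pi> ((\<rho> ^^ k) x)" for k
      proof -
        have "(\<rho> ^^ k) x \<notin> R" using False by blast
        moreover have "\<pi> ((\<rho> ^^ k) x) \<notin> R - C"
        proof
          assume a: "\<pi> ((\<rho> ^^ k) x) \<in> R - C"
          hence "(\<rho> ^^ Suc k) x = \<pi> (\<pi> ((\<rho> ^^ k) x))" using False by (simp add: \<rho>_def)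
          hence "(\<rho> ^^ Suc k) x \<in> R" using a \<pi>R by simp
          thus False using False by blast
        qed
        ultimately show ?thesis by (auto simp: \<rho>_def)
      qed
      have "(\<rho> ^^ k) x = (\<pi> ^^ k) x" for k
      proof (induction k)
        case (Suc k)
        have "(\<rho> ^^ Suc k) x = \<pi> ((\<rho> ^^ k) x)" using step [of k] by simp
        thus ?case using Suc by simp
      qed simp
      hence "x \<in> C" using n x by (auto simp: C_def periodic_def)
      hence "(\<rho> ^^ 0) x \<in> R" using CR by auto
      thus False using False by blast
    qed
  qed
  have "\<rho> x = \<pi> x \<or> \<rho> x = \<pi> (\<pi> x) \<or> \<pi> (\<rho> x) = x" if "x \<in> X" for x
    using \<pi>f that by (auto simp: \<rho>_def)
  thus ?thesis using \<rho>X card3 aper by (intro exI [of _ \<rho>]) auto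
qed

lemma aperiodic_funpow_inj:
  assumes "\<forall>x\<in>X. \<not> periodic \<pi> x" "\<pi> \<in> X \<rightarrow> X" "x \<in> X" "(\<pi> ^^ m) x = (\<pi> ^^ n) x"
  shows "m = n"
proof -
  have X: "(\<pi> ^^ k) x \<in> X" for k using assms(2,3) by (induction k) auto
  have *: False if "i < j" "(\<pi> ^^ i) x = (\<pi> ^^ j) x" for i j
  proof -
    have "(\<pi> ^^ (j - i)) ((\<pi> ^^ i) x) = (\<pi> ^^ i) x"
      using that by (metis funpow_add comp_apply le_add_diff_inverse2 less_imp_le)
    moreover have "j - i > 0" using that(1) by simp
    ultimately show False using assms(1) X [of i] unfolding periodic_def by blast
  qed
  show ?thesis using * [of m n] * [of n m] assms(4) by (metis linorder_neqE_nat)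
qed

text \<open>
  The weights are summed along the orbit of \<open>x\<close> up to a common point with the orbit of the
  point chosen in the tree of \<open>x\<close>, and down again to the chosen point.
\<close>

lemma aperiodic_potential:
  fixes w :: "'x \<Rightarrow> int"
  assumes \<pi>: "\<pi> \<in> X \<rightarrow> X" and ap: "\<forall>x\<in>X. \<not> periodic \<pi> x"
  shows "\<exists>c. \<forall>x\<in>X. c x = c (\<pi> x) + w x"
proof -
  define E where "E x y \<longleftrightarrow> (\<exists>m n. (\<pi> ^^ m) x = (\<pi> ^^ n) y)" for x y
  define b where "b x = (SOME y. y \<in> X \<and> E x y)" for x
  have Eself: "E x x" for x unfolding E_def by blast
  have Estep: "E (\<pi> x) y \<longleftrightarrow> E x y" for x y
  proof
    assume "E (\<pi> x) y"
    then obtain m n where "(\<pi> ^^ m) (\<pi> x) = (\<pi> ^^ n) y" by (auto simp: E_def)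
    hence "(\<pi> ^^ Suc m) x = (\<pi> ^^ n) y" by (simp only: funpow_Suc_apply)
    thus "E x y" unfolding E_def by blast
  next
    assume "E x y"
    then obtain m n where "(\<pi> ^^ m) x = (\<pi> ^^ n) y" by (auto simp: E_def)
    hence "(\<pi> ^^ Suc m) x = (\<pi> ^^ Suc n) y" by simp
    hence "(\<pi> ^^ m) (\<pi> x) = (\<pi> ^^ Suc n) y" by (simp only: funpow_Suc_apply [of m])
    thus "E (\<pi> x) y" unfolding E_def by blast
  qed
  have b\<pi>: "b (\<pi> x) = b x" for x by (simp add: b_def Estep)
  have b: "b x \<in> X \<and> E x (b x)" if "x \<in> X" for x
    unfolding b_def by (rule someI [of _ x]) (use that Eself in blast)
  define S where "S x m = (\<Sum>j<m. w ((\<pi> ^^ j) x))" for x m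
  have S_add: "S x (m + k) = S x m + S ((\<pi> ^^ m) x) k" for x m k
    by (induction k) (simp_all add: S_def funpow_add add.commute)
  \<comment> \<open>The value does not depend on the meeting point: by aperiodicity a later meeting
    point lengthens both orbits by the same \<open>k\<close>, and the added sums agree.\<close>
  have uniq: "S x m - S y n = S x m' - S y n'"
    if x: "x \<in> X" and y: "y \<in> X" and mn: "(\<pi> ^^ m) x = (\<pi> ^^ n) y" "(\<pi> ^^ m') x = (\<pi> ^^ n') y"
      and le: "m \<le> m'" for x y m n m' n'
  proof -
    obtain k where k: "m' = m + k" using le nat_le_iff_add by blast
    have "(\<pi> ^^ n') y = (\<pi> ^^ (n + k)) y"
      using mn k by (metis funpow_add add.commute comp_apply)
    hence n': "n' = n + k" by (rule aperiodic_funpow_inj [OF ap \<pi> y])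
    show ?thesis using S_add [of x m k] S_add [of y n k] mn(1) by (simp add: k n')
  qed
  define P where "P x z \<longleftrightarrow> (\<exists>m n. (\<pi> ^^ m) x = (\<pi> ^^ n) (b x) \<and> z = S x m - S (b x) n)" for x z
  define c where "c x = (THE z. P x z)" for x
  have c: "c x = S x m - S (b x) n" if x: "x \<in> X" and mn: "(\<pi> ^^ m) x = (\<pi> ^^ n) (b x)" for x m n
    unfolding c_def
  proof (rule the_equality)
    show "P x (S x m - S (b x) n)" using mn by (auto simp: P_def)
  next
    fix z assume "P x z"
    then obtain m' n' where mn': "(\<pi> ^^ m') x = (\<pi> ^^ n') (b x)" "z = S x m' - S (b x) n'"
      by (auto simp: P_def)
    show "z = S x m - S (b x) n"
      using uniq [OF x _ mn mn'(1)] uniq [OF x _ mn'(1) mn] b [OF x] mn'(2) by (cases "m \<le> m'") auto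
  qed
  have "c x = c (\<pi> x) + w x" if x: "x \<in> X" for x
  proof -
    obtain m n where mn: "(\<pi> ^^ m) x = (\<pi> ^^ n) (b x)" using b [OF x] by (auto simp: E_def)
    have 1: "(\<pi> ^^ Suc m) x = (\<pi> ^^ Suc n) (b x)" using mn by simp
    hence 2: "(\<pi> ^^ m) (\<pi> x) = (\<pi> ^^ Suc n) (b (\<pi> x))" by (simp only: funpow_Suc_apply [of m] b\<pi>)
    have "S x (Suc m) = w x + S (\<pi> x) m"
      using S_add [of x 1 m] by (simp add: S_def)
    thus ?thesis using c [OF x 1] c [OF funcset_mem [OF \<pi> x] 2] b\<pi> [of x] by simp
  qed
  thus ?thesis by blast
qed

section \<open>Free actions from expansion\<close>

definition letter_code :: "bool \<times> nat \<Rightarrow> int" where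
  "letter_code l = int (snd l) + (if fst l then 0 else 2)"

lemma letter_code_inv: "letter_code (inv_letter l) mod 4 = (letter_code l + 2) mod 4"
  by (auto simp: letter_code_def inv_letter_def)

lemma mod_4_add_2_eq_iff: "(s + 2) mod 4 = t mod 4 \<longleftrightarrow> s mod 4 = (t + 2) mod 4" for s t :: int
proof -
  have *: "(x + 2) mod 4 = (y + 2) mod 4" if "x mod 4 = y mod 4" for x y :: int
    using that by (rule mod_add_cong) simp
  have four: "(x + 2 + 2) mod 4 = x mod 4" for x :: int using mod_add_self2 [of x 4] by simp
  show ?thesis using * [of "s + 2" t] * [of s "t + 2"] four [of s] four [of t] by auto
qed

lemma letter_code_eq_inv:
  assumes "snd l \<in> {0, 1}" "snd k \<in> {0, 1}" "letter_code k mod 4 = (letter_code l + 2) mod 4"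
  shows "k = inv_letter l"
  using assms by (cases l; cases k) (auto simp: letter_code_def inv_letter_def split: if_splits)

text \<open>
  The fibres of an aperiodic three-to-one map give a 4-regular forest. The potential \<open>c\<close>
  provides a labelling of its edges by the letters of \<open>F2\<close>, coded by residues modulo 4 so
  that inverting adds 2: the edge from \<open>x\<close> to \<open>\<pi> x\<close> is labelled \<open>c x\<close> at \<open>x\<close>, and the edge from \<open>x\<close>
  to its \<open>i\<close>-th preimage is labelled \<open>c x + 1 + i\<close> at \<open>x\<close>.
\<close>

lemma aperiodic_three_to_one_labelling:
  assumes \<pi>: "\<pi> \<in> X \<rightarrow> X" and three: "\<forall>x\<in>X. card {y \<in> X. \<pi> y = x} = 3"
    and ap: "\<forall>x\<in>X. \<not> periodic \<pi> x"
  shows "\<exists>(\<sigma> :: int \<Rightarrow> 'x \<Rightarrow> 'x) c. \<forall>x\<in>X. \<forall>s. \<sigma> s x \<in> X \<and> \<sigma> (s + 2) (\<sigma> s x) = x \<and>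
    \<sigma> (s mod 4) x = \<sigma> s x \<and>
    (if s mod 4 = c x mod 4 then \<sigma> s x = \<pi> x
     else \<pi> (\<sigma> s x) = x \<and> c (\<sigma> s x) mod 4 = (s + 2) mod 4)"
proof -
  define Ch where "Ch x = {y \<in> X. \<pi> y = x}" for x
  have "\<exists>h. bij_betw h {0..<3::nat} (Ch x)" if "x \<in> X" for x
  proof -
    have card: "card (Ch x) = 3" using three that by (simp add: Ch_def)
    hence "finite (Ch x)" using card.infinite by fastforce
    thus ?thesis using ex_bij_betw_nat_finite [of "Ch x"] card by auto
  qed
  hence "\<exists>h. \<forall>x\<in>X. bij_betw (h x) {0..<3::nat} (Ch x)" by (intro bchoice ballI)
  then obtain h where h: "\<And>x. x \<in> X \<Longrightarrow> bij_betw (h x) {0..<3::nat} (Ch x)" by blast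
  define ch where "ch x i = h x (nat i)" for x and i :: int
  define ix where "ix y = int (inv_into {0..<3} (h (\<pi> y)) y)" for y
  have \<pi>X: "\<pi> x \<in> X" if "x \<in> X" for x using \<pi> that by auto
  have ix: "0 \<le> ix y \<and> ix y < 3 \<and> ch (\<pi> y) (ix y) = y" if y: "y \<in> X" for y
  proof -
    have "y \<in> h (\<pi> y) ` {0..<3}" using h [OF \<pi>X [OF y]] y by (auto simp: bij_betw_def Ch_def)
    hence "inv_into {0..<3} (h (\<pi> y)) y \<in> {0..<3}" "h (\<pi> y) (inv_into {0..<3} (h (\<pi> y)) y) = y"
      by (rule inv_into_into, rule f_inv_into_f)
    thus ?thesis by (auto simp: ix_def ch_def)
  qed
  have ch: "ch x i \<in> X \<and> \<pi> (ch x i) = x \<and> ix (ch x i) = i" if x: "x \<in> X" and i: "0 \<le> i" "i < 3" for x i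
  proof -
    have "ch x i \<in> Ch x" using h [OF x] i by (auto simp: bij_betw_def ch_def)
    moreover have "inv_into {0..<3} (h x) (h x (nat i)) = nat i"
      using h [OF x] i by (intro inv_into_f_f) (auto simp: bij_betw_def)
    ultimately show ?thesis using i by (auto simp: Ch_def ix_def ch_def)
  qed
  \<comment> \<open>The edge to the child with index \<open>i\<close> has the label
    \<open>c x + 1 + i\<close> at the parent. Its label at the child must be the inverse, which is
    larger by 2; hence the weight \<open>3 + i\<close>.\<close>
  obtain c where c: "\<And>x. x \<in> X \<Longrightarrow> c x = c (\<pi> x) + (3 + ix x)"
    using aperiodic_potential [OF \<pi> ap, of "\<lambda>x. 3 + ix x"] by blast
  define \<sigma> where "\<sigma> s x = (if s mod 4 = c x mod 4 then \<pi> x else ch x ((s - c x) mod 4 - 1))" for s x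
  have up: "\<sigma> s x = \<pi> x" if "s mod 4 = c x mod 4" for s x using that by (simp add: \<sigma>_def)
  have down: "\<exists>i\<in>{0..<3}. \<sigma> s x = ch x i \<and> (s - c x) mod 4 = i + 1" if "s mod 4 \<noteq> c x mod 4" for s x
  proof -
    have "(s - c x) mod 4 \<noteq> 0" using that by presburger
    moreover have "0 \<le> (s - c x) mod 4" "(s - c x) mod 4 < 4" by simp_all
    ultimately have "(s - c x) mod 4 - 1 \<in> {0..<3}" by simp
    thus ?thesis using that by (intro bexI [of _ "(s - c x) mod 4 - 1"]) (auto simp: \<sigma>_def)
  qed
  have down_c: "c (ch x i) mod 4 = (s + 2) mod 4"
    if x: "x \<in> X" and i: "i \<in> {0..<3}" and s: "(s - c x) mod 4 = i + 1" for x i s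
  proof -
    have "c (ch x i) = c x + 3 + i" using c [of "ch x i"] ch [OF x, of i] i by auto
    hence "c (ch x i) = (c x + 2) + (s - c x) mod 4" using s by simp
    hence "c (ch x i) mod 4 = ((c x + 2) + (s - c x)) mod 4" by (simp only: mod_add_right_eq)
    thus ?thesis by (simp add: algebra_simps)
  qed
  have \<sigma>: "\<sigma> s x \<in> X \<and> \<sigma> (s + 2) (\<sigma> s x) = x \<and> \<sigma> (s mod 4) x = \<sigma> s x \<and>
    (if s mod 4 = c x mod 4 then \<sigma> s x = \<pi> x
     else \<pi> (\<sigma> s x) = x \<and> c (\<sigma> s x) mod 4 = (s + 2) mod 4)" if x: "x \<in> X" for x s
  proof -
    have mod: "\<sigma> (s mod 4) x = \<sigma> s x" by (simp add: \<sigma>_def mod_diff_left_eq)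
    show ?thesis
    proof (cases "s mod 4 = c x mod 4")
      case True
      have ixx: "0 \<le> ix x" "ix x < 3" using ix [OF x] by auto
      obtain q where "s - c x = 4 * q" using True by (auto simp: mod_eq_dvd_iff dvd_def)
      hence "s + 2 - c (\<pi> x) = (ix x + 1) + 4 * (q + 1)" using c [OF x] by simp
      hence 1: "(s + 2 - c (\<pi> x)) mod 4 = ix x + 1" using ixx by (simp only: mod_mult_self2) simp
      hence "(s + 2) mod 4 \<noteq> c (\<pi> x) mod 4" using ixx by (auto simp: mod_eq_dvd_iff dvd_eq_mod_eq_0)
      hence "\<sigma> (s + 2) (\<pi> x) = x" using 1 ix [OF x] by (simp add: \<sigma>_def)
      thus ?thesis using True mod up [OF True] \<pi>X [OF x] by simp
    next
      case False
      obtain i where i: "i \<in> {0..<3}" "\<sigma> s x = ch x i" "(s - c x) mod 4 = i + 1"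
        using down [OF False] by blast
      have ci: "c (ch x i) mod 4 = (s + 2) mod 4" by (rule down_c [OF x i(1) i(3)])
      show ?thesis using i ch [OF x, of i] ci up [of "s + 2" "ch x i"] mod False by auto
    qed
  qed
  show ?thesis by (rule exI [of _ \<sigma>], rule exI [of _ c]) (use \<sigma> in blast)
qed

section \<open>Semi-regular copies of \<open>F2\<close> as free actions\<close>

lemma BijGroup_mult:
  "f \<in> Bij X \<Longrightarrow> g \<in> Bij X \<Longrightarrow> f \<otimes>\<^bsub>BijGroup X\<^esub> g = (\<lambda>x\<in>X. f (g x))"
  by (simp add: BijGroup_def compose_def)

lemma carrier_BijGroup [simp]: "carrier (BijGroup X) = Bij X"
  by (simp add: BijGroup_def)

lemma one_BijGroup: "\<one>\<^bsub>BijGroup X\<^esub> = (\<lambda>x\<in>X. x)"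
  by (simp add: BijGroup_def)

text \<open>The subgroup is the image of \<open>h\<close>. Freeness at a single point already makes
  \<open>h\<close> injective, which is why \<open>X\<close> must be nonempty.\<close>

lemma F2_semi_regularI:
  assumes C: "subgroup C (BijGroup X)" and X: "X \<noteq> {}" and hom: "h \<in> hom F2 (BijGroup X)"
    and hC: "\<And>w. w \<in> carrier F2 \<Longrightarrow> h w \<in> C"
    and free: "\<And>w x. w \<in> carrier F2 \<Longrightarrow> w \<noteq> \<one>\<^bsub>F2\<^esub> \<Longrightarrow> x \<in> X \<Longrightarrow> h w x \<noteq> x"
  shows "F2_semi_regular_in X ((BijGroup X)\<lparr>carrier := C\<rparr>)"
proof -
  interpret B: group "BijGroup X" by (rule group_BijGroup)
  interpret F: group F2 unfolding F2_def by (rule group_free_group)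
  interpret h: group_hom F2 "BijGroup X" h
    by (simp add: group_hom_def group_hom_axioms_def hom F.is_group B.is_group)
  have trivial: "w = \<one>\<^bsub>F2\<^esub>" if "w \<in> carrier F2" "x \<in> X" "h w x = x" for w x
    using free that by blast
  have inj: "inj_on h (carrier F2)"
  proof -
    obtain x where x: "x \<in> X" using X by blast
    have "w = \<one>\<^bsub>F2\<^esub>" if "w \<in> carrier F2" "h w = \<one>\<^bsub>BijGroup X\<^esub>" for w
      by (rule trivial [OF that(1) x]) (use that(2) x in \<open>auto simp: BijGroup_def\<close>)
    thus ?thesis by (subst h.inj_on_one_iff) blast
  qed
  let ?H = "h ` carrier F2"
  have H: "subgroup ?H (BijGroup X)" by (rule h.img_is_subgroup)
  have "semi_regular X ?H"
    unfolding semi_regular_def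
  proof (intro conjI ballI impI H)
    fix \<gamma> x assume "\<gamma> \<in> ?H" "\<gamma> \<noteq> \<one>\<^bsub>BijGroup X\<^esub>" and x: "x \<in> X"
    then obtain w where w: "w \<in> carrier F2" "\<gamma> = h w" "w \<noteq> \<one>\<^bsub>F2\<^esub>" using h.hom_one by blast
    thus "\<gamma> x \<noteq> x" using trivial [OF w(1) x] by blast
  qed
  moreover have "subgroup ?H ((BijGroup X)\<lparr>carrier := C\<rparr>)"
    by (rule B.subgroup_incl [OF H C]) (use hC in blast)
  moreover have "h \<in> iso F2 ((BijGroup X)\<lparr>carrier := C\<rparr>\<lparr>carrier := ?H\<rparr>)"
    using hom inj by (auto simp: iso_def hom_def bij_betw_def)
  ultimately show ?thesis unfolding F2_semi_regular_in_def is_iso_def by blast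
qed

lemma F2_semi_regularD:
  assumes C: "subgroup C (BijGroup X)" and F: "F2_semi_regular_in X ((BijGroup X)\<lparr>carrier := C\<rparr>)"
  shows "\<exists>h\<in>hom F2 (BijGroup X). (\<forall>w\<in>carrier F2. h w \<in> C) \<and>
    (\<forall>w\<in>carrier F2. w \<noteq> \<one>\<^bsub>F2\<^esub> \<longrightarrow> (\<forall>x\<in>X. h w x \<noteq> x))"
proof -
  interpret B: group "BijGroup X" by (rule group_BijGroup)
  interpret F: group F2 unfolding F2_def by (rule group_free_group)
  obtain H h where H: "subgroup H ((BijGroup X)\<lparr>carrier := C\<rparr>)" "semi_regular X H"
    and h: "h \<in> iso F2 ((BijGroup X)\<lparr>carrier := C\<rparr>\<lparr>carrier := H\<rparr>)"
    using F by (auto simp: F2_semi_regular_in_def is_iso_def)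
  have HC: "H \<subseteq> C" using subgroup.subset [OF H(1)] by simp
  have hH: "h w \<in> H" if "w \<in> carrier F2" for w
    using h that by (auto simp: iso_def hom_def)
  have hom: "h \<in> hom F2 (BijGroup X)"
    using h HC subgroup.subset [OF C] by (auto simp: iso_def hom_def)
  interpret h: group_hom F2 "BijGroup X" h
    by (simp add: group_hom_def group_hom_axioms_def hom F.is_group B.is_group)
  have "h w x \<noteq> x" if w: "w \<in> carrier F2" "w \<noteq> \<one>\<^bsub>F2\<^esub>" and x: "x \<in> X" for w x
  proof -
    have "h w \<noteq> h \<one>\<^bsub>F2\<^esub>"
      using h w by (auto simp: iso_def bij_betw_def inj_on_def)
    hence "h w \<noteq> \<one>\<^bsub>BijGroup X\<^esub>" by simp
    thus ?thesis using H(2) hH [OF w(1)] x by (auto simp: semi_regular_def)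
  qed
  thus ?thesis using hom hH HC by blast
qed

text \<open>Each letter moves every point along the edge with that label. A reduced word never goes
  back along the edge that it has just used, so in a forest its path does not close up unless the
  word is empty.\<close>

lemma free_action_of_forest:
  fixes \<pi> :: "'x \<Rightarrow> 'x"
  assumes \<pi>: "\<pi> \<in> X \<rightarrow> X" and three: "\<forall>x\<in>X. card {y \<in> X. \<pi> y = x} = 3"
    and ap: "\<forall>x\<in>X. \<not> periodic \<pi> x" and X: "X \<noteq> {}"
    and C: "subgroup C (BijGroup X)"
    and near: "\<And>\<gamma>. \<gamma> \<in> Bij X \<Longrightarrow> (\<And>x. x \<in> X \<Longrightarrow> \<gamma> x = \<pi> x \<or> \<pi> (\<gamma> x) = x) \<Longrightarrow> \<gamma> \<in> C"
  shows "F2_semi_regular_in X ((BijGroup X)\<lparr>carrier := C\<rparr>)"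
proof -
  interpret B: group "BijGroup X" by (rule group_BijGroup)
  interpret F: group F2 unfolding F2_def by (rule group_free_group)
  obtain \<sigma> :: "int \<Rightarrow> 'x \<Rightarrow> 'x" and c :: "'x \<Rightarrow> int" where \<sigma>: "\<forall>x\<in>X. \<forall>s. \<sigma> s x \<in> X \<and> \<sigma> (s + 2) (\<sigma> s x) = x \<and>
    \<sigma> (s mod 4) x = \<sigma> s x \<and>
    (if s mod 4 = c x mod 4 then \<sigma> s x = \<pi> x
     else \<pi> (\<sigma> s x) = x \<and> c (\<sigma> s x) mod 4 = (s + 2) mod 4)"
    using aperiodic_three_to_one_labelling [OF \<pi> three ap] by blast
  have \<sigma>X: "\<sigma> s x \<in> X" if "x \<in> X" for s x using \<sigma> that by blast
  have \<sigma>inv: "\<sigma> t (\<sigma> s x) = x" if x: "x \<in> X" and t: "t mod 4 = (s + 2) mod 4" for s t x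
    using \<sigma> \<sigma>X [OF x, of s] x t by metis
  have up: "\<sigma> s x = \<pi> x" if "x \<in> X" "s mod 4 = c x mod 4" for s x using \<sigma> that by auto
  have down: "\<pi> (\<sigma> s x) = x" "c (\<sigma> s x) mod 4 = (s + 2) mod 4"
    if "x \<in> X" "s mod 4 \<noteq> c x mod 4" for s x using \<sigma> that by auto
  have \<sigma>inv': "\<sigma> s (\<sigma> t x) = x" if x: "x \<in> X" and t: "t mod 4 = (s + 2) mod 4" for s t x
    by (rule \<sigma>inv [OF x]) (use t mod_4_add_2_eq_iff in metis)
  have bij: "bij_betw (\<sigma> s) X X" for s
    by (rule bij_betw_byWitness [where f' = "\<sigma> (s + 2)"]) (use \<sigma>X \<sigma>inv \<sigma>inv' in auto)
  have gen: "restrict (\<sigma> s) X \<in> C" for s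
  proof (rule near)
    show "restrict (\<sigma> s) X \<in> Bij X" using bij [of s] by (auto simp: Bij_def)
    show "restrict (\<sigma> s) X x = \<pi> x \<or> \<pi> (restrict (\<sigma> s) X x) = x" if "x \<in> X" for x
      using that up down(1) by (cases "s mod 4 = c x mod 4") auto
  qed
  define act where "act w x = foldr (\<lambda>l. \<sigma> (letter_code l)) w x" for w x
  have act_simps [simp]: "act [] x = x" "act (l # w) x = \<sigma> (letter_code l) (act w x)" for l w x
    by (simp_all add: act_def)
  have actX: "act w x \<in> X" if "x \<in> X" for w x using that \<sigma>X by (induction w) auto
  have cancel: "\<sigma> (letter_code l) (\<sigma> (letter_code (inv_letter l)) x) = x" if "x \<in> X" for l x
    using \<sigma>inv' [OF that] letter_code_inv by blast
  have act_prepend: "act (prepend l w) x = \<sigma> (letter_code l) (act w x)" if "x \<in> X" for l w x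
    using that actX cancel by (cases w) auto
  have act_mult: "act (foldr prepend u v) x = act u (act v x)" if "x \<in> X" for u v x
    using that by (induction u) (auto simp: act_prepend)
  \<comment> \<open>A reduced word first climbs \<open>k\<close> steps in the forest, then descends \<open>l\<close> steps on a different branch.\<close>
  have path: "\<exists>k l. k + l = length w \<and> (\<pi> ^^ l) (act w x) = (\<pi> ^^ k) x \<and>
      (l > 0 \<longrightarrow> c (act w x) mod 4 = (letter_code (hd w) + 2) mod 4) \<and>
      (l > 0 \<longrightarrow> k > 0 \<longrightarrow> (\<pi> ^^ (l - 1)) (act w x) \<noteq> (\<pi> ^^ (k - 1)) x) \<and>
      (l = 0 \<longrightarrow> k > 0 \<longrightarrow> letter_code (hd w) mod 4 = c ((\<pi> ^^ (k - 1)) x) mod 4)"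
    if x: "x \<in> X" and w: "reduced_word w" "snd ` set w \<subseteq> {0, 1}" for w x
    using w
  proof (induction w)
    case Nil
    show ?case by (intro exI [of _ 0]) auto
  next
    case (Cons y w)
    let ?u = "act w x" and ?s = "letter_code y"
    have uX: "?u \<in> X" using actX [OF x] .
    have rw: "reduced_word w" and y: "snd y \<in> {0, 1}" and ws: "snd ` set w \<subseteq> {0, 1}"
      using Cons.prems by (auto simp: reduced_Cons)
    have nb: "(letter_code (hd w) + 2) mod 4 \<noteq> ?s mod 4" if ne: "w \<noteq> []"
    proof
      assume "(letter_code (hd w) + 2) mod 4 = ?s mod 4"
      hence "letter_code (hd w) mod 4 = (?s + 2) mod 4" unfolding mod_4_add_2_eq_iff .
      moreover have "snd (hd w) \<in> {0, 1}" using ne ws by (cases w) auto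
      ultimately have "hd w = inv_letter y" using letter_code_eq_inv y by blast
      thus False using Cons.prems(1) ne by (auto simp: reduced_Cons)
    qed
    obtain k l where kl: "k + l = length w" "(\<pi> ^^ l) ?u = (\<pi> ^^ k) x"
      and cl: "l > 0 \<longrightarrow> c ?u mod 4 = (letter_code (hd w) + 2) mod 4"
      and ne: "l > 0 \<longrightarrow> k > 0 \<longrightarrow> (\<pi> ^^ (l - 1)) ?u \<noteq> (\<pi> ^^ (k - 1)) x"
      and c0: "l = 0 \<longrightarrow> k > 0 \<longrightarrow> letter_code (hd w) mod 4 = c ((\<pi> ^^ (k - 1)) x) mod 4"
      using Cons.IH [OF rw ws] by blast
    show ?case
    proof (cases "?s mod 4 = c ?u mod 4")
      case True
      \<comment> \<open>After a descent, the upward edge carries the inverse of the letter just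
        applied, so a reduced word cannot climb again.\<close>
      have l0: "l = 0"
      proof (rule ccontr)
        assume "l \<noteq> 0"
        moreover from this have "w \<noteq> []" using kl by auto
        ultimately show False using cl nb True by simp
      qed
      have "act (y # w) x = (\<pi> ^^ Suc k) x" using up [OF uX True] kl(2) l0 by simp
      thus ?thesis using True kl l0 by (intro exI [of _ "Suc k"] exI [of _ 0]) auto
    next
      case False
      let ?v = "act (y # w) x"
      have v: "\<pi> ?v = ?u" "c ?v mod 4 = (?s + 2) mod 4" using down [OF uX False] by simp_all
      have shift: "(\<pi> ^^ Suc j) ?v = (\<pi> ^^ j) ?u" for j
        by (simp only: funpow_Suc_right comp_apply v(1))
      have ne': "(\<pi> ^^ l) ?v \<noteq> (\<pi> ^^ (k - 1)) x" if k: "k > 0"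
      proof (cases "l > 0")
        case True
        thus ?thesis using ne k shift [of "l - 1"] by simp
      next
        \<comment> \<open>The word turns from climbing to descending at this letter. Going down the
          edge by which it came up would take the inverse of the previous letter.\<close>
        case l0: False
        have wne: "w \<noteq> []" using k kl by auto
        show ?thesis
        proof
          assume "(\<pi> ^^ l) ?v = (\<pi> ^^ (k - 1)) x"
          hence "c ?v mod 4 = letter_code (hd w) mod 4" using l0 c0 k by simp
          hence "(letter_code (hd w) + 2) mod 4 = ?s mod 4" using v(2) mod_4_add_2_eq_iff by metis
          thus False using nb [OF wne] by simp
        qed
      qed
      show ?thesis
        using kl v(2) ne' shift [of l]
        by (intro exI [of _ k] exI [of _ "Suc l"]) (auto simp del: act_simps funpow.simps)
    qed
  qed
  have free: "w = []" if x: "x \<in> X" and w: "reduced_word w" "snd ` set w \<subseteq> {0, 1}" and eq: "act w x = x" for w x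
  proof -
    obtain k l where kl: "k + l = length w" "(\<pi> ^^ l) x = (\<pi> ^^ k) x"
      and ne: "l > 0 \<longrightarrow> k > 0 \<longrightarrow> (\<pi> ^^ (l - 1)) x \<noteq> (\<pi> ^^ (k - 1)) x"
      using path [OF x w] eq by auto
    \<comment> \<open>A return to \<open>x\<close> makes climb and descent equally long, by
      aperiodicity. If they were positive, the two branches would coincide.\<close>
    have "l = k" by (rule aperiodic_funpow_inj [OF ap \<pi> x kl(2)])
    hence "k = 0" using ne by auto
    thus ?thesis using kl \<open>l = k\<close> by simp
  qed
  define h where "h w = restrict (act w) X" for w
  have hC: "h w \<in> C" for w
  proof (induction w)
    case Nil
    have "h [] = \<one>\<^bsub>BijGroup X\<^esub>" by (auto simp: h_def BijGroup_def)
    thus ?case using subgroup.one_closed [OF C] by simp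
  next
    case (Cons l w)
    have "h (l # w) = restrict (\<sigma> (letter_code l)) X \<otimes>\<^bsub>BijGroup X\<^esub> h w"
    proof -
      have "restrict (\<sigma> (letter_code l)) X \<in> Bij X" "h w \<in> Bij X"
        using subgroup.subset [OF C] gen Cons by auto
      thus ?thesis using actX by (auto simp: BijGroup_mult h_def fun_eq_iff)
    qed
    thus ?case using subgroup.m_closed [OF C gen Cons] by simp
  qed
  have hcar: "h w \<in> carrier (BijGroup X)" for w using hC subgroup.subset [OF C] by blast
  hence hBij: "h w \<in> Bij X" for w by simp
  have hom: "h \<in> hom F2 (BijGroup X)"
  proof (rule homI)
    fix u v
    have "h (foldr prepend u v) = h u \<otimes>\<^bsub>BijGroup X\<^esub> h v"
      unfolding BijGroup_mult [OF hBij hBij] using actX act_mult by (auto simp: h_def fun_eq_iff)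
    thus "h (u \<otimes>\<^bsub>F2\<^esub> v) = h u \<otimes>\<^bsub>BijGroup X\<^esub> h v" by (simp add: F2_def free_group_def)
  qed (rule hcar)
  have "h w x \<noteq> x" if "w \<in> carrier F2" "w \<noteq> \<one>\<^bsub>F2\<^esub>" "x \<in> X" for w x
    using free [of x w] that by (auto simp: F2_def free_group_def h_def)
  thus ?thesis using F2_semi_regularI [OF C X hom] hC by blast
qed

text \<open>These are the controlled sets of the coarse structure given by the action. Stating the
  wobbling condition for relations lets displacements be composed and inverted without reference to
  maps.\<close>

definition bounded_rel :: "('x \<Rightarrow> 'x) set \<Rightarrow> ('x \<times> 'x) set \<Rightarrow> bool" where
  "bounded_rel \<Gamma> T \<longleftrightarrow> (\<exists>E. finite E \<and> E \<subseteq> \<Gamma> \<and> (\<forall>(x, y)\<in>T. \<exists>g\<in>E. y = g x))"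

lemma bounded_rel_mono:
  assumes "bounded_rel \<Gamma> T" "S \<subseteq> T"
  shows "bounded_rel \<Gamma> S"
proof -
  obtain E where "finite E" "E \<subseteq> \<Gamma>" "\<forall>(x, y)\<in>T. \<exists>g\<in>E. y = g x"
    using assms(1) by (auto simp: bounded_rel_def)
  thus ?thesis unfolding bounded_rel_def using assms(2) by (intro exI [of _ E]) auto
qed

lemma bounded_rel_Un:
  assumes "bounded_rel \<Gamma> S" "bounded_rel \<Gamma> T"
  shows "bounded_rel \<Gamma> (S \<union> T)"
proof -
  obtain E F where "finite E" "E \<subseteq> \<Gamma>" "\<forall>(x, y)\<in>S. \<exists>g\<in>E. y = g x"
    "finite F" "F \<subseteq> \<Gamma>" "\<forall>(x, y)\<in>T. \<exists>g\<in>F. y = g x"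
    using assms by (auto simp: bounded_rel_def)
  thus ?thesis unfolding bounded_rel_def by (intro exI [of _ "E \<union> F"]) auto
qed

lemma bounded_rel_Id_on:
  assumes "subgroup \<Gamma> (BijGroup X)"
  shows "bounded_rel \<Gamma> (Id_on X)"
  unfolding bounded_rel_def
  by (rule exI [of _ "{\<one>\<^bsub>BijGroup X\<^esub>}"])
    (use subgroup.one_closed [OF assms] in \<open>auto simp: one_BijGroup\<close>)

lemma bounded_rel_converse:
  assumes \<Gamma>: "subgroup \<Gamma> (BijGroup X)" and "T \<subseteq> X \<times> X" "bounded_rel \<Gamma> T"
  shows "bounded_rel \<Gamma> (T\<inverse>)"
proof -
  obtain E where E: "finite E" "E \<subseteq> \<Gamma>" "\<forall>(x, y)\<in>T. \<exists>g\<in>E. y = g x"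
    using assms by (auto simp: bounded_rel_def)
  have "\<exists>g\<in>m_inv (BijGroup X) ` E. x = g y" if xy: "(x, y) \<in> T" for x y
  proof -
    obtain g where g: "g \<in> E" "y = g x" using E xy by blast
    have X: "x \<in> X" "y \<in> X" using assms(2) xy by auto
    have gB: "g \<in> Bij X" using g E subgroup.subset [OF \<Gamma>] by auto
    hence "inv_into X g y = x" using g X by (auto simp: Bij_def bij_betw_def)
    hence "(inv\<^bsub>BijGroup X\<^esub> g) y = x" using inv_BijGroup [OF gB] X by simp
    thus ?thesis using g by blast
  qed
  moreover have "m_inv (BijGroup X) ` E \<subseteq> \<Gamma>" using E subgroup.m_inv_closed [OF \<Gamma>] by auto
  ultimately show ?thesis
    unfolding bounded_rel_def using E(1) by (intro exI [of _ "m_inv (BijGroup X) ` E"]) auto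
qed

lemma bounded_rel_relcomp:
  assumes \<Gamma>: "subgroup \<Gamma> (BijGroup X)" and "S \<subseteq> X \<times> X" "bounded_rel \<Gamma> S" "bounded_rel \<Gamma> T"
  shows "bounded_rel \<Gamma> (S O T)"
proof -
  obtain E F where E: "finite E" "E \<subseteq> \<Gamma>" "\<forall>(x, y)\<in>S. \<exists>g\<in>E. y = g x"
    and F: "finite F" "F \<subseteq> \<Gamma>" "\<forall>(x, y)\<in>T. \<exists>g\<in>F. y = g x"
    using assms(3,4) unfolding bounded_rel_def by blast
  let ?P = "(\<lambda>(f, g). f \<otimes>\<^bsub>BijGroup X\<^esub> g) ` (F \<times> E)"
  have "\<exists>g\<in>?P. z = g x" if xz: "(x, y) \<in> S" "(y, z) \<in> T" for x y z
  proof -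
    obtain g where g: "g \<in> E" "y = g x" using E xz by blast
    obtain f where f: "f \<in> F" "z = f y" using F xz by blast
    have "f \<in> Bij X" "g \<in> Bij X" using f g E F subgroup.subset [OF \<Gamma>] by auto
    hence "(f \<otimes>\<^bsub>BijGroup X\<^esub> g) x = z" using assms(2) xz f g by (auto simp: BijGroup_mult)
    thus ?thesis using f(1) g(1) by force
  qed
  moreover have "?P \<subseteq> \<Gamma>" using E(2) F(2) by (auto intro!: subgroup.m_closed [OF \<Gamma>])
  ultimately show ?thesis
    unfolding bounded_rel_def using E(1) F(1) by (intro exI [of _ ?P]) blast
qed

text \<open>Sum the drift over \<open>S\<close>. Since \<open>\<sigma> i\<close> maps
  \<open>S\<close> injectively into \<open>N\<close> and \<open>F i\<close> is nonnegative, the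
  contribution of \<open>i\<close> is at most the sum of \<open>F i\<close> over
  \<open>N - S\<close>, hence at most \<open>M\<close> times the size of
  \<open>N - S\<close>.\<close>

lemma drift_imp_expansion:
  fixes F :: "'i \<Rightarrow> 'x \<Rightarrow> real" and \<sigma> :: "'i \<Rightarrow> 'x \<Rightarrow> 'x"
  assumes I: "finite I" and inj: "\<And>i. i \<in> I \<Longrightarrow> inj_on (\<sigma> i) S"
    and F: "\<And>i x. i \<in> I \<Longrightarrow> 0 \<le> F i x" "\<And>i x. i \<in> I \<Longrightarrow> F i x \<le> M" and M: "M > 0"
    and drift: "\<And>x. x \<in> S \<Longrightarrow> \<delta> \<le> (\<Sum>i\<in>I. F i (\<sigma> i x) - F i x)"
    and S: "finite S" and N: "S \<subseteq> N" "\<And>i. i \<in> I \<Longrightarrow> \<sigma> i ` S \<subseteq> N" "finite N"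
  shows "(1 + \<delta> / (M * (card I + 1))) * card S \<le> card N"
proof -
  have "\<delta> * card S = (\<Sum>x\<in>S. \<delta>)" by simp
  also have "\<dots> \<le> (\<Sum>x\<in>S. \<Sum>i\<in>I. F i (\<sigma> i x) - F i x)" by (intro sum_mono drift)
  also have "\<dots> = (\<Sum>i\<in>I. \<Sum>x\<in>S. F i (\<sigma> i x) - F i x)" by (rule sum.swap)
  also have "\<dots> \<le> (\<Sum>i\<in>I. M * card (N - S))"
  proof (rule sum_mono)
    fix i assume i: "i \<in> I"
    have "(\<Sum>x\<in>S. F i (\<sigma> i x)) = (\<Sum>y\<in>\<sigma> i ` S. F i y)"
      using sum.reindex [OF inj [OF i], of "F i"] by simp
    also have "\<dots> \<le> (\<Sum>y\<in>N. F i y)" using N F i by (intro sum_mono2) auto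
    also have "\<dots> = (\<Sum>y\<in>S. F i y) + (\<Sum>y\<in>N - S. F i y)"
      using N sum.subset_diff [of S N "F i"] by simp
    also have "(\<Sum>y\<in>N - S. F i y) \<le> (\<Sum>y\<in>N - S. M)" by (intro sum_mono F i)
    finally show "(\<Sum>x\<in>S. F i (\<sigma> i x) - F i x) \<le> M * card (N - S)"
      by (simp add: sum_subtractf mult.commute)
  qed
  \<comment> \<open>The added 1 keeps the divisor positive when \<open>I\<close> is empty.\<close>
  also have "\<dots> \<le> (card I + 1) * (M * card (N - S))" using M by (simp add: algebra_simps)
  finally have "\<delta> * card S \<le> card (N - S) * (M * (card I + 1))" by (simp add: algebra_simps)
  moreover have "M * (card I + 1) > 0" using M by simp
  ultimately have "\<delta> / (M * (card I + 1)) * card S \<le> card (N - S)"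
    by (simp only: times_divide_eq_left pos_divide_le_eq)
  moreover have "real (card N) = card S + card (N - S)"
    using N S by (metis card_Un_disjoint Diff_disjoint Un_Diff_cancel Un_absorb1 finite_Diff of_nat_add)
  ultimately show ?thesis by (simp add: algebra_simps)
qed

lemma relpow_Image_Suc: "(T ^^ Suc n) `` S = T `` ((T ^^ n) `` S)"
  by auto

lemma expansion_imp_F2:
  fixes X :: "'x set"
  assumes \<Gamma>: "subgroup \<Gamma> (BijGroup X)" and X: "X \<noteq> {}"
    and C: "subgroup C (BijGroup X)"
    and C_near: "\<And>\<gamma> T. \<gamma> \<in> Bij X \<Longrightarrow> bounded_rel \<Gamma> T \<Longrightarrow> (\<And>x. x \<in> X \<Longrightarrow> (x, \<gamma> x) \<in> T) \<Longrightarrow> \<gamma> \<in> C"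
    and T: "T \<subseteq> X \<times> X" "bounded_rel \<Gamma> T" and a: "a > 1"
    and expand: "\<And>S. finite S \<Longrightarrow> S \<subseteq> X \<Longrightarrow> a * real (card S) \<le> card (T `` S)"
  shows "F2_semi_regular_in X ((BijGroup X)\<lparr>carrier := C\<rparr>)"
proof -
  have finT: "finite (T `` S)" if "finite S" for S
  proof -
    obtain E where E: "finite E" "\<forall>(x, y)\<in>T. \<exists>g\<in>E. y = g x" using T(2) by (auto simp: bounded_rel_def)
    have "T `` S \<subseteq> (\<lambda>(g, x). g x) ` (E \<times> S)" using E(2) by force
    thus ?thesis using E(1) that finite_subset by blast
  qed
  have pow: "finite ((T ^^ n) `` S) \<and> (T ^^ n) `` S \<subseteq> X \<and> a ^ n * card S \<le> card ((T ^^ n) `` S)"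
    if S: "finite S" "S \<subseteq> X" for n S
  proof (induction n)
    case (Suc n)
    have "a ^ Suc n * card S = a * (a ^ n * card S)" by simp
    also have "\<dots> \<le> a * card ((T ^^ n) `` S)" using Suc a by (intro mult_left_mono) auto
    also have "\<dots> \<le> card (T `` ((T ^^ n) `` S))" using Suc by (intro expand) auto
    finally show ?case unfolding relpow_Image_Suc using finT Suc T(1) by blast
  qed (use S in auto)
  \<comment> \<open>A factor above 1 iterates to a factor above 3, at the price of \<open>n\<close>
    steps along \<open>T\<close>.\<close>
  obtain n where n: "a ^ n > 3" using real_arch_pow [OF a, of 3] by blast
  have expand3: "3 * card S \<le> card ((T ^^ n) `` S)" if S: "finite S" "S \<subseteq> X" for S
  proof -
    have "3 * real (card S) \<le> a ^ n * card S" using n by (intro mult_right_mono) auto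
    thus ?thesis using pow [OF S, of n] by linarith
  qed
  let ?P = "X \<times> {0..<3::nat}"
  have "\<exists>f. inj_on f ?P \<and> (\<forall>p\<in>?P. f p \<in> (T ^^ n) `` {fst p})"
  proof (rule hall_infinite)
    show "finite ((T ^^ n) `` {fst p})" if "p \<in> ?P" for p using pow [of "{fst p}" n] that by auto
  next
    fix J assume J: "finite J" "J \<subseteq> ?P"
    have "card J \<le> card (fst ` J \<times> {0..<3::nat})"
      using J by (intro card_mono) (force intro: rev_image_eqI)+
    also have "\<dots> = 3 * card (fst ` J)" by (simp add: card_cartesian_product)
    also have "\<dots> \<le> card ((T ^^ n) `` (fst ` J))" using J by (intro expand3) auto
    also have "(T ^^ n) `` (fst ` J) = (\<Union>p\<in>J. (T ^^ n) `` {fst p})" by blast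
    finally show "card J \<le> card (\<Union>p\<in>J. (T ^^ n) `` {fst p})" .
  qed
  then obtain j where j: "inj_on j ?P" "\<And>p. p \<in> ?P \<Longrightarrow> j p \<in> (T ^^ n) `` {fst p}" by blast
  have jX: "j ` ?P \<subseteq> X"
  proof
    fix y assume "y \<in> j ` ?P"
    then obtain p where "p \<in> ?P" "y = j p" by blast
    thus "y \<in> X" using j(2) [of p] pow [of "{fst p}" n] by auto
  qed
  \<comment> \<open>The injection back sends \<open>x\<close> to \<open>(x, 0)\<close>. So wherever
    \<open>h\<close> differs from \<open>j\<close>, it just forgets the second coordinate and does
    not move the point.\<close>
  have "\<exists>h. bij_betw h ?P X \<and> (\<forall>p\<in>?P. h p = j p \<or> (h p \<in> X \<and> (\<lambda>x. (x, 0)) (h p) = p))"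
    by (rule banach_mapping [OF j(1) jX]) (auto simp: inj_on_def)
  then obtain h where h: "bij_betw h ?P X" "\<And>p. p \<in> ?P \<Longrightarrow> h p = j p \<or> (h p, 0) = p" by auto
  define R where "R = ((T ^^ n) \<inter> X \<times> X) \<union> Id_on X"
  have RX: "R \<subseteq> X \<times> X" by (auto simp: R_def)
  have bT: "bounded_rel \<Gamma> ((T ^^ m) \<inter> X \<times> X)" for m
  proof (induction m)
    case 0
    have "(T ^^ 0) \<inter> X \<times> X \<subseteq> Id_on X" by auto
    thus ?case using bounded_rel_Id_on [OF \<Gamma>] bounded_rel_mono by blast
  next
    case (Suc m)
    have "(T ^^ Suc m) \<inter> X \<times> X \<subseteq> ((T ^^ m) \<inter> X \<times> X) O T" using T(1) by auto
    moreover have "bounded_rel \<Gamma> (((T ^^ m) \<inter> X \<times> X) O T)"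
      using Suc T by (intro bounded_rel_relcomp [OF \<Gamma>]) auto
    ultimately show ?case using bounded_rel_mono by blast
  qed
  have bR: "bounded_rel \<Gamma> R"
    unfolding R_def by (intro bounded_rel_Un bT bounded_rel_Id_on [OF \<Gamma>])
  have hR: "(fst p, h p) \<in> R" if p: "p \<in> ?P" for p
  proof -
    have "h p \<in> X" "fst p \<in> X" using h(1) p by (auto simp: bij_betw_def)
    moreover have "h p = j p \<or> h p = fst p" using h(2) [OF p] by (metis fst_conv)
    ultimately show ?thesis using j(2) [OF p] by (auto simp: R_def)
  qed
  define \<pi> where "\<pi> y = fst (inv_into ?P h y)" for y
  have \<pi>h: "\<pi> (h p) = fst p" if "p \<in> ?P" for p
    using h(1) that by (simp add: \<pi>_def bij_betw_def)
  have hsurj: "\<exists>p\<in>?P. y = h p" if "y \<in> X" for y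
    using h(1) that unfolding bij_betw_def by blast
  have \<pi>X: "\<pi> \<in> X \<rightarrow> X" using hsurj \<pi>h by fastforce
  have \<pi>R: "(\<pi> y, y) \<in> R" if y: "y \<in> X" for y
  proof -
    obtain p where "p \<in> ?P" "y = h p" using hsurj [OF y] by blast
    thus ?thesis using hR \<pi>h by simp
  qed
  have three: "card {y \<in> X. \<pi> y = x} = 3" if x: "x \<in> X" for x
  proof -
    have "{y \<in> X. \<pi> y = x} = h ` ({x} \<times> {0..<3})"
    proof (intro equalityI subsetI)
      fix y assume y: "y \<in> {y \<in> X. \<pi> y = x}"
      then obtain p where p: "p \<in> ?P" "y = h p" using hsurj by blast
      hence "fst p = x" using \<pi>h y by simp
      thus "y \<in> h ` ({x} \<times> {0..<3})" using p by (intro image_eqI [of _ _ p]) auto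
    next
      fix y assume "y \<in> h ` ({x} \<times> {0..<3})"
      then obtain i where "i < 3" "y = h (x, i)" by auto
      thus "y \<in> {y \<in> X. \<pi> y = x}" using \<pi>h [of "(x, i)"] h(1) x by (auto simp: bij_betw_def)
    qed
    moreover have "inj_on h ({x} \<times> {0..<3})"
      by (rule inj_on_subset [OF bij_betw_imp_inj_on [OF h(1)]]) (use x in auto)
    ultimately show ?thesis by (simp add: card_image card_cartesian_product)
  qed
  obtain \<rho> where \<rho>: "\<rho> \<in> X \<rightarrow> X" "\<forall>x\<in>X. card {y \<in> X. \<rho> y = x} = 3" "\<forall>x\<in>X. \<not> periodic \<rho> x"
    and \<rho>near: "\<forall>x\<in>X. \<rho> x = \<pi> x \<or> \<rho> x = \<pi> (\<pi> x) \<or> \<pi> (\<rho> x) = x"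
    using aperiodic_three_to_one [OF \<pi>X three] by blast
  \<comment> \<open>The three parts serve the three alternatives of \<open>\<rho>near\<close>: a
    preimage under \<open>\<pi>\<close>, the image, and the image of the image.\<close>
  define Q where "Q = R \<union> R\<inverse> \<union> R\<inverse> O R\<inverse>"
  have QX: "Q \<subseteq> X \<times> X" using RX by (auto simp: Q_def)
  have bQ: "bounded_rel \<Gamma> Q"
    unfolding Q_def using RX bR
    by (intro bounded_rel_Un bounded_rel_relcomp [OF \<Gamma>] bounded_rel_converse [OF \<Gamma>]) auto
  have \<rho>Q: "(x, \<rho> x) \<in> Q" if x: "x \<in> X" for x
  proof -
    have "\<pi> x \<in> X" "\<rho> x \<in> X" using \<pi>X \<rho>(1) x by auto
    hence *: "(\<pi> x, x) \<in> R" "(\<pi> (\<pi> x), \<pi> x) \<in> R" "(\<pi> (\<rho> x), \<rho> x) \<in> R" using \<pi>R x by auto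
    consider "\<rho> x = \<pi> x" | "\<rho> x = \<pi> (\<pi> x)" | "\<pi> (\<rho> x) = x" using \<rho>near x by blast
    thus ?thesis by cases (use * in \<open>auto simp: Q_def\<close>)
  qed
  show ?thesis
  proof (rule free_action_of_forest [OF \<rho> X C])
    fix \<gamma> assume \<gamma>: "\<gamma> \<in> Bij X" and near: "\<And>x. x \<in> X \<Longrightarrow> \<gamma> x = \<rho> x \<or> \<rho> (\<gamma> x) = x"
    show "\<gamma> \<in> C"
    proof (rule C_near [OF \<gamma>, of "Q \<union> Q\<inverse>"])
      show "bounded_rel \<Gamma> (Q \<union> Q\<inverse>)" using bQ QX by (intro bounded_rel_Un bounded_rel_converse [OF \<Gamma>])
      fix x assume x: "x \<in> X"
      hence "\<gamma> x \<in> X" using \<gamma> by (auto simp: Bij_def bij_betw_def)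
      thus "(x, \<gamma> x) \<in> Q \<union> Q\<inverse>" using near [OF x] \<rho>Q [OF x] \<rho>Q [of "\<gamma> x"] by auto
    qed
  qed
qed

section \<open>Non-amenable groups\<close>

lemma nhd_e_iff: "U \<in> nhd_filter_e \<longleftrightarrow> eventually (\<lambda>x. x \<in> U) (nhds 0)"
  by (simp add: nhd_filter_e_def)

lemma nhd_e_zero: "U \<in> nhd_filter_e \<Longrightarrow> 0 \<in> U"
  unfolding nhd_e_iff by (rule eventually_nhds_x_imp_x)

lemma nhd_e_mono: "U \<in> nhd_filter_e \<Longrightarrow> U \<subseteq> V \<Longrightarrow> V \<in> nhd_filter_e"
  by (auto simp: nhd_e_iff elim: eventually_mono)

lemma nhd_e_Int: "U \<in> nhd_filter_e \<Longrightarrow> V \<in> nhd_filter_e \<Longrightarrow> U \<inter> V \<in> nhd_filter_e"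
  by (auto simp: nhd_e_iff eventually_conj_iff)

lemma nhd_e_INT:
  "finite I \<Longrightarrow> (\<And>i. i \<in> I \<Longrightarrow> U i \<in> nhd_filter_e) \<Longrightarrow> (\<Inter>i\<in>I. U i) \<in> nhd_filter_e"
  by (simp add: nhd_e_iff eventually_ball_finite_distrib)

lemma nhd_e_vimage:
  assumes "U \<in> nhd_filter_e" "(f \<longlongrightarrow> 0) (nhds 0)"
  shows "{x. f x \<in> U} \<in> nhd_filter_e"
  using assms(1) assms(2) [unfolded filterlim_iff, THEN spec, of "\<lambda>x. x \<in> U"]
  by (simp add: nhd_e_iff)

text \<open>A left translation by \<open>g\<close> conjugates the difference \<open>x - y\<close> by
  \<open>g\<close>; this lemma makes left translations uniformly continuous for the right
  uniformity.\<close>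

lemma nhd_e_conj:
  fixes g :: "'a::topological_group_add"
  assumes "U \<in> nhd_filter_e"
  shows "{x. g + x - g \<in> U} \<in> nhd_filter_e"
  by (rule nhd_e_vimage [OF assms]) (auto intro!: tendsto_eq_intros filterlim_ident)

lemma nhd_e_uminus:
  fixes U :: "'a::topological_group_add set"
  assumes "U \<in> nhd_filter_e"
  shows "{x. - x \<in> U} \<in> nhd_filter_e"
  by (rule nhd_e_vimage [OF assms]) (auto intro!: tendsto_eq_intros filterlim_ident)

lemma RUC_b_const: "(\<lambda>x. c) \<in> RUC_b"
proof -
  have "UNIV \<in> nhd_filter_e" by (simp add: nhd_e_iff)
  thus ?thesis unfolding RUC_b_iff by auto
qed

lemma RUC_b_add:
  assumes "f \<in> RUC_b" "g \<in> RUC_b"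
  shows "(\<lambda>x. f x + g x) \<in> RUC_b"
  unfolding RUC_b_iff
proof (intro conjI allI impI)
  show "bounded (range (\<lambda>x. f x + g x))"
    using assms by (intro bounded_plus_comp) (auto simp: RUC_b_iff)
  fix \<epsilon> :: real assume "\<epsilon> > 0"
  hence e: "\<epsilon> / 2 > 0" by simp
  obtain U V where "U \<in> nhd_filter_e" "V \<in> nhd_filter_e"
    "\<forall>x y. x - y \<in> U \<longrightarrow> \<bar>f x - f y\<bar> < \<epsilon> / 2" "\<forall>x y. x - y \<in> V \<longrightarrow> \<bar>g x - g y\<bar> < \<epsilon> / 2"
    using assms e unfolding RUC_b_iff by meson
  thus "\<exists>U\<in>nhd_filter_e. \<forall>x y. x - y \<in> U \<longrightarrow> \<bar>f x + g x - (f y + g y)\<bar> < \<epsilon>"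
    by (intro bexI [of _ "U \<inter> V"] nhd_e_Int) (smt (verit) IntE field_sum_of_halves)+
qed

lemma RUC_b_scale:
  assumes "f \<in> RUC_b"
  shows "(\<lambda>x. c * f x) \<in> RUC_b"
  unfolding RUC_b_iff
proof (intro conjI allI impI)
  show "bounded (range (\<lambda>x. c * f x))"
    using bounded_scaling [of "range f" c] assms by (simp add: RUC_b_iff image_image)
  fix \<epsilon> :: real assume e: "\<epsilon> > 0"
  hence "\<epsilon> / (\<bar>c\<bar> + 1) > 0" by simp
  then obtain U where U: "U \<in> nhd_filter_e" "\<forall>x y. x - y \<in> U \<longrightarrow> \<bar>f x - f y\<bar> < \<epsilon> / (\<bar>c\<bar> + 1)"
    using assms unfolding RUC_b_iff by meson
  have "\<bar>c * f x - c * f y\<bar> < \<epsilon>" if "x - y \<in> U" for x y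
  proof -
    have "\<bar>c * f x - c * f y\<bar> = \<bar>c\<bar> * \<bar>f x - f y\<bar>" by (simp add: abs_mult flip: right_diff_distrib)
    also have "\<dots> \<le> (\<bar>c\<bar> + 1) * \<bar>f x - f y\<bar>" by (intro mult_right_mono) auto
    also have "\<dots> < (\<bar>c\<bar> + 1) * (\<epsilon> / (\<bar>c\<bar> + 1))" using U(2) that by (intro mult_strict_left_mono) auto
    also have "\<dots> = \<epsilon>" by simp
    finally show ?thesis .
  qed
  thus "\<exists>U\<in>nhd_filter_e. \<forall>x y. x - y \<in> U \<longrightarrow> \<bar>c * f x - c * f y\<bar> < \<epsilon>" using U(1) by blast
qed

lemma fun_subspace_RUC_b: "fun_subspace RUC_b"
  unfolding fun_subspace_def using RUC_b_const RUC_b_add RUC_b_scale by blast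

lemma RUC_b_translate:
  fixes f :: "'a::topological_group_add \<Rightarrow> real"
  assumes "f \<in> RUC_b"
  shows "(\<lambda>x. f (g + x)) \<in> RUC_b"
  unfolding RUC_b_iff
proof (intro conjI allI impI)
  show "bounded (range (\<lambda>x. f (g + x)))"
    using assms by (auto simp: RUC_b_iff intro: bounded_subset)
  fix \<epsilon> :: real assume "\<epsilon> > 0"
  then obtain U where U: "U \<in> nhd_filter_e" "\<forall>x y. x - y \<in> U \<longrightarrow> \<bar>f x - f y\<bar> < \<epsilon>"
    using assms unfolding RUC_b_iff by meson
  have "(g + x) - (g + y) = g + (x - y) - g" for x y
    by (simp only: diff_conv_add_uminus minus_add add.assoc)
  thus "\<exists>U\<in>nhd_filter_e. \<forall>x y. x - y \<in> U \<longrightarrow> \<bar>f (g + x) - f (g + y)\<bar> < \<epsilon>"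
    using U nhd_e_conj [OF U(1), of g] by (intro bexI [of _ "{x. g + x - g \<in> U}"]) auto
qed

text \<open>These are the elements of the span of the functions \<open>f \<circ> T i - f\<close>, on
  which an invariant mean vanishes. With lists, sums are concatenations and repeated entries need no
  care.\<close>

definition drift :: "('i \<Rightarrow> 'x \<Rightarrow> 'x) \<Rightarrow> (('x \<Rightarrow> real) \<times> 'i) list \<Rightarrow> 'x \<Rightarrow> real" where
  "drift T ps x = (\<Sum>(f, i)\<leftarrow>ps. f (T i x) - f x)"

lemma drift_simps [simp]:
  "drift T [] x = 0" "drift T ((f, i) # ps) x = f (T i x) - f x + drift T ps x"
  "drift T (ps @ qs) x = drift T ps x + drift T qs x"
  by (simp_all add: drift_def)

lemma drift_scale: "drift T (map (\<lambda>(f, i). (\<lambda>x. c * f x, i)) ps) x = c * drift T ps x"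
  by (induction ps) (auto simp: algebra_simps)

text \<open>The drifts form a linear space, so a mean that is nonnegative on them is zero on them,
  which is invariance. The hypothesis \<open>small\<close> is the condition that
  \<open>mean_exists\<close> imposes on the cone.\<close>

lemma invariant_mean_exists:
  fixes T :: "'i \<Rightarrow> 'x \<Rightarrow> 'x"
  assumes V: "fun_subspace V" and bnd: "\<And>f. f \<in> V \<Longrightarrow> bounded (range f)" and one: "(\<lambda>x. 1) \<in> V"
    and T: "\<And>f i. f \<in> V \<Longrightarrow> (\<lambda>x. f (T i x)) \<in> V"
    and small: "\<And>ps \<delta>. fst ` set ps \<subseteq> V \<Longrightarrow> \<delta> > 0 \<Longrightarrow> \<exists>x. - \<delta> < drift T ps x"
  shows "\<exists>m. mean_on V m \<and> (\<forall>f\<in>V. \<forall>i. m (\<lambda>x. f (T i x)) = m f)"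
proof -
  define C where "C = drift T ` {ps. fst ` set ps \<subseteq> V}"
  have C_V: "drift T ps \<in> V" if "fst ` set ps \<subseteq> V" for ps
    using that
  proof (induction ps)
    case Nil
    have "drift T [] = (\<lambda>x. 0)" by auto
    thus ?case using fun_subspaceD(5) [OF V] by simp
  next
    case (Cons p ps)
    obtain f i where p: "p = (f, i)" by force
    have f: "f \<in> V" using Cons p by auto
    have "(\<lambda>x. (f (T i x) - f x) + drift T ps x) \<in> V"
      using Cons by (intro fun_subspaceD(1) [OF V fun_subspaceD(4) [OF V T [OF f] f]]) simp
    moreover have "drift T (p # ps) = (\<lambda>x. (f (T i x) - f x) + drift T ps x)" by (auto simp: p)
    ultimately show ?case by simp
  qed
  have scale: "(\<lambda>x. c * f x) \<in> C" if f: "f \<in> C" for c f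
  proof -
    obtain ps where ps: "f = drift T ps" "fst ` set ps \<subseteq> V" using f by (auto simp: C_def)
    hence "(\<lambda>x. c * f x) = drift T (map (\<lambda>(f, i). (\<lambda>x. c * f x, i)) ps)"
      by (auto simp: drift_scale)
    moreover have "fst ` set (map (\<lambda>(f, i). (\<lambda>x. c * f x, i)) ps) \<subseteq> V"
      using ps(2) by (force intro: fun_subspaceD(2) [OF V])
    ultimately show ?thesis unfolding C_def by blast
  qed
  have "\<exists>m. mean_on V m \<and> (\<forall>f\<in>C. m f \<ge> 0)"
  proof (rule mean_exists [OF V bnd one])
    show "C \<subseteq> V" using C_V by (auto simp: C_def)
    show "C \<noteq> {}" by (auto simp: C_def intro!: exI [of _ "[]"])
  next
    fix f f' assume "f \<in> C" "f' \<in> C"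
    then obtain ps ps' where "f = drift T ps" "fst ` set ps \<subseteq> V" "f' = drift T ps'" "fst ` set ps' \<subseteq> V"
      by (auto simp: C_def)
    hence "(\<lambda>x. f x + f' x) = drift T (ps @ ps')" "fst ` set (ps @ ps') \<subseteq> V" by auto
    thus "(\<lambda>x. f x + f' x) \<in> C" unfolding C_def by blast
  qed (use scale small in \<open>auto simp: C_def\<close>)
  then obtain m where m: "mean_on V m" and mC: "\<And>f. f \<in> C \<Longrightarrow> m f \<ge> 0" by blast
  have lin: "linear_on V m" using m by (simp add: mean_on_def)
  have "m (\<lambda>x. f (T i x)) = m f" if f: "f \<in> V" for f i
  proof -
    define d where "d = (\<lambda>x. f (T i x) - f x)"
    have "d = drift T [(f, i)]" by (auto simp: d_def)
    hence dC: "d \<in> C" using f unfolding C_def by auto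
    hence dV: "d \<in> V" using C_V by (auto simp: C_def)
    have "m (\<lambda>x. (-1) * d x) = (-1) * m d" by (rule linear_on_scale [OF lin dV])
    hence "m d = 0" using mC [OF dC] mC [OF scale [OF dC, of "-1"]] by simp
    thus ?thesis using linear_on_diff [OF V lin T [OF f, of i] f] by (simp add: d_def)
  qed
  thus ?thesis using m by blast
qed

lemma not_amenable_imp_drift:
  assumes "\<not> amenable TYPE('a::topological_group_add)"
  shows "\<exists>(ps :: (('a \<Rightarrow> real) \<times> 'a) list) \<delta>. fst ` set ps \<subseteq> RUC_b \<and> \<delta> > 0 \<and> (\<forall>x. \<delta> \<le> drift (+) ps x)"
proof (rule ccontr)
  assume n: "\<not> ?thesis"
  have "\<exists>m. mean_on RUC_b m \<and> (\<forall>f\<in>RUC_b. \<forall>g::'a. m (\<lambda>x. f (g + x)) = m f)"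
  proof (rule invariant_mean_exists [OF fun_subspace_RUC_b])
    fix ps :: "(('a \<Rightarrow> real) \<times> 'a) list" and \<delta> :: real
    assume ps: "fst ` set ps \<subseteq> RUC_b" and \<delta>: "\<delta> > 0"
    \<comment> \<open>The negated claim is applied to the negated functions: a drift below
      \<open>\<delta>\<close> at some point becomes a drift above \<open>- \<delta>\<close>
      there.\<close>
    define c :: real where "c = - 1"
    let ?qs = "map (\<lambda>(f, i). (\<lambda>x. c * f x, i)) ps"
    have "fst ` set ?qs \<subseteq> RUC_b" using ps by (force intro: RUC_b_scale)
    hence "\<not> (\<forall>x. \<delta> \<le> drift (+) ?qs x)" using n \<delta> by metis
    then obtain x where "drift (+) ?qs x < \<delta>" by (auto simp: not_le)
    hence "- \<delta> < drift (+) ps x" unfolding drift_scale by (simp add: c_def)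
    thus "\<exists>x. - \<delta> < drift (+) ps x" ..
  qed (use RUC_b_const RUC_b_translate in \<open>auto simp: RUC_b_iff\<close>)
  then obtain m where "mean_on RUC_b m" "\<forall>f\<in>RUC_b. \<forall>g::'a. m (\<lambda>x. f (g + x)) = m f" by blast
  hence "amenable TYPE('a)"
    unfolding amenable_def by (intro exI [of _ m]) (auto simp: mean_on_def linear_on_def comp_def)
  thus False using assms by blast
qed

section \<open>From drift to expansion in \<open>W\<^sub>U(G)\<close>\<close>

lemma subgroup_generate_BijGroup:
  "\<alpha> ` I \<subseteq> Bij X \<Longrightarrow> subgroup (generate (BijGroup X) (\<alpha> ` I)) (BijGroup X)"
  by (rule group.generate_is_subgroup [OF group_BijGroup]) simp

lemma Bij_mem: "\<gamma> \<in> Bij X \<Longrightarrow> x \<in> X \<Longrightarrow> \<gamma> x \<in> X"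
  by (auto simp: Bij_def bij_betw_def)

definition wobbling_set :: "('x \<Rightarrow> 'x) set \<Rightarrow> 'x set \<Rightarrow> ('x \<Rightarrow> 'x) set" where
  "wobbling_set \<Gamma> X = {\<gamma> \<in> Bij X. \<exists>E. finite E \<and> E \<subseteq> \<Gamma> \<and> (\<forall>x\<in>X. \<exists>g\<in>E. \<gamma> x = g x)}"

lemma wobbling_of_eq:
  "wobbling_of I X \<alpha> = (BijGroup X)\<lparr>carrier := wobbling_set (generate (BijGroup X) (\<alpha> ` I)) X\<rparr>"
  by (simp add: wobbling_of_def wobbling_group_def perm_gen_def wobbling_set_def)

lemma subgroup_wobbling_set:
  assumes "\<alpha> ` I \<subseteq> Bij X"
  shows "subgroup (wobbling_set (generate (BijGroup X) (\<alpha> ` I)) X) (BijGroup X)"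
proof -
  have "group_action (perm_gen I X \<alpha>) X (\<lambda>\<gamma>. \<gamma>)" by (rule group_action_perm_gen) (use assms in simp)
  moreover have "group (perm_gen I X \<alpha>)" unfolding perm_gen_def
    by (rule subgroup.subgroup_is_group [OF subgroup_generate_BijGroup [OF assms] group_BijGroup])
  ultimately have "subgroup (carrier (wobbling_of I X \<alpha>)) (BijGroup X)"
    unfolding wobbling_of_def by (intro wobbling_group_subgroup)
  thus ?thesis by (simp add: wobbling_of_eq)
qed

lemma near_translations_Bij: "\<alpha> \<in> near_translations U \<Longrightarrow> \<alpha> g \<in> Bij UNIV"
  by (auto simp: near_translations_def)

lemma perm_sum_near_translations_Bij:
  "perm_sum UNIV (near_translations U) (\<lambda>\<alpha>. \<alpha>) g \<in> Bij (UNIV \<times> near_translations U)"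
proof -
  have "perm_sum UNIV (near_translations U) (\<lambda>\<alpha>. \<alpha>) g \<in> carrier (BijGroup (UNIV \<times> near_translations U))"
    by (rule perm_sum_Bij) (use near_translations_Bij in simp)
  thus ?thesis by simp
qed

lemma translation_Bij: "(\<lambda>x. g + x) \<in> Bij (UNIV :: 'a::group_add set)"
proof -
  have "bij_betw (\<lambda>x. g + x) UNIV UNIV"
    by (rule bij_betw_byWitness [where f' = "\<lambda>x. - g + x"]) (auto simp flip: add.assoc)
  thus ?thesis by (simp add: Bij_def)
qed

lemma translation_near_translations:
  "U \<in> nhd_filter_e \<Longrightarrow> (\<lambda>g x. g + x) \<in> near_translations U"
  using translation_Bij nhd_e_zero [of U] by (auto simp: near_translations_def intro!: exI [of _ 0])

text \<open>The loss depends only on \<open>U\<close> and the list, not on the perturbed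
  translations \<open>a\<close>. So one constant serves all of \<open>near_translations U\<close>,
  and with it the direct sum.\<close>

lemma drift_close:
  fixes ps :: "(('a::topological_group_add \<Rightarrow> real) \<times> 'a) list" and \<epsilon> :: real
  assumes "\<And>f x y. f \<in> fst ` set ps \<Longrightarrow> x - y \<in> U \<Longrightarrow> \<bar>f x - f y\<bar> \<le> \<epsilon>"
    and "\<And>g. g \<in> snd ` set ps \<Longrightarrow> a g x - (g + x) \<in> U"
  shows "drift (+) ps x - length ps * \<epsilon> \<le> drift a ps x"
  using assms
proof (induction ps)
  case (Cons p ps)
  obtain f g where p: "p = (f, g)" by force
  have "drift (+) ps x - length ps * \<epsilon> \<le> drift a ps x"
    using Cons.prems by (intro Cons.IH) (auto simp: p)
  moreover have "\<bar>f (a g x) - f (g + x)\<bar> \<le> \<epsilon>" using Cons.prems by (auto simp: p)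
  ultimately show ?case by (simp add: p algebra_simps abs_le_iff)
qed simp

lemma not_amenable_imp_F2:
  assumes "\<not> amenable TYPE('a::topological_group_add)"
  shows "\<exists>U\<in>(nhd_filter_e :: 'a set set). F2_semi_regular_in (UNIV \<times> near_translations U) (wobbling_nhd U)"
proof -
  obtain ps :: "(('a \<Rightarrow> real) \<times> 'a) list" and \<delta>
    where ps: "fst ` set ps \<subseteq> RUC_b" and \<delta>: "\<delta> > 0" "\<And>x. \<delta> \<le> drift (+) ps x"
    using not_amenable_imp_drift [OF assms] by blast
  define n where "n = length ps"
  \<comment> \<open>With this choice the perturbation costs at most half of the drift;
    \<open>n + 1\<close> instead of \<open>n\<close> admits the empty list.\<close>
  define \<epsilon> where "\<epsilon> = \<delta> / (2 * (n + 1))"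
  have \<epsilon>: "\<epsilon> > 0" using \<delta>(1) by (simp add: \<epsilon>_def)
  have "n * \<epsilon> \<le> (n + 1) * \<epsilon>" using \<epsilon> by simp
  also have "\<dots> = \<delta> / 2" by (simp add: \<epsilon>_def field_simps)
  finally have n\<epsilon>: "n * \<epsilon> \<le> \<delta> / 2" .
  have "fst ` set ps \<subseteq> bounded_funs" using ps by (auto simp: RUC_b_iff bounded_funs_def)
  then obtain B where B: "B \<ge> 0" "\<And>f x. f \<in> fst ` set ps \<Longrightarrow> \<bar>f x\<bar> \<le> B"
    using bounded_funs_uniform_bound [of "fst ` set ps"] by auto
  have "\<exists>U\<in>nhd_filter_e. \<forall>x y. x - y \<in> U \<longrightarrow> \<bar>f x - f y\<bar> < \<epsilon>" if "f \<in> fst ` set ps" for f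
    using ps that \<epsilon> by (auto simp: RUC_b_iff)
  then obtain V where V: "\<And>f. f \<in> fst ` set ps \<Longrightarrow> V f \<in> nhd_filter_e"
    "\<And>f x y. f \<in> fst ` set ps \<Longrightarrow> x - y \<in> V f \<Longrightarrow> \<bar>f x - f y\<bar> < \<epsilon>" by metis
  define U where "U = (\<Inter>f\<in>fst ` set ps. V f)"
  have U: "U \<in> nhd_filter_e" unfolding U_def using V(1) by (intro nhd_e_INT) auto
  have Uc: "\<bar>f x - f y\<bar> \<le> \<epsilon>" if "f \<in> fst ` set ps" "x - y \<in> U" for f x y
    using V(2) [OF that(1), of x y] that by (auto simp: U_def)
  let ?N = "near_translations U"
  let ?X = "UNIV \<times> ?N :: ('a \<times> ('a \<Rightarrow> 'a \<Rightarrow> 'a)) set"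
  let ?s = "perm_sum UNIV ?N (\<lambda>\<alpha>. \<alpha>)"
  let ?\<Gamma> = "generate (BijGroup ?X) (?s ` UNIV)"
  have sB: "?s g \<in> Bij ?X" for g
    by (rule perm_sum_near_translations_Bij)
  hence sub: "?s ` UNIV \<subseteq> Bij ?X" by blast
  have \<Gamma>: "subgroup ?\<Gamma> (BijGroup ?X)" by (rule subgroup_generate_BijGroup [OF sub])
  \<comment> \<open>Only the group coordinate is read, so the same functions work in every summand;
    adding \<open>B\<close> makes them nonnegative.\<close>
  define F where "F i p = fst (ps ! i) (fst p) + B" for i and p :: "'a \<times> ('a \<Rightarrow> 'a \<Rightarrow> 'a)"
  define \<sigma> where "\<sigma> i = ?s (snd (ps ! i))" for i
  \<comment> \<open>The bound is \<open>2 * B\<close>; the added 1 makes it positive even if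
    \<open>B = 0\<close>.\<close>
  define M where "M = 2 * B + 1"
  have F: "0 \<le> F i p" "F i p \<le> M" if "i < n" for i p
  proof -
    have "\<bar>fst (ps ! i) (fst p)\<bar> \<le> B" by (rule B(2)) (use that in \<open>simp add: n_def\<close>)
    thus "0 \<le> F i p" "F i p \<le> M" using B(1) by (auto simp: F_def M_def)
  qed
  have drift: "\<delta> / 2 \<le> (\<Sum>i<n. F i (\<sigma> i p) - F i p)" if p: "p \<in> ?X" for p
  proof -
    obtain x \<alpha> where x\<alpha>: "p = (x, \<alpha>)" "\<alpha> \<in> ?N" using p by auto
    have near: "\<alpha> g x - (g + x) \<in> U" for g
    proof -
      obtain u where "\<alpha> g x = u + g + x" "u \<in> U" using x\<alpha>(2) by (auto simp: near_translations_def)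
      thus ?thesis by (simp add: add.assoc)
    qed
    have "\<delta> / 2 \<le> drift (+) ps x - length ps * \<epsilon>" using \<delta>(2) [of x] n\<epsilon> by (simp add: n_def)
    also have "\<dots> \<le> drift \<alpha> ps x" using Uc near by (intro drift_close)
    also have "\<dots> = (\<Sum>i<n. F i (\<sigma> i p) - F i p)"
      using x\<alpha> by (simp add: drift_def sum_list_sum_nth n_def atLeast0LessThan split_def F_def \<sigma>_def perm_sum_def)
    finally show ?thesis .
  qed
  \<comment> \<open>The diagonal is included so that a set is contained in its image, as
    \<open>drift_imp_expansion\<close> requires.\<close>
  define T where "T = {(p, q). p \<in> ?X \<and> (q = p \<or> (\<exists>i<n. q = \<sigma> i p))}"
  have \<sigma>X: "\<sigma> i p \<in> ?X" if "p \<in> ?X" for i p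
    unfolding \<sigma>_def by (rule Bij_mem [OF sB that])
  have TX: "T \<subseteq> ?X \<times> ?X" unfolding T_def using \<sigma>X by blast
  have bT: "bounded_rel ?\<Gamma> T"
    unfolding bounded_rel_def
  proof (intro exI [of _ "insert \<one>\<^bsub>BijGroup ?X\<^esub> (\<sigma> ` {..<n})"] conjI)
    show "insert \<one>\<^bsub>BijGroup ?X\<^esub> (\<sigma> ` {..<n}) \<subseteq> ?\<Gamma>"
      using generate.one generate.incl [of _ "?s ` UNIV" "BijGroup ?X"] by (auto simp: \<sigma>_def)
    show "\<forall>(p, q)\<in>T. \<exists>g\<in>insert \<one>\<^bsub>BijGroup ?X\<^esub> (\<sigma> ` {..<n}). q = g p"
      by (auto simp: T_def one_BijGroup)
  qed simp
  have expand: "(1 + \<delta> / 2 / (M * (card {..<n} + 1))) * card S \<le> card (T `` S)"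
    if S: "finite S" "S \<subseteq> ?X" for S
  proof (rule drift_imp_expansion [of "{..<n}" \<sigma> S F M "\<delta> / 2"])
    show "inj_on (\<sigma> i) S" for i
      using sB S(2) unfolding \<sigma>_def Bij_def bij_betw_def by (blast intro: inj_on_subset)
    have "T `` S \<subseteq> S \<union> (\<Union>i<n. \<sigma> i ` S)" by (auto simp: T_def)
    thus "finite (T `` S)" using S(1) finite_subset by blast
    show "S \<subseteq> T `` S" using S by (auto simp: T_def)
    show "\<sigma> i ` S \<subseteq> T `` S" if "i \<in> {..<n}" for i using S that by (force simp: T_def)
  qed (use F drift S B(1) in \<open>auto simp: M_def\<close>)
  have gt1: "1 + \<delta> / 2 / (M * (card {..<n} + 1)) > 1" using \<delta>(1) B(1) by (simp add: M_def)
  have ne: "?X \<noteq> {}" using translation_near_translations [OF U] by blast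
  have near: "\<gamma> \<in> wobbling_set ?\<Gamma> ?X"
    if \<gamma>: "\<gamma> \<in> Bij ?X" "bounded_rel ?\<Gamma> S" "\<And>x. x \<in> ?X \<Longrightarrow> (x, \<gamma> x) \<in> S" for \<gamma> S
  proof -
    obtain E where E: "finite E" "E \<subseteq> ?\<Gamma>" "\<forall>(x, y)\<in>S. \<exists>g\<in>E. y = g x"
      using \<gamma>(2) by (auto simp: bounded_rel_def)
    have "\<forall>x\<in>?X. \<exists>g\<in>E. \<gamma> x = g x" using \<gamma>(3) E(3) by blast
    thus ?thesis using E \<gamma>(1) unfolding wobbling_set_def by blast
  qed
  have "F2_semi_regular_in ?X ((BijGroup ?X)\<lparr>carrier := wobbling_set ?\<Gamma> ?X\<rparr>)"
    by (rule expansion_imp_F2 [OF \<Gamma> ne subgroup_wobbling_set [OF sub] near TX bT gt1 expand])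
  thus ?thesis using U by (auto simp: wobbling_nhd_def wobbling_of_eq)
qed

text \<open>The fibre over \<open>\<alpha>\<close> is invariant. Semi-regularity is what survives
  there: a merely faithful action could become trivial on one fibre, but a free one stays
  free.\<close>

lemma F2_wobbling_nhd_imp:
  fixes U :: "'a::topological_group_add set"
  assumes F: "F2_semi_regular_in (UNIV \<times> near_translations U) (wobbling_nhd U)"
    and \<alpha>: "\<alpha> \<in> near_translations U"
  shows "F2_semi_regular_in UNIV (wobbling_of UNIV UNIV \<alpha>)"
proof -
  let ?N = "near_translations U"
  let ?X = "UNIV \<times> ?N :: ('a \<times> ('a \<Rightarrow> 'a \<Rightarrow> 'a)) set"
  let ?s = "perm_sum UNIV ?N (\<lambda>\<alpha>. \<alpha>)"
  let ?\<Gamma> = "generate (BijGroup ?X) (?s ` UNIV)"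
  let ?\<Gamma>' = "generate (BijGroup UNIV) (\<alpha> ` UNIV)"
  interpret B: group "BijGroup ?X" by (rule group_BijGroup)
  have sub: "?s ` UNIV \<subseteq> Bij ?X"
    using perm_sum_near_translations_Bij by blast
  have sub': "\<alpha> ` UNIV \<subseteq> Bij UNIV" using near_translations_Bij [OF \<alpha>] by blast
  have \<Gamma>': "subgroup ?\<Gamma>' (BijGroup UNIV)" by (rule subgroup_generate_BijGroup [OF sub'])
  have C: "subgroup (wobbling_set ?\<Gamma> ?X) (BijGroup ?X)" by (rule subgroup_wobbling_set [OF sub])
  have C': "subgroup (wobbling_set ?\<Gamma>' UNIV) (BijGroup UNIV)" by (rule subgroup_wobbling_set [OF sub'])
  define r where "r \<gamma> x = fst (\<gamma> (x, \<alpha>))" for \<gamma> :: "'a \<times> ('a \<Rightarrow> 'a \<Rightarrow> 'a) \<Rightarrow> 'a \<times> ('a \<Rightarrow> 'a \<Rightarrow> 'a)" and x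
  have r\<Gamma>: "r \<gamma> \<in> ?\<Gamma>' \<and> (\<forall>x. \<gamma> (x, \<alpha>) = (r \<gamma> x, \<alpha>))" if "\<gamma> \<in> ?\<Gamma>" for \<gamma>
    using that
  proof (induction rule: generate.induct)
    case one
    have "r \<one>\<^bsub>BijGroup ?X\<^esub> = \<one>\<^bsub>BijGroup UNIV\<^esub>" using \<alpha> by (auto simp: r_def one_BijGroup)
    hence "r \<one>\<^bsub>BijGroup ?X\<^esub> \<in> ?\<Gamma>'" using generate.one [of "BijGroup UNIV"] by (simp only:)
    moreover have "\<one>\<^bsub>BijGroup ?X\<^esub> (x, \<alpha>) = (r \<one>\<^bsub>BijGroup ?X\<^esub> x, \<alpha>)" for x
      using \<alpha> by (simp add: r_def one_BijGroup)
    ultimately show ?case by blast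
  next
    case (incl h)
    then obtain g where g: "h = ?s g" by blast
    have "r h = \<alpha> g" using \<alpha> by (auto simp: g r_def perm_sum_def)
    moreover have "h (x, \<alpha>) = (\<alpha> g x, \<alpha>)" for x using \<alpha> by (simp add: g perm_sum_def)
    ultimately show ?case using generate.incl [of "\<alpha> g" "\<alpha> ` UNIV" "BijGroup UNIV"] by simp
  next
    case (inv h)
    then obtain g where g: "h = ?s g" by blast
    have hB: "h \<in> Bij ?X" using sub g by blast
    have gB: "\<alpha> g \<in> Bij UNIV" using sub' by blast
    have eq: "(inv\<^bsub>BijGroup ?X\<^esub> h) (x, \<alpha>) = ((inv\<^bsub>BijGroup UNIV\<^esub> (\<alpha> g)) x, \<alpha>)" for x
    proof -
      let ?y = "inv_into UNIV (\<alpha> g) x"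
      have "\<alpha> g ?y = x" using gB by (auto simp: Bij_def bij_betw_def intro: f_inv_into_f)
      hence "h (?y, \<alpha>) = (x, \<alpha>)" using \<alpha> by (simp add: g perm_sum_def)
      moreover have "inj_on h ?X" using hB by (auto simp: Bij_def bij_betw_def)
      ultimately have "inv_into ?X h (x, \<alpha>) = (?y, \<alpha>)" using \<alpha> by (intro inv_into_f_eq) auto
      thus ?thesis using \<alpha> by (simp add: inv_BijGroup [OF hB] inv_BijGroup [OF gB])
    qed
    hence "r (inv\<^bsub>BijGroup ?X\<^esub> h) = inv\<^bsub>BijGroup UNIV\<^esub> (\<alpha> g)" by (auto simp: r_def)
    thus ?case using eq generate.inv [of "\<alpha> g" "\<alpha> ` UNIV" "BijGroup UNIV"] by auto
  next
    case (eng h k)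
    have B: "h \<in> Bij ?X" "k \<in> Bij ?X"
      using eng.hyps subgroup.subset [OF subgroup_generate_BijGroup [OF sub]] by auto
    have B': "r h \<in> Bij UNIV" "r k \<in> Bij UNIV" using eng.IH subgroup.subset [OF \<Gamma>'] by auto
    have eq: "(h \<otimes>\<^bsub>BijGroup ?X\<^esub> k) (x, \<alpha>) = ((r h \<otimes>\<^bsub>BijGroup UNIV\<^esub> r k) x, \<alpha>)" for x
      using eng.IH \<alpha> by (simp add: BijGroup_mult [OF B] BijGroup_mult [OF B'])
    hence "r (h \<otimes>\<^bsub>BijGroup ?X\<^esub> k) = r h \<otimes>\<^bsub>BijGroup UNIV\<^esub> r k" by (auto simp: r_def)
    thus ?case using eq eng.IH generate.eng [of "r h" "BijGroup UNIV" "\<alpha> ` UNIV" "r k"] by auto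
  qed
  have near: "\<exists>E. finite E \<and> E \<subseteq> ?\<Gamma>' \<and> (\<forall>x. \<exists>g\<in>E. \<gamma> (x, \<alpha>) = (g x, \<alpha>))"
    if \<gamma>: "\<gamma> \<in> wobbling_set ?\<Gamma> ?X" for \<gamma>
  proof -
    obtain E where E: "finite E" "E \<subseteq> ?\<Gamma>" "\<forall>x\<in>?X. \<exists>g\<in>E. \<gamma> x = g x"
      using \<gamma> unfolding wobbling_set_def by blast
    have "\<exists>g\<in>r ` E. \<gamma> (x, \<alpha>) = (g x, \<alpha>)" for x
    proof -
      have "(x, \<alpha>) \<in> ?X" using \<alpha> by simp
      then obtain g where g: "g \<in> E" "\<gamma> (x, \<alpha>) = g (x, \<alpha>)" using E(3) by blast
      moreover have "g (x, \<alpha>) = (r g x, \<alpha>)" using r\<Gamma> [of g] g(1) E(2) by blast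
      ultimately show ?thesis by auto
    qed
    moreover have "r ` E \<subseteq> ?\<Gamma>'" using E(2) r\<Gamma> by auto
    ultimately show ?thesis using E(1) by (intro exI [of _ "r ` E"]) auto
  qed
  have r: "\<gamma> (x, \<alpha>) = (r \<gamma> x, \<alpha>)" if "\<gamma> \<in> wobbling_set ?\<Gamma> ?X" for \<gamma> x
    using near [OF that] by (metis fst_conv r_def)
  have r_mult: "r (\<gamma> \<otimes>\<^bsub>BijGroup ?X\<^esub> \<gamma>') = (\<lambda>x. r \<gamma> (r \<gamma>' x))"
    if "\<gamma> \<in> wobbling_set ?\<Gamma> ?X" "\<gamma>' \<in> wobbling_set ?\<Gamma> ?X" for \<gamma> \<gamma>'
  proof -
    have "\<gamma> \<in> Bij ?X" "\<gamma>' \<in> Bij ?X" using that by (auto simp: wobbling_set_def)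
    thus ?thesis using \<alpha> r [OF that(2)] by (auto simp: r_def BijGroup_mult)
  qed
  have r_one: "r \<one>\<^bsub>BijGroup ?X\<^esub> = (\<lambda>x. x)" using \<alpha> by (auto simp: r_def one_BijGroup)
  \<comment> \<open>The restriction to the fibre is a bijection because the inverse of
    \<open>\<gamma>\<close> preserves the fibre as well.\<close>
  have rC: "r \<gamma> \<in> wobbling_set ?\<Gamma>' UNIV" if \<gamma>: "\<gamma> \<in> wobbling_set ?\<Gamma> ?X" for \<gamma>
  proof -
    let ?i = "inv\<^bsub>BijGroup ?X\<^esub> \<gamma>"
    have i: "?i \<in> wobbling_set ?\<Gamma> ?X" by (rule subgroup.m_inv_closed [OF C \<gamma>])
    have \<gamma>B: "\<gamma> \<in> carrier (BijGroup ?X)" using subgroup.subset [OF C] \<gamma> by blast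
    have "r \<gamma> (r ?i x) = x" "r ?i (r \<gamma> x) = x" for x
      using r_mult [OF \<gamma> i] r_mult [OF i \<gamma>] r_one B.r_inv [OF \<gamma>B] B.l_inv [OF \<gamma>B] by (metis)+
    hence "bij (r \<gamma>)" by (intro o_bij [of "r ?i"]) (auto simp: fun_eq_iff)
    hence "r \<gamma> \<in> Bij UNIV" by (simp add: Bij_def)
    moreover obtain E where "finite E" "E \<subseteq> ?\<Gamma>'" "\<And>x. \<exists>g\<in>E. \<gamma> (x, \<alpha>) = (g x, \<alpha>)"
      using near [OF \<gamma>] by blast
    ultimately show ?thesis using r [OF \<gamma>] unfolding wobbling_set_def by (auto intro!: exI [of _ E])
  qed
  obtain h where h: "h \<in> hom F2 (BijGroup ?X)" "\<And>w. w \<in> carrier F2 \<Longrightarrow> h w \<in> wobbling_set ?\<Gamma> ?X"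
    "\<And>w p. w \<in> carrier F2 \<Longrightarrow> w \<noteq> \<one>\<^bsub>F2\<^esub> \<Longrightarrow> p \<in> ?X \<Longrightarrow> h w p \<noteq> p"
    using F2_semi_regularD [OF C] F unfolding wobbling_nhd_def wobbling_of_eq by blast
  have "F2_semi_regular_in UNIV ((BijGroup UNIV)\<lparr>carrier := wobbling_set ?\<Gamma>' UNIV\<rparr>)"
  proof (rule F2_semi_regularI [OF C'])
    have rB: "r (h w) \<in> Bij UNIV" if "w \<in> carrier F2" for w
      using rC [OF h(2) [OF that]] by (simp add: wobbling_set_def)
    show "(\<lambda>w. r (h w)) \<in> hom F2 (BijGroup UNIV)"
    proof (rule homI)
      fix u v assume uv: "u \<in> carrier F2" "v \<in> carrier F2"
      have "h (u \<otimes>\<^bsub>F2\<^esub> v) = h u \<otimes>\<^bsub>BijGroup ?X\<^esub> h v" by (rule hom_mult [OF h(1) uv])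
      thus "r (h (u \<otimes>\<^bsub>F2\<^esub> v)) = r (h u) \<otimes>\<^bsub>BijGroup UNIV\<^esub> r (h v)"
        using r_mult [OF h(2) h(2)] uv rB by (auto simp: BijGroup_mult)
    qed (use rB in simp)
    fix w x assume w: "w \<in> carrier F2" "w \<noteq> \<one>\<^bsub>F2\<^esub>"
    thus "r (h w) x \<noteq> x" using h(3) [OF w, of "(x, \<alpha>)"] r [OF h(2) [OF w(1)], of x] \<alpha> by auto
  qed (use rC h(2) in auto)
  thus ?thesis by (simp add: wobbling_of_eq)
qed

section \<open>Invariant means and wobbling groups\<close>

lemma invariant_mean_generate:
  assumes \<alpha>: "\<alpha> ` I \<subseteq> Bij (UNIV :: 'x set)"
    and inv: "\<And>i f. i \<in> I \<Longrightarrow> f \<in> bounded_funs \<Longrightarrow> m (\<lambda>x. f (\<alpha> i x)) = (m f :: real)"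
    and \<gamma>: "\<gamma> \<in> generate (BijGroup UNIV) (\<alpha> ` I)" and f: "f \<in> bounded_funs"
  shows "m (\<lambda>x. f (\<gamma> x)) = m f"
  using \<gamma> f
proof (induction arbitrary: f rule: generate.induct)
  case (inv h)
  then obtain i where i: "i \<in> I" "h = \<alpha> i" by blast
  hence hB: "h \<in> Bij UNIV" using \<alpha> by blast
  let ?h' = "inv\<^bsub>BijGroup UNIV\<^esub> h"
  have "?h' (h x) = x" for x using hB by (simp add: inv_BijGroup Bij_def bij_betw_def)
  hence "m (\<lambda>x. f (?h' (\<alpha> i x))) = m f" by (simp add: i)
  thus ?case using assms(2) [OF i(1) bounded_funs_comp [OF inv.prems, of ?h']] by simp
next
  case (eng h k)
  have "h \<in> Bij UNIV" "k \<in> Bij UNIV"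
    using eng.hyps subgroup.subset [OF subgroup_generate_BijGroup [OF \<alpha>]] by auto
  thus ?case using eng.IH(1) [OF eng.prems] eng.IH(2) [OF bounded_funs_comp [OF eng.prems, of h]]
    by (simp add: BijGroup_mult)
qed (use assms(2) in \<open>auto simp: one_BijGroup\<close>)

text \<open>Cut the space into finitely many pieces on each of which \<open>\<gamma>\<close> agrees
  with one element of \<open>E\<close>. The mean is invariant on every piece, and finite additivity
  puts the pieces together.\<close>

lemma invariant_mean_wobbling:
  assumes m: "linear_on bounded_funs m"
    and inv: "\<And>\<gamma> f. \<gamma> \<in> \<Gamma> \<Longrightarrow> f \<in> bounded_funs \<Longrightarrow> m (\<lambda>x. f (\<gamma> x)) = m f"
    and \<Gamma>: "\<Gamma> \<subseteq> Bij UNIV"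
    and \<gamma>: "\<gamma> \<in> wobbling_set \<Gamma> UNIV" and f: "f \<in> bounded_funs"
  shows "m (\<lambda>x. f (\<gamma> x)) = m f"
proof -
  obtain E where E: "finite E" "E \<subseteq> \<Gamma>" "\<And>x. \<exists>g\<in>E. \<gamma> x = g x" and \<gamma>B: "\<gamma> \<in> Bij UNIV"
    using \<gamma> by (auto simp: wobbling_set_def)
  obtain e where e: "\<And>x. e x \<in> E" "\<And>x. \<gamma> x = e x x" using E(3) by metis
  have \<gamma>bij: "bij \<gamma>" using \<gamma>B by (simp add: Bij_def)
  \<comment> \<open>\<open>f\<close> restricted to the image under \<open>\<gamma>\<close> of the piece on which \<open>\<gamma>\<close> agrees with \<open>g\<close>\<close>
  define F where "F g y = (if e (inv_into UNIV \<gamma> y) = g then f y else 0)" for g y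
  have Fb: "F g \<in> bounded_funs" for g unfolding F_def by (rule bounded_funs_restrict [OF f])
  define D where "D g x = (if e x = g then f (\<gamma> x) else 0)" for g x
  have D: "m (D g) = m (F g)" if g: "g \<in> E" for g
  proof -
    have gB: "g \<in> Bij UNIV" using g E(2) \<Gamma> by blast
    define P where "P x \<longleftrightarrow> e (inv_into UNIV \<gamma> (g x)) = g" for x
    have "P x \<longleftrightarrow> e x = g" for x
    proof
      assume "P x"
      define z where "z = inv_into UNIV \<gamma> (g x)"
      have "\<gamma> z = g x" using \<gamma>bij by (simp add: z_def bij_is_surj surj_f_inv_f)
      moreover have "e z = g" using \<open>P x\<close> by (simp add: P_def z_def)
      ultimately have "g z = g x" using e(2) by metis
      hence "z = x" using gB by (auto simp: Bij_def bij_betw_def inj_on_def)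
      thus "e x = g" using \<open>e z = g\<close> by simp
    next
      assume "e x = g"
      hence "\<gamma> x = g x" using e(2) by metis
      hence "inv_into UNIV \<gamma> (g x) = x" using \<gamma>bij by (metis bij_is_inj inv_f_f)
      thus "P x" using \<open>e x = g\<close> by (simp add: P_def)
    qed
    hence "D g = (\<lambda>x. F g (g x))" using e(2) by (auto simp: D_def F_def P_def fun_eq_iff)
    thus ?thesis using inv [OF subsetD [OF E(2) g] Fb [of g]] by simp
  qed
  have Db: "D g \<in> bounded_funs" for g
    unfolding D_def by (rule bounded_funs_restrict [OF bounded_funs_comp [OF f]])
  have "(\<lambda>x. f (\<gamma> x)) = (\<lambda>x. \<Sum>g\<in>E. D g x)" using E(1) e(1) by (simp add: D_def)
  hence "m (\<lambda>x. f (\<gamma> x)) = (\<Sum>g\<in>E. m (D g))"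
    using linear_on_sum [OF fun_subspace_bounded_funs m, of E D] Db by simp
  also have "\<dots> = (\<Sum>g\<in>E. m (F g))" using D by simp
  also have "\<dots> = m (\<lambda>y. \<Sum>g\<in>E. F g y)"
    using linear_on_sum [OF fun_subspace_bounded_funs m, of E F] Fb by simp
  also have "(\<lambda>y. \<Sum>g\<in>E. F g y) = f" using E(1) e(1) by (simp add: F_def)
  finally show ?thesis .
qed

text \<open>
  The paradoxical decomposition: the points whose position in their free orbit starts with
  the letter \<open>s\<close> are the image under \<open>s\<close> of those that do not start with the inverse of \<open>s\<close>.
\<close>

lemma F2_paradoxical:
  assumes hom: "h \<in> hom F2 (BijGroup (UNIV :: 'x set))"
    and free: "\<And>w x. w \<in> carrier F2 \<Longrightarrow> w \<noteq> \<one>\<^bsub>F2\<^esub> \<Longrightarrow> h w x \<noteq> x"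
  shows "\<exists>p :: 'x \<Rightarrow> (bool \<times> nat) option.
    \<forall>s x. snd s \<in> {0, 1} \<longrightarrow> p x \<noteq> Some (inv_letter s) \<longrightarrow> p (h [s] x) = Some s"
proof -
  interpret F: group F2 unfolding F2_def by (rule group_free_group)
  have hB: "h w \<in> Bij UNIV" if "w \<in> carrier F2" for w using hom that by (auto simp: hom_def)
  interpret h: group_hom F2 "BijGroup UNIV" h
    by (simp add: group_hom_def group_hom_axioms_def hom F.is_group group_BijGroup)
  have mult: "h (u \<otimes>\<^bsub>F2\<^esub> v) x = h u (h v x)" if "u \<in> carrier F2" "v \<in> carrier F2" for u v x
    using hom_mult [OF hom that] hB that by (simp add: BijGroup_mult)
  have one: "h \<one>\<^bsub>F2\<^esub> x = x" for x by (simp add: one_BijGroup)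
  have uniq: "u = v" if uv: "u \<in> carrier F2" "v \<in> carrier F2" "h u x = h v x" for u v x
  proof -
    have "h (inv\<^bsub>F2\<^esub> u \<otimes>\<^bsub>F2\<^esub> v) x = h (inv\<^bsub>F2\<^esub> u) (h v x)"
      by (rule mult) (use uv in auto)
    also have "\<dots> = h (inv\<^bsub>F2\<^esub> u) (h u x)" using uv(3) by simp
    also have "\<dots> = h (inv\<^bsub>F2\<^esub> u \<otimes>\<^bsub>F2\<^esub> u) x" by (rule mult [symmetric]) (use uv in auto)
    also have "\<dots> = x" using uv one by simp
    finally have "inv\<^bsub>F2\<^esub> u \<otimes>\<^bsub>F2\<^esub> v = \<one>\<^bsub>F2\<^esub>" using free [of "inv\<^bsub>F2\<^esub> u \<otimes>\<^bsub>F2\<^esub> v" x] uv by auto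
    thus ?thesis using uv by (metis F.inv_equality F.inv_closed F.inv_inv)
  qed
  define orb where "orb x = {h w x | w. w \<in> carrier F2}" for x
  define t where "t x = (SOME y. y \<in> orb x)" for x
  have orb_step: "orb (h u x) = orb x" if u: "u \<in> carrier F2" for u x
  proof (intro equalityI subsetI)
    fix y assume "y \<in> orb (h u x)"
    then obtain w where "w \<in> carrier F2" "y = h w (h u x)" by (auto simp: orb_def)
    hence "y = h (w \<otimes>\<^bsub>F2\<^esub> u) x" "w \<otimes>\<^bsub>F2\<^esub> u \<in> carrier F2" using u by (simp_all only: mult F.m_closed)
    thus "y \<in> orb x" unfolding orb_def by blast
  next
    fix y assume "y \<in> orb x"
    then obtain w where w: "w \<in> carrier F2" "y = h w x" by (auto simp: orb_def)
    have "x = h (inv\<^bsub>F2\<^esub> u \<otimes>\<^bsub>F2\<^esub> u) x" using u one by simp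
    also have "\<dots> = h (inv\<^bsub>F2\<^esub> u) (h u x)" by (rule mult) (use u in auto)
    finally have "y = h w (h (inv\<^bsub>F2\<^esub> u) (h u x))" using w by simp
    also have "\<dots> = h (w \<otimes>\<^bsub>F2\<^esub> inv\<^bsub>F2\<^esub> u) (h u x)" by (rule mult [symmetric]) (use u w in auto)
    finally show "y \<in> orb (h u x)" unfolding orb_def using u w by blast
  qed
  have t: "\<exists>w\<in>carrier F2. h w (t x) = x" for x
  proof -
    have "x \<in> orb x" using one [of x] unfolding orb_def by (metis (mono_tags, lifting) F.one_closed mem_Collect_eq)
    hence "t x \<in> orb x" unfolding t_def by (rule someI)
    then obtain u where u: "u \<in> carrier F2" "t x = h u x" by (auto simp: orb_def)
    have "x = h (inv\<^bsub>F2\<^esub> u \<otimes>\<^bsub>F2\<^esub> u) x" using u one by simp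
    also have "\<dots> = h (inv\<^bsub>F2\<^esub> u) (t x)" unfolding u(2) by (rule mult) (use u in auto)
    finally show ?thesis using u by (intro bexI [of _ "inv\<^bsub>F2\<^esub> u"]) auto
  qed
  then obtain pos where pos: "\<And>x. pos x \<in> carrier F2" "\<And>x. h (pos x) (t x) = x" by metis
  \<comment> \<open>\<open>None\<close> marks the points whose position is the empty word, that is,
    the base point of each orbit.\<close>
  define p where "p x = (if pos x = [] then None else Some (hd (pos x)))" for x
  have "p (h [s] x) = Some s" if s: "snd s \<in> {0, 1}" and px: "p x \<noteq> Some (inv_letter s)" for s x
  proof -
    have sF: "[s] \<in> carrier F2" using s by (auto simp: F2_def free_group_def reduced_Cons)
    have "reduced_word (s # pos x)"
      using pos(1) [of x] px by (auto simp: F2_def free_group_def reduced_Cons p_def split: if_splits)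
    hence "[s] \<otimes>\<^bsub>F2\<^esub> pos x = s # pos x" by (simp add: F2_def free_group_def prepend_reduced)
    hence "h (s # pos x) (t x) = h [s] x" using mult [OF sF pos(1) [of x], of "t x"] pos(2) by simp
    moreover have "t (h [s] x) = t x" by (simp add: t_def orb_step [OF sF])
    moreover have "s # pos x \<in> carrier F2"
      using \<open>[s] \<otimes>\<^bsub>F2\<^esub> pos x = s # pos x\<close> F.m_closed [OF sF pos(1) [of x]] by simp
    ultimately have "pos (h [s] x) = s # pos x"
      using uniq [OF pos(1), of "s # pos x" "h [s] x" "t x"] pos(2) [of "h [s] x"] by simp
    thus ?thesis by (simp add: p_def)
  qed
  thus ?thesis by blast
qed

text \<open>For each of the two generators, the points that start with it and those that start with
  its inverse have total mean at least 1, since the former are translated so as to cover the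
  complement of the latter. The four sets are disjoint, so the total would be both at least 2 and at
  most 1.\<close>

lemma invariant_mean_no_F2:
  assumes \<alpha>: "\<alpha> ` I \<subseteq> Bij (UNIV :: 'x set)" and m: "mean_on bounded_funs m"
    and inv: "\<And>i f. i \<in> I \<Longrightarrow> f \<in> bounded_funs \<Longrightarrow> m (\<lambda>x. f (\<alpha> i x)) = m f"
  shows "\<not> F2_semi_regular_in UNIV (wobbling_of I UNIV \<alpha>)"
proof
  let ?\<Gamma> = "generate (BijGroup UNIV) (\<alpha> ` I)"
  have \<Gamma>: "?\<Gamma> \<subseteq> Bij UNIV" using subgroup.subset [OF subgroup_generate_BijGroup [OF \<alpha>]] by simp
  assume "F2_semi_regular_in UNIV (wobbling_of I UNIV \<alpha>)"
  then obtain h where h: "h \<in> hom F2 (BijGroup UNIV)" "\<And>w. w \<in> carrier F2 \<Longrightarrow> h w \<in> wobbling_set ?\<Gamma> UNIV"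
    "\<And>w x. w \<in> carrier F2 \<Longrightarrow> w \<noteq> \<one>\<^bsub>F2\<^esub> \<Longrightarrow> h w x \<noteq> x"
    using F2_semi_regularD [OF subgroup_wobbling_set [OF \<alpha>]] unfolding wobbling_of_eq by blast
  have mlin: "linear_on bounded_funs m" using m by (simp add: mean_on_def)
  note VD = fun_subspaceD [OF fun_subspace_bounded_funs]
  have invW: "m (\<lambda>x. f (\<gamma> x)) = m f" if "\<gamma> \<in> wobbling_set ?\<Gamma> UNIV" "f \<in> bounded_funs" for \<gamma> f
    by (rule invariant_mean_wobbling [OF mlin invariant_mean_generate [OF \<alpha> inv] \<Gamma> that])
  obtain p :: "'x \<Rightarrow> (bool \<times> nat) option"
    where p: "\<And>s x. snd s \<in> {0, 1} \<Longrightarrow> p x \<noteq> Some (inv_letter s) \<Longrightarrow> p (h [s] x) = Some s"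
    using F2_paradoxical [OF h(1,3)] by blast
  define A where "A s x = (if p x = Some s then 1 else 0 :: real)" for s x
  have Ab: "A s \<in> bounded_funs" for s by (rule bounded_funsI [of _ 1]) (simp add: A_def)
  have half: "1 \<le> m (A s) + m (A (inv_letter s))" if s: "snd s \<in> {0, 1}" for s
  proof -
    have sF: "[s] \<in> carrier F2" using s by (auto simp: F2_def free_group_def reduced_Cons)
    have b: "(\<lambda>x. A s (h [s] x)) \<in> bounded_funs" by (rule bounded_funs_comp [OF Ab])
    have "m (\<lambda>x. 1) \<le> m (\<lambda>x. A s (h [s] x) + A (inv_letter s) x)"
    proof (rule mean_on_mono [OF fun_subspace_bounded_funs m bounded_funs_const VD(1) [OF b Ab]])
      show "1 \<le> A s (h [s] x) + A (inv_letter s) x" for x using p [OF s, of x] by (auto simp: A_def)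
    qed
    also have "\<dots> = m (\<lambda>x. A s (h [s] x)) + m (A (inv_letter s))"
      by (rule linear_on_add [OF mlin b Ab])
    also have "m (\<lambda>x. A s (h [s] x)) = m (A s)" by (rule invW [OF h(2) [OF sF] Ab])
    finally show ?thesis using m by (simp add: mean_on_def)
  qed
  let ?L = "{(True, 0), (False, 0), (True, 1), (False, 1)} :: (bool \<times> nat) set"
  have "(\<Sum>s\<in>?L. m (A s)) = m (\<lambda>x. \<Sum>s\<in>?L. A s x)" "(\<lambda>x. \<Sum>s\<in>?L. A s x) \<in> bounded_funs"
    using linear_on_sum [OF fun_subspace_bounded_funs mlin, of ?L A] Ab by simp_all
  moreover have "(\<Sum>s\<in>?L. A s x) \<le> 1" for x by (auto simp: A_def)
  ultimately have "(\<Sum>s\<in>?L. m (A s)) \<le> m (\<lambda>x. 1)"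
    using mean_on_mono [OF fun_subspace_bounded_funs m _ bounded_funs_const] by metis
  thus False using half [of "(True, 0)"] half [of "(True, 1)"] m by (simp add: inv_letter_def mean_on_def)
qed

section \<open>Folner sets in amenable topological groups\<close>

text \<open>Three summands are needed since cutting a chain at half of its weight leaves one entry
  between the two halves.\<close>

lemma nhd_e_add3:
  fixes U :: "'a::topological_group_add set"
  assumes "U \<in> nhd_filter_e"
  shows "\<exists>V\<in>nhd_filter_e. \<forall>x\<in>V. \<forall>y\<in>V. \<forall>z\<in>V. x + y + z \<in> U"
proof -
  have half: "\<exists>V\<in>nhd_filter_e. \<forall>x\<in>V. \<forall>y\<in>V. x + y \<in> U"
    if U: "U \<in> nhd_filter_e" for U :: "'a set"
  proof -
    have "((\<lambda>p. fst p + snd p) \<longlongrightarrow> 0 + 0) (nhds (0::'a) \<times>\<^sub>F nhds (0::'a))"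
      by (intro tendsto_add filterlim_fst filterlim_snd)
    hence "eventually (\<lambda>p. fst p + snd p \<in> U) (nhds (0::'a) \<times>\<^sub>F nhds 0)"
      using U eventually_compose_filterlim [of "\<lambda>x. x \<in> U" "nhds 0"] by (simp add: nhd_e_iff)
    then obtain P Q where PQ: "eventually P (nhds (0::'a))" "eventually Q (nhds (0::'a))"
      "\<And>x y. P x \<Longrightarrow> Q y \<Longrightarrow> x + y \<in> U"
      unfolding eventually_prod_filter by auto
    thus ?thesis
      by (intro bexI [of _ "{x. P x \<and> Q x}"]) (auto simp: nhd_e_iff eventually_conj_iff)
  qed
  obtain V where V: "V \<in> nhd_filter_e" "\<And>x y. x \<in> V \<Longrightarrow> y \<in> V \<Longrightarrow> x + y \<in> U"
    using half [OF assms] by blast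
  obtain W where W: "W \<in> nhd_filter_e" "\<And>x y. x \<in> W \<Longrightarrow> y \<in> W \<Longrightarrow> x + y \<in> V"
    using half [OF V(1)] by blast
  show ?thesis
    using V W nhd_e_zero [OF W(1)]
    by (intro bexI [of _ "W \<inter> V"] nhd_e_Int) auto
qed

text \<open>
  The Birkhoff--Kakutani construction: the weights of the members of a chain are summed,
  and a chain of total weight below \<open>1/2 ^ Suc n\<close> is cut at half of its weight.
\<close>

lemma nhd_e_seminorm:
  fixes U :: "'a::topological_group_add set"
  assumes U: "U \<in> nhd_filter_e"
  shows "\<exists>N :: 'a \<Rightarrow> real. (\<forall>x. 0 \<le> N x) \<and> N 0 = 0 \<and> (\<forall>x y. N (x + y) \<le> N x + N y) \<and>
    (\<forall>\<epsilon>>0. {x. N x \<le> \<epsilon>} \<in> nhd_filter_e) \<and> (\<forall>x. N x < 1 \<longrightarrow> x \<in> U)"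
proof -
  have "\<exists>V :: nat \<Rightarrow> 'a set. \<forall>n. (V n \<in> nhd_filter_e \<and> V n \<subseteq> U) \<and>
      (\<forall>x\<in>V (Suc n). \<forall>y\<in>V (Suc n). \<forall>z\<in>V (Suc n). x + y + z \<in> V n)"
  proof (rule dependent_nat_choice)
    fix W :: "'a set" and n :: nat assume W: "W \<in> nhd_filter_e \<and> W \<subseteq> U"
    obtain V where V: "V \<in> nhd_filter_e" "\<forall>x\<in>V. \<forall>y\<in>V. \<forall>z\<in>V. x + y + z \<in> W"
      using nhd_e_add3 W by blast
    moreover have "V \<subseteq> W"
    proof
      fix x assume "x \<in> V"
      hence "x + 0 + 0 \<in> W" using V nhd_e_zero by blast
      thus "x \<in> W" by simp
    qed
    ultimately show "\<exists>V. (V \<in> nhd_filter_e \<and> V \<subseteq> U) \<and> (\<forall>x\<in>V. \<forall>y\<in>V. \<forall>z\<in>V. x + y + z \<in> W)"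
      using W by blast
  qed (use U in blast)
  then obtain V :: "nat \<Rightarrow> 'a set" where V: "\<And>n. V n \<in> nhd_filter_e" "\<And>n. V n \<subseteq> U"
    "\<And>n x y z. x \<in> V (Suc n) \<Longrightarrow> y \<in> V (Suc n) \<Longrightarrow> z \<in> V (Suc n) \<Longrightarrow> x + y + z \<in> V n" by metis
  have V0: "0 \<in> V n" for n by (rule nhd_e_zero [OF V(1)])
  have "V (Suc n) \<subseteq> V n" for n using V(3) [OF _ V0 V0] by auto
  hence mono: "V n \<subseteq> V m" if "m \<le> n" for m n using that by (rule lift_Suc_antimono_le)
  define w where "w x = (if \<forall>n. x \<in> V n then 0 else (1/2) ^ (LEAST n. x \<notin> V n) :: real)" for x
  have w0: "w 0 = 0" using V0 by (simp add: w_def)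
  have w_nonneg: "0 \<le> w x" for x by (simp add: w_def)
  have w_le: "w x \<le> (1/2) ^ n" if x: "x \<in> V n" for x n
  proof (cases "\<forall>n. x \<in> V n")
    case False
    then obtain k where "x \<notin> V k" by blast
    hence "x \<notin> V (LEAST n. x \<notin> V n)" by (rule LeastI [of "\<lambda>n. x \<notin> V n"])
    hence "\<not> (LEAST n. x \<notin> V n) \<le> n" using mono x by blast
    hence "n \<le> (LEAST n. x \<notin> V n)" by simp
    hence "(1/2) ^ (LEAST n. x \<notin> V n) \<le> ((1/2) ^ n :: real)" by (rule power_decreasing) auto
    moreover have "w x = (1/2) ^ (LEAST n. x \<notin> V n)" using False by (simp only: w_def if_False)
    ultimately show ?thesis by simp
  qed (simp add: w_def)
  have w_less: "x \<in> V n" if "w x < (1/2) ^ n" for x n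
  proof (rule ccontr)
    assume x: "x \<notin> V n"
    hence "(LEAST n. x \<notin> V n) \<le> n" by (rule Least_le)
    hence "(1/2) ^ n \<le> ((1/2) ^ (LEAST n. x \<notin> V n) :: real)" by (rule power_decreasing) auto
    also have "\<dots> = w x" using x by (auto simp: w_def)
    finally show False using that by simp
  qed
  define W where "W xs = sum_list (map w xs)" for xs
  have W_nonneg: "0 \<le> W xs" for xs unfolding W_def using w_nonneg by (induction xs) auto
  have W_app: "W (xs @ ys) = W xs + W ys" "W (x # xs) = w x + W xs" "W [] = 0" for xs ys x
    by (simp_all add: W_def)
  have chain: "sum_list xs \<in> V n" if "W xs < (1/2) ^ Suc n" for xs n
    using that
  proof (induction "length xs" arbitrary: xs n rule: less_induct)
    case less
    show ?case
    proof (cases "xs = []")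
      case False
      define T where "T = W xs"
      define k where "k = (LEAST k. k \<ge> length xs \<or> W (take (Suc k) xs) > T / 2)"
      have k: "k \<ge> length xs \<or> W (take (Suc k) xs) > T / 2"
        unfolding k_def by (rule LeastI [of _ "length xs"]) simp
      have kl: "k \<le> length xs" unfolding k_def by (rule Least_le) simp
      have below: "W (take j xs) \<le> T / 2" if "j \<le> k" for j
      proof (cases j)
        case 0 thus ?thesis using W_nonneg [of xs] by (simp add: W_app T_def)
      next
        case (Suc i)
        hence "\<not> (i \<ge> length xs \<or> W (take (Suc i) xs) > T / 2)"
          using that unfolding k_def by (intro not_less_Least) simp
        thus ?thesis using Suc by simp
      qed
      \<comment> \<open>If the weight \<open>T\<close> is 0, no prefix exceeds half of it and
        \<open>k\<close> is the length of \<open>xs\<close>; the last entry then becomes the middle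
        one.\<close>
      define k' where "k' = min k (length xs - 1)"
      have k': "k' < length xs" using False by (cases xs) (auto simp: k'_def)
      have split: "xs = take k' xs @ xs ! k' # drop (Suc k') xs" using k' by (rule id_take_nth_drop)
      have left: "W (take k' xs) \<le> T / 2" by (rule below) (simp add: k'_def)
      have right: "W (drop (Suc k') xs) \<le> T / 2"
      proof (cases "k < length xs")
        case True
        hence kk: "k' = k" by (simp add: k'_def)
        have "T = W (take (Suc k) xs) + W (drop (Suc k) xs)"
          unfolding T_def using W_app(1) [of "take (Suc k) xs" "drop (Suc k) xs"] by simp
        thus ?thesis using k True by (simp add: kk)
      next
        case F: False
        hence "drop (Suc k') xs = []" using kl by (simp add: k'_def)
        thus ?thesis using W_nonneg [of xs] by (simp add: W_app T_def)
      qed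
      have "T = W (take k' xs) + (w (xs ! k') + W (drop (Suc k') xs))"
        unfolding T_def using arg_cong [OF split, of W] by (simp only: W_app)
      hence "w (xs ! k') \<le> T"
        using W_nonneg [of "take k' xs"] W_nonneg [of "drop (Suc k') xs"] by linarith
      moreover have T: "T < (1/2) ^ Suc n" using less.prems by (simp add: T_def)
      ultimately have mid: "xs ! k' \<in> V (Suc n)" by (intro w_less) linarith
      \<comment> \<open>Halving the weight gains one index: the two outer sums and the middle entry
        all lie in \<open>V (Suc n)\<close>, and three such elements add up to one of
        \<open>V n\<close>.\<close>
      have half: "T / 2 < (1/2) ^ Suc (Suc n)" using T by simp
      have "sum_list (take k' xs) \<in> V (Suc n)" using left half k' by (intro less.hyps) auto
      moreover have "sum_list (drop (Suc k') xs) \<in> V (Suc n)"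
        using right half k' by (intro less.hyps) auto
      ultimately have "sum_list (take k' xs) + xs ! k' + sum_list (drop (Suc k') xs) \<in> V n"
        using mid by (intro V(3))
      also have "sum_list (take k' xs) + xs ! k' + sum_list (drop (Suc k') xs) = sum_list xs"
        using arg_cong [OF split, of sum_list] by (simp add: add.assoc)
      finally show ?thesis .
    qed (use V0 in simp)
  qed
  \<comment> \<open>This is the largest subadditive function below \<open>w\<close>.\<close>
  define N where "N x = (INF xs\<in>{xs. sum_list xs = x}. W xs)" for x
  have ne: "{xs. sum_list xs = x} \<noteq> {}" for x :: 'a by (auto intro!: exI [of _ "[x]"])
  have bdd: "bdd_below (W ` A)" for A using W_nonneg by (auto intro: bdd_belowI [of _ 0])
  have N_le: "N (sum_list xs) \<le> W xs" for xs unfolding N_def by (intro cINF_lower bdd) simp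
  have N_nonneg: "0 \<le> N x" for x unfolding N_def by (intro cINF_greatest ne W_nonneg)
  have N_add: "N (x + y) \<le> N x + N y" for x y
  proof -
    have *: "N (x + y) \<le> W xs + W ys" if "sum_list xs = x" "sum_list ys = y" for xs ys
      using N_le [of "xs @ ys"] that by (simp add: W_app)
    have "N (x + y) - W ys \<le> N x" if "sum_list ys = y" for ys
      unfolding N_def [of x] using *[OF _ that] by (intro cINF_greatest ne) (auto simp: algebra_simps)
    hence "N (x + y) - N x \<le> N y"
      unfolding N_def [of y] by (intro cINF_greatest ne) (auto simp: algebra_simps)
    thus ?thesis by simp
  qed
  have N0: "N 0 = 0" using N_le [of "[]"] N_nonneg [of 0] by (simp add: W_app)
  have N_small: "x \<in> U" if x: "N x < 1/2" for x
  proof -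
    obtain xs where "sum_list xs = x" "W xs < 1/2"
      using x cINF_less_iff [OF ne bdd, of x "1/2"] unfolding N_def by blast
    thus ?thesis using chain [of xs 0] V(2) by auto
  qed
  have N_nhd: "{x. N x \<le> \<epsilon>} \<in> nhd_filter_e" if \<epsilon>: "\<epsilon> > 0" for \<epsilon>
  proof -
    obtain n where n: "(1/2) ^ n < \<epsilon>" using real_arch_pow_inv [OF \<epsilon>, of "1/2"] by auto
    have "N x \<le> \<epsilon>" if x: "x \<in> V n" for x
      using N_le [of "[x]"] w_le [OF x] n by (simp add: W_app)
    thus ?thesis by (intro nhd_e_mono [OF V(1) [of n]]) auto
  qed
  \<comment> \<open>The chain argument with \<open>n = 0\<close> controls \<open>N x < 1/2\<close>;
    doubling \<open>N\<close> moves the threshold to 1.\<close>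
  have "{x. 2 * N x \<le> \<epsilon>} \<in> nhd_filter_e" if "\<epsilon> > 0" for \<epsilon>
    using N_nhd [of "\<epsilon> / 2"] that by (simp add: field_simps)
  moreover have "2 * N (x + y) \<le> 2 * N x + 2 * N y" for x y using N_add [of x y] by simp
  ultimately show ?thesis
    using N0 N_nonneg N_small by (intro exI [of _ "\<lambda>x. 2 * N x"]) auto
qed

text \<open>The bumps stand in for indicator functions of sets, which are not uniformly continuous.
  Their modulus of continuity is the same for all \<open>S\<close>, because Hall's condition will be
  tested with all sets \<open>S\<close> at once.\<close>

lemma equicontinuous_bumps:
  fixes U :: "'a::topological_group_add set"
  assumes U: "U \<in> nhd_filter_e"
  shows "\<exists>b :: 'a set \<Rightarrow> 'a \<Rightarrow> real. (\<forall>S x. 0 \<le> b S x \<and> b S x \<le> 1) \<and> (\<forall>S. \<forall>x\<in>S. b S x = 1) \<and>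
    (\<forall>S x. 0 < b S x \<longrightarrow> (\<exists>s\<in>S. x - s \<in> U)) \<and>
    (\<forall>\<epsilon>>0. \<exists>W\<in>nhd_filter_e. \<forall>S x y. x - y \<in> W \<longrightarrow> \<bar>b S x - b S y\<bar> \<le> \<epsilon>)"
proof -
  obtain N :: "'a \<Rightarrow> real" where N: "\<And>x. 0 \<le> N x" "N 0 = 0" "\<And>x y. N (x + y) \<le> N x + N y"
    "\<And>\<epsilon>. \<epsilon> > 0 \<Longrightarrow> {x. N x \<le> \<epsilon>} \<in> nhd_filter_e" "\<And>x. N x < 1 \<Longrightarrow> x \<in> U"
    using nhd_e_seminorm [OF U] by blast
  define h where "h s x = max 0 (1 - N (x - s))" for s x
  \<comment> \<open>The empty set is treated apart because the supremum of the empty set of reals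
    has no useful value.\<close>
  define b where "b S x = (if S = {} then 0 else SUP s\<in>S. h s x)" for S x
  have h: "0 \<le> h s x" "h s x \<le> 1" for s x using N(1) by (auto simp: h_def)
  have bdd: "bdd_above ((\<lambda>s. h s x) ` S)" for S x using h(2) by (auto intro: bdd_aboveI [of _ 1])
  have h_le: "h s x \<le> b S x" if "s \<in> S" for s S x
    using that cSUP_upper [OF that bdd] by (auto simp: b_def)
  have b_le: "b S x \<le> c" if "\<And>s. s \<in> S \<Longrightarrow> h s x \<le> c" "0 \<le> c" for S x c
    using that by (auto simp: b_def intro: cSUP_least)
  have b_nonneg: "0 \<le> b S x" for S x
  proof (cases "S = {}")
    case False
    then obtain s where "s \<in> S" by blast
    thus ?thesis using h_le [of s S x] h(1) [of s x] by linarith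
  qed (simp add: b_def)
  have b1: "b S x \<le> 1" for S x by (rule b_le) (use h in auto)
  have eq1: "b S x = 1" if "x \<in> S" for S x
    using h_le [OF that, of x] b1 [of S x] N(2) by (simp add: h_def)
  have supp: "\<exists>s\<in>S. x - s \<in> U" if "0 < b S x" for S x
  proof (rule ccontr)
    assume "\<not> ?thesis"
    hence "\<not> N (x - s) < 1" if "s \<in> S" for s using N(5) that by blast
    hence "b S x \<le> 0" by (intro b_le) (auto simp: h_def not_less)
    thus False using that by simp
  qed
  have equi: "\<exists>W\<in>nhd_filter_e. \<forall>S x y. x - y \<in> W \<longrightarrow> \<bar>b S x - b S y\<bar> \<le> \<epsilon>" if \<epsilon>: "\<epsilon> > 0" for \<epsilon>
  proof -
    have step: "b S x \<le> b S y + \<epsilon>" if "N (y - x) \<le> \<epsilon>" for S x y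
    proof (rule b_le)
      fix s assume s: "s \<in> S"
      have "y - s = (y - x) + (x - s)" by (simp add: algebra_simps)
      hence "N (y - s) \<le> N (y - x) + N (x - s)" using N(3) by metis
      hence "h s x \<le> h s y + \<epsilon>" using that \<epsilon> by (auto simp: h_def)
      thus "h s x \<le> b S y + \<epsilon>" using h_le [OF s, of y] by linarith
    qed (use b_nonneg [of S y] \<epsilon> in linarith)
    \<comment> \<open>\<open>N\<close> need not be symmetric, so both differences are
      controlled.\<close>
    define W where "W = {x. N x \<le> \<epsilon>} \<inter> {x. - x \<in> {x. N x \<le> \<epsilon>}}"
    have "W \<in> nhd_filter_e"
      unfolding W_def by (intro nhd_e_Int nhd_e_uminus N(4) \<epsilon>)
    moreover have "\<bar>b S x - b S y\<bar> \<le> \<epsilon>" if "x - y \<in> W" for S x y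
    proof -
      have "N (x - y) \<le> \<epsilon>" "N (y - x) \<le> \<epsilon>" using that by (auto simp: W_def)
      thus ?thesis using step [of y x S] step [of x y S] by linarith
    qed
    ultimately show ?thesis by blast
  qed
  show ?thesis by (intro exI [of _ b] conjI allI ballI impI) (use b_nonneg b1 eq1 supp equi in simp_all)
qed

section \<open>Almost invariant weights and lists\<close>

lemma amenableE:
  assumes "amenable TYPE('a::topological_group_add)"
  obtains \<mu> :: "('a::topological_group_add \<Rightarrow> real) \<Rightarrow> real" where "mean_on RUC_b \<mu>"
    and "\<And>f g. f \<in> RUC_b \<Longrightarrow> \<mu> (\<lambda>x. f (g + x)) = \<mu> f"
proof -
  obtain \<mu> :: "('a \<Rightarrow> real) \<Rightarrow> real" where
    "(\<forall>f\<in>RUC_b. \<forall>g\<in>RUC_b. \<mu> (\<lambda>x. f x + g x) = \<mu> f + \<mu> g) \<and>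
     (\<forall>c. \<forall>f\<in>RUC_b. \<mu> (\<lambda>x. c * f x) = c * \<mu> f) \<and>
     (\<forall>f\<in>RUC_b. (\<forall>x. f x \<ge> 0) \<longrightarrow> \<mu> f \<ge> 0) \<and> \<mu> (\<lambda>x. 1) = 1 \<and>
     (\<forall>f\<in>RUC_b. \<forall>g. \<mu> (f \<circ> (\<lambda>x. g + x)) = \<mu> f)"
    using assms unfolding amenable_def by blast
  thus ?thesis by (intro that [of \<mu>]) (auto simp: mean_on_def linear_on_def comp_def)
qed

text \<open>
  If no convex combination of point masses is almost invariant against all \<open>b S\<close>, then a mean
  on the pairs \<open>(g, S)\<close> averages the functions \<open>b S\<close> to uniformly continuous functions that
  contradict amenability.
\<close>

lemma amenable_imp_almost_invariant_weights:
  fixes E :: "'a::topological_group_add set" and b :: "'i \<Rightarrow> 'a \<Rightarrow> real"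
  assumes am: "amenable TYPE('a)" and E: "finite E" and \<epsilon>: "\<epsilon> > 0"
    and b: "\<And>S x. 0 \<le> b S x" "\<And>S x. b S x \<le> 1"
    and equi: "\<And>\<epsilon>. \<epsilon> > 0 \<Longrightarrow> \<exists>W\<in>nhd_filter_e. \<forall>S x y. x - y \<in> W \<longrightarrow> \<bar>b S x - b S y\<bar> \<le> \<epsilon>"
  shows "\<exists>ws :: (real \<times> 'a) list. (\<forall>(c, x)\<in>set ws. 0 \<le> c) \<and> 0 < (\<Sum>(c, x)\<leftarrow>ws. c) \<and>
    (\<forall>g\<in>E. \<forall>S. (\<Sum>(c, x)\<leftarrow>ws. c * (b S (g + x) - b S x)) \<le> \<epsilon> * (\<Sum>(c, x)\<leftarrow>ws. c))"
proof (rule ccontr)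
  assume neg: "\<not> ?thesis"
  define d where "d x y = (if fst y \<in> E then b (snd y) (fst y + x) - b (snd y) x else 0)" for x :: 'a and y :: "'a \<times> 'i"
  define k where "k ws y = (\<Sum>(c, x)\<leftarrow>ws. c * (d x y - \<epsilon>))" for ws :: "(real \<times> 'a) list" and y
  define C where "C = k ` {ws. \<forall>(c, x)\<in>set ws. 0 \<le> c}"
  have k_simps: "k [] y = 0" "k ((c, x) # ws) y = c * (d x y - \<epsilon>) + k ws y" "k (ws @ vs) y = k ws y + k vs y"
    for c x ws vs y by (simp_all add: k_def)
  have d_le: "\<bar>d x y\<bar> \<le> 1" for x y
    using b(1,2) [of "snd y" "fst y + x"] b(1,2) [of "snd y" x] by (auto simp: d_def)
  have d_bnd: "d x \<in> bounded_funs" for x by (rule bounded_funsI [OF d_le])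
  have dk_bnd: "(\<lambda>y. d x y - \<epsilon>) \<in> bounded_funs" for x
    by (rule fun_subspaceD(4) [OF fun_subspace_bounded_funs d_bnd bounded_funs_const])
  have k_bnd: "k ws \<in> bounded_funs" for ws
  proof (induction ws)
    case Nil
    have "k [] = (\<lambda>y. 0)" by (auto simp: k_simps)
    thus ?case using bounded_funs_const by metis
  next
    case (Cons p ws)
    obtain c x where "p = (c, x)" by force
    hence "k (p # ws) = (\<lambda>y. c * (d x y - \<epsilon>) + k ws y)" by (auto simp: k_simps)
    thus ?case
      using fun_subspaceD(1) [OF fun_subspace_bounded_funs
          fun_subspaceD(2) [OF fun_subspace_bounded_funs dk_bnd [of x], of c] Cons] by simp
  qed
  have k_scale: "k (map (\<lambda>(c, x). (a * c, x)) ws) y = a * k ws y" for a ws y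
    by (induction ws) (auto simp: k_simps algebra_simps)
  have "\<exists>m. mean_on bounded_funs m \<and> (\<forall>f\<in>C. m f \<ge> 0)"
  proof (rule mean_exists [OF fun_subspace_bounded_funs])
    show "C \<subseteq> bounded_funs" using k_bnd by (auto simp: C_def)
    show "C \<noteq> {}" by (auto simp: C_def intro!: exI [of _ "[]"])
  next
    fix f f' assume "f \<in> C" "f' \<in> C"
    then obtain ws vs where ws: "f = k ws" "f' = k vs" "\<forall>(c, x)\<in>set ws. 0 \<le> c" "\<forall>(c, x)\<in>set vs. 0 \<le> c"
      by (auto simp: C_def)
    hence "(\<lambda>x. f x + f' x) = k (ws @ vs)" "ws @ vs \<in> {ws. \<forall>(c, x)\<in>set ws. 0 \<le> c}"
      by (auto simp: k_simps)
    thus "(\<lambda>x. f x + f' x) \<in> C" unfolding C_def by blast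
  next
    fix a :: real and f assume a: "0 \<le> a" and "f \<in> C"
    then obtain ws where ws: "f = k ws" "\<forall>(c, x)\<in>set ws. 0 \<le> c" by (auto simp: C_def)
    have "(\<lambda>x. a * f x) = k (map (\<lambda>(c, x). (a * c, x)) ws)" by (simp add: k_scale ws(1) fun_eq_iff)
    moreover have "map (\<lambda>(c, x). (a * c, x)) ws \<in> {ws. \<forall>(c, x)\<in>set ws. 0 \<le> c}" using ws(2) a by auto
    ultimately show "(\<lambda>x. a * f x) \<in> C" unfolding C_def by blast
  next
    fix f \<delta> assume \<delta>: "(0::real) < \<delta>" and "f \<in> C"
    then obtain ws where ws: "f = k ws" "\<forall>(c, x)\<in>set ws. 0 \<le> c" by (auto simp: C_def)
    have k_eq: "k ws (g, S) = (\<Sum>(c, x)\<leftarrow>ws. c * (b S (g + x) - b S x)) - \<epsilon> * (\<Sum>(c, x)\<leftarrow>ws. c)"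
      if "g \<in> E" for g S
      using that by (induction ws) (auto simp: k_simps d_def algebra_simps)
    show "\<exists>y. - \<delta> < f y"
    proof (cases "0 < (\<Sum>(c, x)\<leftarrow>ws. c)")
      case True
      then obtain g S where "g \<in> E" "\<epsilon> * (\<Sum>(c, x)\<leftarrow>ws. c) < (\<Sum>(c, x)\<leftarrow>ws. c * (b S (g + x) - b S x))"
        using neg ws(2) by (auto simp: not_le)
      hence "- \<delta> < f (g, S)" using k_eq [of g S] \<delta> by (simp add: ws(1))
      thus ?thesis ..
    next
      case False
      have "k ws y = 0" for y
        using ws(2) False
      proof (induction ws)
        case (Cons p ws)
        obtain c x where p: "p = (c, x)" by force
        have "0 \<le> (\<Sum>(c, x)\<leftarrow>ws. c)" using Cons.prems(1) by (intro sum_list_nonneg) auto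
        hence "c = 0" "\<not> 0 < (\<Sum>(c, x)\<leftarrow>ws. c)" using Cons.prems by (auto simp: p)
        thus ?case using Cons by (simp add: p k_simps)
      qed (simp add: k_simps)
      thus ?thesis using \<delta> by (simp add: ws(1))
    qed
  qed (auto simp: bounded_funs_def)
  then obtain \<kappa> where \<kappa>: "mean_on bounded_funs \<kappa>" "\<And>f. f \<in> C \<Longrightarrow> \<kappa> f \<ge> 0" by blast
  have \<kappa>lin: "linear_on bounded_funs \<kappa>" and \<kappa>1: "\<kappa> (\<lambda>y. 1) = 1" using \<kappa>(1) by (auto simp: mean_on_def)
  define e where "e g x y = (if fst y = g then b (snd y) x else 0)" for g x and y :: "'a \<times> 'i"
  have e_bnd: "e g x \<in> bounded_funs" for g x
    by (rule bounded_funsI [of _ 1]) (use b in \<open>auto simp: e_def\<close>)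
  \<comment> \<open>\<open>f g\<close> averages the bumps over the pairs with first entry
    \<open>g\<close>; equicontinuity survives the averaging and puts it into
    \<open>RUC_b\<close>.\<close>
  define f where "f g x = \<kappa> (e g x)" for g x
  have \<kappa>_le: "\<kappa> h \<le> c" if "h \<in> bounded_funs" "\<And>y. h y \<le> c" for h c
  proof -
    have "\<kappa> h \<le> \<kappa> (\<lambda>y. c * 1)"
      using that bounded_funs_const by (intro mean_on_mono [OF fun_subspace_bounded_funs \<kappa>(1)]) auto
    also have "\<dots> = c" using linear_on_scale [OF \<kappa>lin bounded_funs_const, of c 1] \<kappa>1 by simp
    finally show ?thesis .
  qed
  have f_bnd: "0 \<le> f g x \<and> f g x \<le> 1" for g x
    using \<kappa>(1) e_bnd [of g x] b \<kappa>_le [OF e_bnd, of g x 1] by (auto simp: f_def mean_on_def e_def)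
  have f_diff: "f g x - f g y \<le> c" if "\<And>S. \<bar>b S x - b S y\<bar> \<le> c" for g x y c
  proof -
    have "\<bar>b undefined x - b undefined y\<bar> \<le> c" by (rule that)
    hence c: "0 \<le> c" by linarith
    have "f g x - f g y = \<kappa> (\<lambda>z. e g x z - e g y z)"
      unfolding f_def by (rule linear_on_diff [OF fun_subspace_bounded_funs \<kappa>lin e_bnd e_bnd, symmetric])
    also have "\<dots> \<le> c"
    proof (rule \<kappa>_le [OF fun_subspaceD(4) [OF fun_subspace_bounded_funs e_bnd e_bnd]])
      show "e g x z - e g y z \<le> c" for z using that [of "snd z"] c by (auto simp: e_def)
    qed
    finally show ?thesis .
  qed
  have fR: "f g \<in> RUC_b" for g
    unfolding RUC_b_iff
  proof (intro conjI allI impI)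
    show "bounded (range (f g))" using f_bnd [of g] by (auto simp: bounded_iff intro!: exI [of _ 1])
    fix \<epsilon>' :: real assume "\<epsilon>' > 0"
    hence "\<epsilon>' / 2 > 0" by simp
    from equi [OF this] obtain W where W: "W \<in> nhd_filter_e"
      "\<forall>S x y. x - y \<in> W \<longrightarrow> \<bar>b S x - b S y\<bar> \<le> \<epsilon>' / 2" by blast
    have "\<bar>f g x - f g y\<bar> < \<epsilon>'" if "x - y \<in> W" for x y
    proof -
      have *: "\<bar>b S x - b S y\<bar> \<le> \<epsilon>' / 2" "\<bar>b S y - b S x\<bar> \<le> \<epsilon>' / 2" for S
        using W(2) that by (auto simp: abs_minus_commute)
      show ?thesis using f_diff [of x y "\<epsilon>' / 2" g] f_diff [of y x "\<epsilon>' / 2" g] * \<open>\<epsilon>' > 0\<close> by force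
    qed
    thus "\<exists>W\<in>nhd_filter_e. \<forall>x y. x - y \<in> W \<longrightarrow> \<bar>f g x - f g y\<bar> < \<epsilon>'" using W(1) by blast
  qed
  obtain \<mu> :: "('a \<Rightarrow> real) \<Rightarrow> real" where \<mu>: "mean_on RUC_b \<mu>"
    and \<mu>inv: "\<And>f g. f \<in> RUC_b \<Longrightarrow> \<mu> (\<lambda>x. f (g + x)) = \<mu> f" using amenableE [OF am] by blast
  have \<mu>lin: "linear_on RUC_b \<mu>" using \<mu> by (simp add: mean_on_def)
  define D where "D g x = f g (g + x) - f g x" for g x
  have DR: "D g \<in> RUC_b" for g
    unfolding D_def by (rule fun_subspaceD(4) [OF fun_subspace_RUC_b RUC_b_translate [OF fR] fR])
  have "\<mu> (D g) = 0" for g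
    unfolding D_def using linear_on_diff [OF fun_subspace_RUC_b \<mu>lin RUC_b_translate [OF fR] fR]
      \<mu>inv [OF fR] by simp
  hence zero: "\<mu> (\<lambda>x. \<Sum>g\<in>E. D g x) = 0"
    using linear_on_sum(1) [OF fun_subspace_RUC_b \<mu>lin DR] by simp
  \<comment> \<open>The point mass at \<open>x\<close> belongs to the cone, so
    \<open>\<kappa>\<close> gives it a drift of at least \<open>\<epsilon>\<close>. The bound is
    uniform in \<open>x\<close>, but the invariant mean of the right-hand side is 0.\<close>
  have "\<epsilon> \<le> (\<Sum>g\<in>E. D g x)" for x
  proof -
    have "d x = (\<lambda>y. \<Sum>g\<in>E. e g (g + x) y - e g x y)"
      using E by (auto simp: d_def e_def sum_subtractf fun_eq_iff)
    hence "\<kappa> (d x) = (\<Sum>g\<in>E. \<kappa> (\<lambda>y. e g (g + x) y - e g x y))"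
      using linear_on_sum(1) [OF fun_subspace_bounded_funs \<kappa>lin
          fun_subspaceD(4) [OF fun_subspace_bounded_funs e_bnd e_bnd]] by simp
    also have "\<dots> = (\<Sum>g\<in>E. D g x)"
      unfolding D_def f_def
      by (simp add: linear_on_diff [OF fun_subspace_bounded_funs \<kappa>lin e_bnd e_bnd])
    finally have "\<kappa> (d x) = (\<Sum>g\<in>E. D g x)" .
    moreover have "(\<lambda>y. d x y - \<epsilon>) = k [(1, x)]" by (auto simp: k_simps)
    hence "(\<lambda>y. d x y - \<epsilon>) \<in> C" unfolding C_def by auto
    hence "0 \<le> \<kappa> (\<lambda>y. d x y - \<epsilon>)" by (rule \<kappa>(2))
    moreover have "\<kappa> (\<lambda>y. d x y - \<epsilon>) = \<kappa> (d x) - \<kappa> (\<lambda>y. \<epsilon>)"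
      by (rule linear_on_diff [OF fun_subspace_bounded_funs \<kappa>lin d_bnd bounded_funs_const])
    moreover have "\<kappa> (\<lambda>y. \<epsilon>) = \<epsilon>"
      using linear_on_scale [OF \<kappa>lin bounded_funs_const, of \<epsilon> 1] \<kappa>1 by simp
    ultimately show ?thesis by simp
  qed
  hence "\<mu> (\<lambda>x. \<epsilon>) \<le> \<mu> (\<lambda>x. \<Sum>g\<in>E. D g x)"
    using linear_on_sum(2) [OF fun_subspace_RUC_b \<mu>lin DR]
    by (intro mean_on_mono [OF fun_subspace_RUC_b \<mu> RUC_b_const]) auto
  moreover have "\<mu> (\<lambda>x. \<epsilon>) = \<epsilon>"
    using linear_on_scale [OF \<mu>lin RUC_b_const, of \<epsilon> 1] \<mu> by (simp add: mean_on_def)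
  ultimately show False using zero \<epsilon> by simp
qed

text \<open>Rounding the weight \<open>N * c\<close> up to a multiplicity costs at most 1 per entry,
  a total independent of \<open>N\<close>; a large \<open>N\<close> makes it negligible.\<close>

lemma round_weights:
  fixes d :: "'a \<Rightarrow> real"
  assumes "\<forall>(c, x)\<in>set ws. 0 \<le> c" and d: "\<And>x. \<bar>d x\<bar> \<le> 1" and N: "N > 0"
  defines "xs \<equiv> concat (map (\<lambda>(c, x). replicate (nat \<lceil>N * c\<rceil>) x) ws)"
  shows "sum_list (map d xs) \<le> N * (\<Sum>(c, x)\<leftarrow>ws. c * d x) + real (length ws)"
    and "N * (\<Sum>(c, x)\<leftarrow>ws. c) \<le> real (length xs)"
proof -
  have "sum_list (map d xs) \<le> N * (\<Sum>(c, x)\<leftarrow>ws. c * d x) + real (length ws) \<and>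
      N * (\<Sum>(c, x)\<leftarrow>ws. c) \<le> real (length xs)"
    using assms(1) unfolding xs_def
  proof (induction ws)
    case (Cons p ws)
    obtain c x where p: "p = (c, x)" by force
    have c: "0 \<le> N * c" using Cons.prems N by (simp add: p)
    define n where "n = nat \<lceil>N * c\<rceil>"
    have n: "N * c \<le> n" "n \<le> N * c + 1" using c unfolding n_def by linarith+
    have "(n - N * c) * d x \<le> \<bar>(n - N * c) * d x\<bar>" by simp
    also have "\<dots> \<le> 1 * 1" unfolding abs_mult using n d by (intro mult_mono) auto
    finally have "n * d x \<le> N * (c * d x) + 1" by (simp add: algebra_simps)
    thus ?case using Cons n(1) by (simp add: p sum_list_replicate algebra_simps flip: n_def)
  qed simp
  thus "sum_list (map d xs) \<le> N * (\<Sum>(c, x)\<leftarrow>ws. c * d x) + real (length ws)"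
    and "N * (\<Sum>(c, x)\<leftarrow>ws. c) \<le> real (length xs)" by blast+
qed

lemma amenable_imp_almost_invariant_list:
  fixes E :: "'a::topological_group_add set" and b :: "'i \<Rightarrow> 'a \<Rightarrow> real"
  assumes am: "amenable TYPE('a)" and E: "finite E" and \<epsilon>: "(\<epsilon>::real) > 0"
    and b: "\<And>S x. 0 \<le> b S x" "\<And>S x. b S x \<le> 1"
    and equi: "\<And>\<epsilon>. \<epsilon> > 0 \<Longrightarrow> \<exists>W\<in>nhd_filter_e. \<forall>S x y. x - y \<in> W \<longrightarrow> \<bar>b S x - b S y\<bar> \<le> \<epsilon>"
  shows "\<exists>xs. xs \<noteq> [] \<and> (\<forall>g\<in>E. \<forall>S. (\<Sum>x\<leftarrow>xs. b S (g + x) - b S x) \<le> \<epsilon> * real (length xs))"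
proof -
  have "\<epsilon> / 2 > 0" using \<epsilon> by simp
  from amenable_imp_almost_invariant_weights [OF am E this b equi]
  obtain ws where ws: "\<forall>(c, x)\<in>set ws. 0 \<le> c" "0 < (\<Sum>(c, x)\<leftarrow>ws. c)"
    "\<And>g S. g \<in> E \<Longrightarrow> (\<Sum>(c, x)\<leftarrow>ws. c * (b S (g + x) - b S x)) \<le> \<epsilon> / 2 * (\<Sum>(c, x)\<leftarrow>ws. c)" by blast
  define s where "s = (\<Sum>(c, x)\<leftarrow>ws. c)"
  \<comment> \<open>Half of the allowed error then absorbs the rounding error
    \<open>length ws\<close>; the added 1 keeps \<open>N\<close> positive.\<close>
  define N where "N = (length ws + 1) / (\<epsilon> / 2 * s)"
  have N: "N > 0" using \<epsilon> ws(2) by (simp add: N_def s_def)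
  have Ns: "N * (\<epsilon> / 2 * s) = length ws + 1" using \<epsilon> ws(2) by (simp add: N_def s_def)
  define xs where "xs = concat (map (\<lambda>(c, x). replicate (nat \<lceil>N * c\<rceil>) x) ws)"
  have d_le: "\<bar>b S (g + x) - b S x\<bar> \<le> 1" for g S x
    using b(1,2) [of S "g + x"] b(1,2) [of S x] by linarith
  have len: "N * s \<le> length xs" unfolding s_def xs_def by (rule round_weights(2) [OF ws(1) d_le N])
  have "(\<Sum>x\<leftarrow>xs. b S (g + x) - b S x) \<le> \<epsilon> * real (length xs)" if g: "g \<in> E" for g S
  proof -
    have "(\<Sum>x\<leftarrow>xs. b S (g + x) - b S x) \<le> N * (\<Sum>(c, x)\<leftarrow>ws. c * (b S (g + x) - b S x)) + length ws"
      unfolding xs_def by (rule round_weights(1) [OF ws(1) d_le N])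
    also have "\<dots> \<le> N * (\<epsilon> / 2 * s) + length ws"
      unfolding s_def using ws(3) [OF g, of S] N by (intro add_right_mono mult_left_mono) auto
    also have "\<dots> \<le> N * (\<epsilon> / 2 * s) + N * (\<epsilon> / 2 * s)" unfolding Ns by simp
    also have "\<dots> = \<epsilon> * (N * s)" by simp
    also have "\<dots> \<le> \<epsilon> * real (length xs)" using len \<epsilon> by (intro mult_left_mono) auto
    finally show ?thesis .
  qed
  moreover have "N * s > 0" using N ws(2) by (simp add: s_def)
  hence "xs \<noteq> []" using len by auto
  ultimately show ?thesis by blast
qed

text \<open>A greedy choice: each new point avoids finitely many points, and by the symmetry of
  \<open>K\<close> it suffices to look at the earlier choices.\<close>

lemma separated_choice:
  fixes n :: nat
  assumes "\<And>i. i < n \<Longrightarrow> infinite (B i)" "\<And>y. finite (K y)" "\<And>x y. x \<in> K y \<longleftrightarrow> y \<in> K x"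
  shows "\<exists>z. (\<forall>i<n. z i \<in> B i) \<and> (\<forall>i<n. \<forall>j<n. i \<noteq> j \<longrightarrow> z i \<notin> K (z j))"
  using assms(1)
proof (induction n)
  case (Suc n)
  then obtain z where z: "\<forall>i<n. z i \<in> B i" "\<forall>i<n. \<forall>j<n. i \<noteq> j \<longrightarrow> z i \<notin> K (z j)" by auto
  have "infinite (B n - (\<Union>j<n. K (z j)))" using Suc.prems assms(2) by (intro Diff_infinite_finite) auto
  then obtain y where y: "y \<in> B n" "\<And>j. j < n \<Longrightarrow> y \<notin> K (z j)"
    using infinite_imp_nonempty by blast
  show ?case
    using z y assms(3) [of y]
    by (intro exI [of _ "z(n := y)"]) (auto simp: less_Suc_eq)
qed simp

text \<open>The permutation is meant to be applied after the translation by \<open>g\<close>. The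
  form of an involution that fixes all points outside \<open>F\<close> and its translate lets such
  permutations for disjoint data be glued into one.\<close>

definition folner_perm :: "'a::topological_group_add set \<Rightarrow> real \<Rightarrow> 'a set \<Rightarrow> 'a \<Rightarrow> ('a \<Rightarrow> 'a) \<Rightarrow> bool" where
  "folner_perm U \<delta> F g \<sigma> \<longleftrightarrow> (\<forall>y. \<sigma> (\<sigma> y) = y) \<and> (\<forall>y. \<sigma> y - y \<in> U) \<and>
     (\<forall>y. y \<notin> F \<union> (\<lambda>x. g + x) ` F \<longrightarrow> \<sigma> y = y) \<and>
     real (card {x \<in> F. \<sigma> (g + x) \<notin> F}) \<le> \<delta> * real (card F)"

definition folner_set :: "'a::topological_group_add set \<Rightarrow> 'a set \<Rightarrow> real \<Rightarrow> 'a set \<Rightarrow> bool" where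
  "folner_set U E \<delta> F \<longleftrightarrow> finite F \<and> F \<noteq> {} \<and> (\<forall>g\<in>E. \<exists>\<sigma>. folner_perm U \<delta> F g \<sigma>)"

text \<open>Right translations commute with the left translation by \<open>g\<close> and do not
  change \<open>\<sigma> y - y\<close>; so these sets can be moved apart at will.\<close>

lemma folner_set_translate:
  assumes "folner_set U E \<delta> F"
  shows "folner_set U E \<delta> ((\<lambda>x. x + a) ` F)"
proof -
  have inj: "inj_on (\<lambda>x. x + a) A" for A by (simp add: inj_on_def)
  have "\<exists>\<sigma>. folner_perm U \<delta> ((\<lambda>x. x + a) ` F) g \<sigma>"
    if g: "g \<in> E" for g
  proof -
    obtain \<sigma> where \<sigma>: "\<And>y. \<sigma> (\<sigma> y) = y" "\<And>y. \<sigma> y - y \<in> U"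
      "\<And>y. y \<notin> F \<union> (\<lambda>x. g + x) ` F \<Longrightarrow> \<sigma> y = y" "real (card {x \<in> F. \<sigma> (g + x) \<notin> F}) \<le> \<delta> * real (card F)"
      using assms g unfolding folner_set_def folner_perm_def by blast
    define \<tau> where "\<tau> y = \<sigma> (y - a) + a" for y
    have mem: "y \<in> (\<lambda>x. x + a) ` A \<longleftrightarrow> y - a \<in> A" for y A by (force intro: image_eqI [of _ _ "y - a"])
    have "\<tau> (\<tau> y) = y" for y by (simp add: \<tau>_def \<sigma>(1))
    moreover have "\<tau> y - y \<in> U" for y
    proof -
      have "\<tau> y - y = \<sigma> (y - a) - (y - a)"
        by (simp only: \<tau>_def diff_conv_add_uminus minus_add minus_minus add.assoc)
      thus ?thesis using \<sigma>(2) by simp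
    qed
    moreover have "\<tau> y = y" if y: "y \<notin> (\<lambda>x. x + a) ` F \<union> (\<lambda>x. g + x) ` (\<lambda>x. x + a) ` F" for y
    proof -
      have "(\<lambda>x. g + x) ` (\<lambda>x. x + a) ` F = (\<lambda>x. x + a) ` (\<lambda>x. g + x) ` F"
        by (simp add: image_image add.assoc)
      hence "y - a \<notin> F \<union> (\<lambda>x. g + x) ` F" using y mem [of y F] mem [of y "(\<lambda>x. g + x) ` F"] by simp
      thus ?thesis by (simp add: \<tau>_def \<sigma>(3))
    qed
    moreover have "{x \<in> (\<lambda>x. x + a) ` F. \<tau> (g + x) \<notin> (\<lambda>x. x + a) ` F} = (\<lambda>x. x + a) ` {x \<in> F. \<sigma> (g + x) \<notin> F}"
    proof -
      have "\<tau> (g + (x + a)) \<in> (\<lambda>x. x + a) ` F \<longleftrightarrow> \<sigma> (g + x) \<in> F" for x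
        unfolding mem by (simp add: \<tau>_def flip: add.assoc)
      thus ?thesis by auto
    qed
    hence "real (card {x \<in> (\<lambda>x. x + a) ` F. \<tau> (g + x) \<notin> (\<lambda>x. x + a) ` F}) \<le> \<delta> * real (card ((\<lambda>x. x + a) ` F))"
      using \<sigma>(4) by (simp add: card_image inj)
    ultimately show ?thesis unfolding folner_perm_def by blast
  qed
  thus ?thesis using assms by (simp add: folner_set_def)
qed

text \<open>The almost invariant list may repeat points and meet its own translates. Moving its
  entries within a small neighbourhood cures both, and the bumps tolerate it. Their almost
  invariance is then Hall's condition with a small deficiency for matching the translate of
  \<open>F\<close> with \<open>F\<close>.\<close>

lemma amenable_imp_folner_set:
  fixes U E :: "'a::topological_group_add set"
  assumes am: "amenable TYPE('a)" and inf: "\<And>W. W \<in> nhd_filter_e \<Longrightarrow> infinite (W :: 'a set)"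
    and U: "U \<in> nhd_filter_e" and E: "finite E" and \<delta>: "\<delta> > 0"
  shows "\<exists>F. folner_set U E \<delta> F"
proof -
  \<comment> \<open>The involution will move points along the matching in both directions, hence the
    symmetric neighbourhood.\<close>
  define V where "V = U \<inter> {x. - x \<in> U}"
  have V: "V \<in> nhd_filter_e" unfolding V_def by (intro nhd_e_Int nhd_e_uminus U)
  obtain b :: "'a set \<Rightarrow> 'a \<Rightarrow> real" where b: "\<And>S x. 0 \<le> b S x" "\<And>S x. b S x \<le> 1"
    and b1: "\<And>S x. x \<in> S \<Longrightarrow> b S x = 1" and supp: "\<And>S x. 0 < b S x \<Longrightarrow> \<exists>s\<in>S. x - s \<in> V"
    and equi: "\<And>\<epsilon>. \<epsilon> > 0 \<Longrightarrow> \<exists>W\<in>nhd_filter_e. \<forall>S x y. x - y \<in> W \<longrightarrow> \<bar>b S x - b S y\<bar> \<le> \<epsilon>"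
    using equicontinuous_bumps [OF V] by metis
  \<comment> \<open>One third is spent on the list, two on moving its entries: once at the point and
    once at its translate.\<close>
  define \<epsilon> where "\<epsilon> = \<delta> / 3"
  have \<epsilon>: "\<epsilon> > 0" using \<delta> by (simp add: \<epsilon>_def)
  obtain xs where xs: "xs \<noteq> []" "\<And>g S. g \<in> E \<Longrightarrow> (\<Sum>x\<leftarrow>xs. b S (g + x) - b S x) \<le> \<epsilon> * real (length xs)"
    using amenable_imp_almost_invariant_list [OF am E \<epsilon> b equi] by blast
  define n where "n = length xs"
  obtain W where W: "W \<in> nhd_filter_e" "\<And>S x y. x - y \<in> W \<Longrightarrow> \<bar>b S x - b S y\<bar> \<le> \<epsilon>"
    using equi [OF \<epsilon>] by blast
  define W' where "W' = W \<inter> (\<Inter>g\<in>E. {x. g + x - g \<in> W})"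
  have W': "W' \<in> nhd_filter_e"
    unfolding W'_def using W(1) E by (intro nhd_e_Int nhd_e_INT nhd_e_conj) auto
  \<comment> \<open>Avoiding \<open>K\<close> makes the new points distinct and \<open>F\<close>
    disjoint from its translates by nonzero elements of \<open>E\<close>; the inverses are included
    to make the relation symmetric.\<close>
  define K where "K y = insert y (\<Union>g\<in>E. {g + y, - g + y})" for y
  have "\<exists>z. (\<forall>i<n. z i \<in> (\<lambda>w. w + xs ! i) ` W') \<and> (\<forall>i<n. \<forall>j<n. i \<noteq> j \<longrightarrow> z i \<notin> K (z j))"
  proof (rule separated_choice)
    show "infinite ((\<lambda>w. w + xs ! i) ` W')" for i
      using inf [OF W'] by (simp add: finite_image_iff inj_on_def)
    show "finite (K y)" for y using E by (simp add: K_def)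
    have "y \<in> K x" if "x \<in> K y" for x y
    proof -
      consider "x = y" | g where "g \<in> E" "x = g + y" | g where "g \<in> E" "x = - g + y"
        using \<open>x \<in> K y\<close> by (auto simp: K_def)
      thus ?thesis
      proof cases
        case (2 g)
        hence "y = - g + x" by (simp flip: add.assoc)
        thus ?thesis using 2(1) unfolding K_def by blast
      next
        case (3 g)
        hence "y = g + x" by (simp flip: add.assoc)
        thus ?thesis using 3(1) unfolding K_def by blast
      qed (simp add: K_def)
    qed
    thus "x \<in> K y \<longleftrightarrow> y \<in> K x" for x y by blast
  qed
  then obtain z where zW: "\<And>i. i < n \<Longrightarrow> z i \<in> (\<lambda>w. w + xs ! i) ` W'"
    and zK: "\<And>i j. i < n \<Longrightarrow> j < n \<Longrightarrow> i \<noteq> j \<Longrightarrow> z i \<notin> K (z j)" by blast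
  have z_near: "z i - xs ! i \<in> W'" if "i < n" for i using zW [OF that] by auto
  have z_inj: "inj_on z {..<n}"
  proof (rule inj_onI, rule ccontr)
    fix i j assume "i \<in> {..<n}" "j \<in> {..<n}" "z i = z j" "i \<noteq> j"
    thus False using zK [of i j] by (simp add: K_def)
  qed
  define F where "F = z ` {..<n}"
  have F: "finite F" "F \<noteq> {}" "card F = n"
    using xs(1) z_inj by (auto simp: F_def card_image n_def)
  have disj: "g + x \<notin> F" if g: "g \<in> E" "g \<noteq> 0" and x: "x \<in> F" for g x
  proof
    assume "g + x \<in> F"
    then obtain i j where ij: "i < n" "j < n" "x = z j" "g + x = z i" using x by (auto simp: F_def)
    have "i \<noteq> j"
    proof
      assume "i = j"
      hence "g + z j = 0 + z j" using ij by simp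
      thus False using g(2) by (simp only: add_right_cancel)
    qed
    moreover have "z i \<in> K (z j)" using g(1) unfolding K_def ij(4) [symmetric] ij(3) by blast
    ultimately show False using zK ij by blast
  qed
  have drift: "(\<Sum>x\<in>F. b S (g + x)) \<le> (\<Sum>x\<in>F. b S x) + \<delta> * n" if g: "g \<in> E" for g S
  proof -
    have "(\<Sum>x\<in>F. b S (g + x) - b S x) = (\<Sum>i<n. b S (g + z i) - b S (z i))"
      unfolding F_def using sum.reindex [OF z_inj] by (simp add: comp_def)
    also have "\<dots> \<le> (\<Sum>i<n. b S (g + xs ! i) - b S (xs ! i) + 2 * \<epsilon>)"
    proof (rule sum_mono)
      fix i assume i: "i \<in> {..<n}"
      have zi: "z i - xs ! i \<in> W'" using z_near i by simp
      have "(g + z i) - (g + xs ! i) = g + (z i - xs ! i) - g"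
        by (simp only: diff_conv_add_uminus minus_add add.assoc)
      hence "\<bar>b S (g + z i) - b S (g + xs ! i)\<bar> \<le> \<epsilon>" using zi g by (intro W(2)) (auto simp: W'_def)
      moreover have "\<bar>b S (z i) - b S (xs ! i)\<bar> \<le> \<epsilon>" using zi by (intro W(2)) (auto simp: W'_def)
      ultimately show "b S (g + z i) - b S (z i) \<le> b S (g + xs ! i) - b S (xs ! i) + 2 * \<epsilon>" by linarith
    qed
    also have "\<dots> = (\<Sum>x\<leftarrow>xs. b S (g + x) - b S x) + 2 * \<epsilon> * n"
      by (simp add: sum.distrib sum_list_sum_nth n_def atLeast0LessThan)
    also have "\<dots> \<le> \<epsilon> * n + 2 * \<epsilon> * n" using xs(2) [OF g, of S] by (simp add: n_def)
    finally show ?thesis by (simp add: sum_subtractf \<epsilon>_def)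
  qed
  have "\<exists>\<sigma>. folner_perm U \<delta> F g \<sigma>" if g: "g \<in> E" for g
  proof (cases "g = 0")
    case True
    hence "real (card {x \<in> F. g + x \<notin> F}) \<le> \<delta> * real (card F)" using \<delta> by simp
    thus ?thesis using nhd_e_zero [OF U] by (intro exI [of _ "\<lambda>y. y"]) (auto simp: folner_perm_def)
  next
    case False
    define A where "A x = {y \<in> F. y - (g + x) \<in> V}" for x
    have "\<exists>f D. D \<subseteq> F \<and> card (F - D) \<le> nat \<lfloor>\<delta> * n\<rfloor> \<and> inj_on f D \<and> (\<forall>x\<in>D. f x \<in> A x)"
    proof (rule hall_deficiency [OF F(1)])
      show "finite (A x)" for x using F(1) by (simp add: A_def)
      fix J assume J: "J \<subseteq> F"
      \<comment> \<open>The bump of the translate of \<open>J\<close> takes the value 1 at the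
        translated points of \<open>J\<close>, whereas on \<open>F\<close> itself it vanishes except
        at admissible partners. Its small drift thus bounds the deficiency of
        \<open>J\<close>.\<close>
      define S where "S = (\<lambda>x. g + x) ` J"
      have "real (card J) = (\<Sum>x\<in>J. b S (g + x))" by (simp add: b1 S_def)
      also have "\<dots> \<le> (\<Sum>x\<in>F. b S (g + x))" using F(1) J b by (intro sum_mono2) auto
      also have "\<dots> \<le> (\<Sum>x\<in>F. b S x) + \<delta> * n" by (rule drift [OF g])
      also have "(\<Sum>x\<in>F. b S x) = (\<Sum>x\<in>\<Union>(A ` J). b S x)"
      proof (rule sum.mono_neutral_right [OF F(1)])
        show "\<Union>(A ` J) \<subseteq> F" by (auto simp: A_def)
        show "\<forall>x\<in>F - \<Union>(A ` J). b S x = 0"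
        proof
          fix x assume x: "x \<in> F - \<Union>(A ` J)"
          hence "\<not> (\<exists>s\<in>S. x - s \<in> V)" by (auto simp: A_def S_def)
          thus "b S x = 0" using supp [of S x] b(1) [of S x] by (metis less_eq_real_def)
        qed
      qed
      also have "\<dots> \<le> (\<Sum>x\<in>\<Union>(A ` J). 1)" by (intro sum_mono b)
      finally have "real (card J) - card (\<Union>(A ` J)) \<le> \<delta> * n" by simp
      hence "int (card J) - int (card (\<Union>(A ` J))) \<le> \<lfloor>\<delta> * n\<rfloor>" by (simp add: le_floor_iff)
      thus "card J \<le> card (\<Union>(A ` J)) + nat \<lfloor>\<delta> * n\<rfloor>" by linarith
    qed
    then obtain f D where D: "D \<subseteq> F" "card (F - D) \<le> nat \<lfloor>\<delta> * n\<rfloor>" "inj_on f D"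
      and fA: "\<And>x. x \<in> D \<Longrightarrow> f x \<in> F \<and> f x - (g + x) \<in> V" by (auto simp: A_def)
    define G where "G = (\<lambda>x. g + x) ` D"
    have GF: "G \<inter> F = {}" using disj [OF g False] D(1) by (auto simp: G_def)
    \<comment> \<open>Matched pairs are exchanged; this is consistent because the translate of
      \<open>D\<close> is disjoint from \<open>F\<close>.\<close>
    define \<sigma> where "\<sigma> y = (if y \<in> G then f (- g + y) else if y \<in> f ` D then g + inv_into D f y else y)" for y
    have \<sigma>G: "\<sigma> (g + x) = f x" if "x \<in> D" for x
      using that by (auto simp: \<sigma>_def G_def simp flip: add.assoc)
    have \<sigma>f: "\<sigma> (f x) = g + x" if "x \<in> D" for x
      using that fA [OF that] GF D(3) by (auto simp: \<sigma>_def)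
    have \<sigma>else: "\<sigma> y = y" if "y \<notin> G" "y \<notin> f ` D" for y using that by (simp add: \<sigma>_def)
    have cases: "(\<exists>x\<in>D. y = g + x) \<or> (\<exists>x\<in>D. y = f x) \<or> (y \<notin> G \<and> y \<notin> f ` D)" for y
      by (auto simp: G_def)
    have "\<sigma> (\<sigma> y) = y" for y using cases [of y] \<sigma>G \<sigma>f \<sigma>else by auto
    moreover have "\<sigma> y - y \<in> U" for y
      using cases [of y]
    proof (elim disjE bexE)
      fix x assume "x \<in> D" "y = g + x"
      thus ?thesis using \<sigma>G fA by (auto simp: V_def)
    next
      fix x assume x: "x \<in> D" "y = f x"
      have "- (f x - (g + x)) \<in> U" using fA [OF x(1)] by (simp add: V_def)
      thus ?thesis using \<sigma>f [OF x(1)] x(2) by simp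
    qed (use \<sigma>else nhd_e_zero [OF U] in simp)
    moreover have "\<sigma> y = y" if "y \<notin> F \<union> (\<lambda>x. g + x) ` F" for y
      using that D(1) fA by (intro \<sigma>else) (auto simp: G_def)
    moreover have "real (card {x \<in> F. \<sigma> (g + x) \<notin> F}) \<le> \<delta> * real (card F)"
    proof -
      have "{x \<in> F. \<sigma> (g + x) \<notin> F} \<subseteq> F - D" using \<sigma>G fA by auto
      hence "card {x \<in> F. \<sigma> (g + x) \<notin> F} \<le> card (F - D)" using F(1) by (intro card_mono) auto
      also have "\<dots> \<le> nat \<lfloor>\<delta> * n\<rfloor>" by (rule D)
      finally have "real (card {x \<in> F. \<sigma> (g + x) \<notin> F}) \<le> nat \<lfloor>\<delta> * n\<rfloor>" by simp
      also have "\<dots> \<le> \<delta> * n" using \<delta> by simp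
      finally show ?thesis using F(3) by simp
    qed
    ultimately show ?thesis unfolding folner_perm_def by blast
  qed
  thus ?thesis using F unfolding folner_set_def by blast
qed

section \<open>Disjoint translates for all data\<close>

context includes cardinal_syntax begin

lemma card_of_lists_ordLeq:
  assumes "infinite (UNIV :: 'a set)"
  shows "|UNIV :: 'a list set| \<le>o |UNIV :: 'a set|"
proof -
  have n: "|{xs :: 'a list. length xs = n}| \<le>o |UNIV :: 'a set|" for n
  proof (induction n)
    case 0
    have "{xs :: 'a list. length xs = 0} = {[]}" by auto
    thus ?case using card_of_singl_ordLeq [of "UNIV :: 'a set"] by simp
  next
    case (Suc n)
    have "{xs :: 'a list. length xs = Suc n} = (\<lambda>(x, xs). x # xs) ` (UNIV \<times> {xs. length xs = n})"
      by (force simp: length_Suc_conv)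
    moreover have "|(UNIV :: 'a set) \<times> {xs :: 'a list. length xs = n}| \<le>o |UNIV :: 'a set|"
      by (rule card_of_Sigma_ordLeq_infinite [OF assms card_of_mono1]) (use Suc in auto)
    ultimately show ?case using ordLeq_transitive [OF card_of_image] by metis
  qed
  have "|\<Union>n. {xs :: 'a list. length xs = n}| \<le>o |UNIV :: 'a set|"
    by (rule card_of_UNION_ordLeq_infinite [OF assms]) (use n assms infinite_iff_card_of_nat in auto)
  moreover have "(\<Union>n. {xs :: 'a list. length xs = n}) = UNIV" by auto
  ultimately show ?thesis by simp
qed

text \<open>
  The translates are chosen one after the other along a well-order of the least order type, so
  that at each stage the forbidden translations form a set smaller than the group.
\<close>

lemma disjoint_translates:
  fixes K :: "'i \<Rightarrow> 'a::group_add set"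
  assumes inf: "infinite (UNIV :: 'a set)" and le: "|UNIV :: 'i set| \<le>o |UNIV :: 'a set|"
    and K: "\<And>p. finite (K p)"
  shows "\<exists>a. \<forall>p q. p \<noteq> q \<longrightarrow> (\<lambda>x. x + a p) ` K p \<inter> (\<lambda>x. x + a q) ` K q = {}"
proof -
  define r where "r = |UNIV :: 'i set|"
  have r: "Card_order r" unfolding r_def by (rule card_of_Card_order)
  have Field: "Field r = UNIV" unfolding r_def by (rule Field_card_of)
  have wo: "well_order_on UNIV r" using r card_of_well_order_on [of "UNIV :: 'i set"] by (simp add: r_def)
  define R where "R = r - Id"
  have wf: "wf R" using wo by (simp add: R_def well_order_on_def)
  have total: "(p, q) \<in> R \<or> (q, p) \<in> R" if "p \<noteq> q" for p q
    using wo that by (auto simp: R_def well_order_on_def linear_order_on_def total_on_def)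
  define P where "P f p a \<longleftrightarrow>
    (\<forall>q. (q, p) \<in> R \<longrightarrow> (\<lambda>x. x + a) ` K p \<inter> (\<lambda>x. x + f q) ` K q = {})" for f p a
  have "\<exists>f. \<forall>p. P f p (f p)"
  proof (rule dependent_wf_choice [OF wf])
    show "P f p a = P g p a" if "\<And>q. (q, p) \<in> R \<Longrightarrow> f q = g q" for f g p a
      using that by (auto simp: P_def)
    fix p f
    let ?I = "underS r p"
    \<comment> \<open>These are the translations that make the translate of \<open>K p\<close> meet
      the one already chosen for \<open>q\<close>: solve \<open>k + a = l + f q\<close> for
      \<open>a\<close>.\<close>
    define S where "S q = (\<lambda>(k, l). - k + (l + f q)) ` (K p \<times> K q)" for q
    have finS: "finite (S q)" for q using K by (simp add: S_def)
    have "(\<Union>q\<in>?I. S q) \<noteq> UNIV"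
    proof (cases "finite ?I")
      case True
      hence "finite (\<Union>q\<in>?I. S q)" using finS by blast
      thus ?thesis using inf by auto
    next
      case False
      have "|S q| \<le>o |?I|" for q
        using ordLeq_total [OF card_of_Well_order card_of_Well_order] card_of_ordLeq_finite
          finS [of q] False by blast
      hence "|\<Union>q\<in>?I. S q| \<le>o |?I|"
        using False by (intro card_of_UNION_ordLeq_infinite card_of_mono1) auto
      moreover have "|?I| <o r" by (rule card_of_underS [OF r]) (simp add: Field)
      ultimately have "|\<Union>q\<in>?I. S q| <o |UNIV :: 'a set|"
        using le unfolding r_def by (meson ordLeq_ordLess_trans ordLess_ordLeq_trans)
      thus ?thesis using ordLess_irreflexive by fastforce
    qed
    then obtain a where a: "a \<notin> (\<Union>q\<in>?I. S q)" by blast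
    have "P f p a"
      unfolding P_def
    proof (intro allI impI equals0I)
      fix q y assume q: "(q, p) \<in> R" and "y \<in> (\<lambda>x. x + a) ` K p \<inter> (\<lambda>x. x + f q) ` K q"
      then obtain k l where kl: "k \<in> K p" "l \<in> K q" "k + a = l + f q" by auto
      have "a = - k + (k + a)" by (simp flip: add.assoc)
      hence "a \<in> S q" unfolding S_def kl(3) using kl by (intro image_eqI [of _ _ "(k, l)"]) auto
      moreover have "q \<in> ?I" using q by (auto simp: R_def underS_def)
      ultimately show False using a by blast
    qed
    thus "\<exists>a. P f p a" ..
  qed
  then obtain f where f: "\<And>p. P f p (f p)" by blast
  have "(\<lambda>x. x + f p) ` K p \<inter> (\<lambda>x. x + f q) ` K q = {}" if "p \<noteq> q" for p q
    using total [OF that] f [of p] f [of q] unfolding P_def by blast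
  thus ?thesis by blast
qed

end

section \<open>Near translations of amenable groups\<close>

text \<open>The sums over \<open>F\<close> and over its image differ only by the points outside the
  intersection. Both differences have the same number of points, since \<open>\<tau>\<close>
  preserves the size of \<open>F\<close>.\<close>

lemma sum_almost_invariant:
  fixes f :: "'x \<Rightarrow> real"
  assumes F: "finite F" and \<tau>: "inj \<tau>" and f: "\<And>x. \<bar>f x\<bar> \<le> B"
  shows "- (2 * B * card {x \<in> F. \<tau> x \<notin> F}) \<le> (\<Sum>x\<in>F. f (\<tau> x) - f x)"
proof -
  have inj: "inj_on \<tau> A" for A using \<tau> by (rule inj_on_subset) simp
  let ?b = "card {x \<in> F. \<tau> x \<notin> F}"
  have "\<tau> ` F - F = \<tau> ` {x \<in> F. \<tau> x \<notin> F}" by auto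
  hence 1: "card (\<tau> ` F - F) = ?b" by (simp add: card_image inj)
  have "card (\<tau> ` F) = card F" by (simp add: card_image inj)
  hence 2: "card (F - \<tau> ` F) = ?b"
    using F 1 card_Diff_subset_Int [of F "\<tau> ` F"] card_Diff_subset_Int [of "\<tau> ` F" F]
    by (simp add: Int_commute)
  have "(\<Sum>x\<in>F. f (\<tau> x)) = sum f (\<tau> ` F)" using sum.reindex [OF inj [of F], of f] by simp
  also have "\<dots> = sum f (\<tau> ` F \<inter> F) + sum f (\<tau> ` F - F)" using F by (simp add: sum.Int_Diff)
  finally have "(\<Sum>x\<in>F. f (\<tau> x) - f x) = sum f (\<tau> ` F - F) - sum f (F - \<tau> ` F)"
    using F sum.Int_Diff [OF F, of f "\<tau> ` F"] by (simp add: sum_subtractf Int_commute)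
  moreover have "- (B * ?b) \<le> sum f (\<tau> ` F - F)"
  proof -
    have "(\<Sum>x\<in>\<tau> ` F - F. - B) \<le> sum f (\<tau> ` F - F)"
      by (rule sum_mono) (use f in \<open>simp add: abs_le_iff minus_le_iff\<close>)
    thus ?thesis by (simp add: 1 mult.commute)
  qed
  moreover have "sum f (F - \<tau> ` F) \<le> B * ?b"
  proof -
    have "sum f (F - \<tau> ` F) \<le> (\<Sum>x\<in>F - \<tau> ` F. B)"
      by (rule sum_mono) (use f in \<open>simp add: abs_le_iff\<close>)
    thus ?thesis by (simp add: 2 mult.commute)
  qed
  ultimately show ?thesis by simp
qed

lemma drift_folner_lower:
  assumes F: "finite F" and ps: "\<And>f. f \<in> fst ` set ps \<Longrightarrow> (\<And>x. \<bar>f x\<bar> \<le> (B :: real))"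
    and T: "\<And>i. i \<in> snd ` set ps \<Longrightarrow> inj (T i) \<and> real (card {x \<in> F. T i x \<notin> F}) \<le> \<eta>" and B: "0 \<le> B"
  shows "- (2 * B * \<eta> * length ps) \<le> (\<Sum>x\<in>F. drift T ps x)"
  using ps T
proof (induction ps)
  case (Cons p ps)
  obtain f i where p: "p = (f, i)" by force
  have "- (2 * B * \<eta> * length ps) \<le> (\<Sum>x\<in>F. drift T ps x)" using Cons by (intro Cons.IH) auto
  moreover have "- (2 * B * card {x \<in> F. T i x \<notin> F}) \<le> (\<Sum>x\<in>F. f (T i x) - f x)"
    using Cons.prems by (intro sum_almost_invariant F) (auto simp: p)
  moreover have "2 * B * card {x \<in> F. T i x \<notin> F} \<le> 2 * B * \<eta>"
    using Cons.prems(2) [of i] B by (intro mult_left_mono) (auto simp: p)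
  moreover have "(\<Sum>x\<in>F. drift T (p # ps) x) = (\<Sum>x\<in>F. f (T i x) - f x) + (\<Sum>x\<in>F. drift T ps x)"
    by (simp add: p sum.distrib)
  moreover have "2 * B * \<eta> * length (p # ps) = 2 * B * \<eta> + 2 * B * \<eta> * length ps"
    by (simp add: algebra_simps)
  ultimately show ?case by linarith
qed simp

lemma amenable_imp_invariant_mean_nondiscrete:
  fixes U :: "'a::topological_group_add set"
  assumes am: "amenable TYPE('a)" and inf: "\<And>W. W \<in> nhd_filter_e \<Longrightarrow> infinite (W :: 'a set)"
    and U: "U \<in> nhd_filter_e"
  shows "\<exists>\<alpha>\<in>near_translations U. \<exists>m. mean_on bounded_funs m \<and>
    (\<forall>f\<in>bounded_funs. \<forall>g. m (\<lambda>x. f (\<alpha> g x)) = m f)"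
proof -
  \<comment> \<open>A list encodes both a finite set of group elements and, by its length, a
    tolerance.\<close>
  define \<eta> where "\<eta> p = 1 / (real (length p) + 1)" for p :: "'a list"
  have "\<exists>F. folner_set U (set p) (\<eta> p) F" for p
    by (rule amenable_imp_folner_set [OF am inf U]) (auto simp: \<eta>_def)
  then obtain F0 where F0: "\<And>p. folner_set U (set p) (\<eta> p) (F0 p)" by metis
  define K0 where "K0 p = F0 p \<union> (\<Union>g\<in>set p. (\<lambda>x. g + x) ` F0 p)" for p
  have "infinite (UNIV :: 'a set)" using inf [of UNIV] by (simp add: nhd_e_iff)
  moreover have "finite (K0 p)" for p using F0 [of p] by (simp add: K0_def folner_set_def)
  ultimately obtain a where a: "\<And>p q. p \<noteq> q \<Longrightarrow> (\<lambda>x. x + a p) ` K0 p \<inter> (\<lambda>x. x + a q) ` K0 q = {}"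
    using disjoint_translates [of K0] card_of_lists_ordLeq by blast
  define F where "F p = (\<lambda>x. x + a p) ` F0 p" for p
  \<comment> \<open>The translates are included because the permutation for \<open>g\<close> acts at
    \<open>g + x\<close>, not at \<open>x\<close>.\<close>
  define K where "K p = F p \<union> (\<Union>g\<in>set p. (\<lambda>x. g + x) ` F p)" for p
  have "(\<lambda>x. x + a p) ` K0 p = K p" for p
    by (simp add: K_def K0_def F_def image_Un image_UN image_image add.assoc)
  hence "K p \<inter> K q = {}" if "p \<noteq> q" for p q using a [OF that] by simp
  hence K_disj: "p = q" if "y \<in> K p" "y \<in> K q" for p q y using that by blast
  have F: "folner_set U (set p) (\<eta> p) (F p)" for p unfolding F_def by (rule folner_set_translate [OF F0])
  have finF: "finite (F p)" "F p \<noteq> {}" for p using F [of p] by (auto simp: folner_set_def)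
  have "\<forall>p. \<forall>g\<in>set p. \<exists>\<tau>. folner_perm U (\<eta> p) (F p) g \<tau>" using F by (simp add: folner_set_def)
  then obtain \<sigma> where "\<And>p g. g \<in> set p \<Longrightarrow> folner_perm U (\<eta> p) (F p) g (\<sigma> p g)" by metis
  hence \<sigma>: "\<And>p g y. g \<in> set p \<Longrightarrow> \<sigma> p g (\<sigma> p g y) = y"
    "\<And>p g y. g \<in> set p \<Longrightarrow> \<sigma> p g y - y \<in> U"
    "\<And>p g y. g \<in> set p \<Longrightarrow> y \<notin> F p \<union> (\<lambda>x. g + x) ` F p \<Longrightarrow> \<sigma> p g y = y"
    "\<And>p g. g \<in> set p \<Longrightarrow> real (card {x \<in> F p. \<sigma> p g (g + x) \<notin> F p}) \<le> \<eta> p * real (card (F p))"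
    unfolding folner_perm_def by blast+
  have \<sigma>K: "\<sigma> p g y \<in> K p" if g: "g \<in> set p" and y: "y \<in> K p" for p g y
  proof (rule ccontr)
    assume n: "\<sigma> p g y \<notin> K p"
    hence "\<sigma> p g y \<notin> F p \<union> (\<lambda>x. g + x) ` F p" using g by (auto simp: K_def)
    hence "\<sigma> p g y = y" using \<sigma>(1,3) [OF g] by metis
    thus False using n y by simp
  qed
  define ix where "ix y = (SOME p. y \<in> K p)" for y
  have ix: "ix y = p" if "y \<in> K p" for y p
    unfolding ix_def using that K_disj by (intro some_equality) auto
  \<comment> \<open>On each block the permutation chosen for its list acts, provided
    \<open>g\<close> occurs in that list; everywhere else nothing moves.\<close>
  define s where "s g y = (if y \<in> K (ix y) \<and> g \<in> set (ix y) then \<sigma> (ix y) g y else y)" for g y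
  have sK: "s g y = \<sigma> p g y" if "y \<in> K p" "g \<in> set p" for g y p
    using that ix [OF that(1)] by (simp add: s_def)
  have s_inv: "s g (s g y) = y" for g y
  proof (cases "y \<in> K (ix y) \<and> g \<in> set (ix y)")
    case True
    thus ?thesis using sK \<sigma>K \<sigma>(1) by metis
  next
    case False
    hence "s g y = y" by (auto simp: s_def)
    thus ?thesis by simp
  qed
  have s_U: "s g y - y \<in> U" for g y using \<sigma>(2) nhd_e_zero [OF U] by (simp add: s_def)
  have s_Bij: "s g \<in> Bij UNIV" for g
    using s_inv by (auto simp: Bij_def intro!: o_bij [of "s g"])
  define \<alpha> where "\<alpha> g x = s g (g + x)" for g x
  have \<alpha>_Bij: "\<alpha> g \<in> Bij UNIV" for g
  proof -
    have "bij (s g \<circ> (\<lambda>x. g + x))" using s_Bij [of g] translation_Bij [of g] by (intro bij_comp) (auto simp: Bij_def)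
    moreover have "s g \<circ> (\<lambda>x. g + x) = \<alpha> g" by (auto simp: \<alpha>_def)
    ultimately show ?thesis by (simp add: Bij_def)
  qed
  have near: "\<alpha> g h \<in> {u + g + h |u. u \<in> U}" for g h
  proof -
    have "\<alpha> g h = (\<alpha> g h - (g + h)) + g + h" by (simp add: add.assoc)
    moreover have "\<alpha> g h - (g + h) \<in> U" using s_U [of g "g + h"] by (simp add: \<alpha>_def)
    ultimately show ?thesis by blast
  qed
  have "\<alpha> \<in> near_translations U" using \<alpha>_Bij near unfolding near_translations_def by simp
  moreover have "\<exists>m. mean_on bounded_funs m \<and> (\<forall>f\<in>bounded_funs. \<forall>g. m (\<lambda>x. f (\<alpha> g x)) = m f)"
  proof (rule invariant_mean_exists [OF fun_subspace_bounded_funs])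
    fix ps :: "(('a \<Rightarrow> real) \<times> 'a) list" and \<delta> :: real
    assume ps: "fst ` set ps \<subseteq> bounded_funs" and \<delta>: "\<delta> > 0"
    obtain B where B: "B \<ge> 0" "\<And>f x. f \<in> fst ` set ps \<Longrightarrow> \<bar>f x\<bar> \<le> B"
      using bounded_funs_uniform_bound [OF _ ps] by auto
    define c where "c = 2 * B * length ps"
    obtain n :: nat where n: "c / \<delta> < n" using reals_Archimedean2 by blast
    \<comment> \<open>Padding with zeros leaves the required elements in the list and brings the
      tolerance below \<open>\<delta> / c\<close>.\<close>
    define p where "p = map snd ps @ replicate n 0"
    have "c < \<delta> * n" using n \<delta> by (simp add: field_simps)
    also have "\<dots> \<le> \<delta> * (length p + 1)" using \<delta> by (simp add: p_def)
    finally have small: "c * \<eta> p < \<delta>" by (simp add: \<eta>_def field_simps)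
    define k where "k = real (card (F p))"
    have k: "k > 0" using finF [of p] by (simp add: k_def card_gt_0_iff)
    have lower: "- (2 * B * (\<eta> p * k) * length ps) \<le> (\<Sum>x\<in>F p. drift \<alpha> ps x)"
    proof (rule drift_folner_lower [OF finF(1)])
      fix i assume "i \<in> snd ` set ps"
      hence i: "i \<in> set p" by (auto simp: p_def)
      have "\<alpha> i x = \<sigma> p i (i + x)" if "x \<in> F p" for x
        unfolding \<alpha>_def using that i by (intro sK) (auto simp: K_def)
      hence "{x \<in> F p. \<alpha> i x \<notin> F p} = {x \<in> F p. \<sigma> p i (i + x) \<notin> F p}" by auto
      moreover have "inj (\<alpha> i)" using \<alpha>_Bij [of i] by (simp add: Bij_def bij_betw_def)
      ultimately show "inj (\<alpha> i) \<and> real (card {x \<in> F p. \<alpha> i x \<notin> F p}) \<le> \<eta> p * k"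
        using \<sigma>(4) [OF i] by (simp add: k_def)
    qed (use B in auto)
    show "\<exists>x. - \<delta> < drift \<alpha> ps x"
    proof (rule ccontr)
      assume "\<not> ?thesis"
      hence "(\<Sum>x\<in>F p. drift \<alpha> ps x) \<le> (\<Sum>x\<in>F p. - \<delta>)" by (intro sum_mono) (auto simp: not_less)
      hence "- (2 * B * (\<eta> p * k) * length ps) \<le> - (\<delta> * k)" using lower by (simp add: k_def mult.commute)
      hence "\<delta> * k \<le> (c * \<eta> p) * k" by (simp add: c_def mult_ac)
      thus False using small k by simp
    qed
  qed (use bounded_funs_const bounded_funs_comp in \<open>auto simp: bounded_funs_def\<close>)
  ultimately show ?thesis by blast
qed

lemma amenable_imp_invariant_mean:
  fixes U :: "'a::{topological_group_add, t2_space} set"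
  assumes am: "amenable TYPE('a)" and U: "U \<in> nhd_filter_e"
  shows "\<exists>\<alpha>\<in>near_translations U. \<exists>m. mean_on bounded_funs m \<and>
    (\<forall>f\<in>bounded_funs. \<forall>g. m (\<lambda>x. f (\<alpha> g x)) = m f)"
proof (cases "\<exists>W\<in>nhd_filter_e. finite (W :: 'a set)")
  case True
  then obtain W where W: "W \<in> nhd_filter_e" "finite (W :: 'a set)" by blast
  \<comment> \<open>In a Hausdorff space the finite set \<open>W - {0}\<close> is closed; removing
    it from \<open>W\<close> leaves \<open>{0}\<close> as a neighbourhood, so the group is
    discrete.\<close>
  have "open (- (W - {0}))" by (intro open_Compl finite_imp_closed finite_Diff W(2))
  hence "- (W - {0}) \<in> nhd_filter_e"
    unfolding nhd_e_iff by (rule eventually_nhds_in_open) simp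
  hence "W \<inter> - (W - {0}) \<in> nhd_filter_e" by (rule nhd_e_Int [OF W(1)])
  hence zero: "{0 :: 'a} \<in> nhd_filter_e" by (rule nhd_e_mono) auto
  have "(bounded_funs :: ('a \<Rightarrow> real) set) = RUC_b"
    using zero by (force simp: RUC_b_iff bounded_funs_def intro: bexI [of _ "{0}"])
  moreover obtain \<mu> :: "('a \<Rightarrow> real) \<Rightarrow> real" where "mean_on RUC_b \<mu>"
    "\<And>f g. f \<in> RUC_b \<Longrightarrow> \<mu> (\<lambda>x. f (g + x)) = \<mu> f"
    using amenableE [OF am] by blast
  ultimately show ?thesis
    using translation_near_translations [OF U]
    by (intro bexI [of _ "\<lambda>g x. g + x"] exI [of _ \<mu>]) auto
next
  case False
  thus ?thesis using amenable_imp_invariant_mean_nondiscrete [OF am _ U] by blast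
qed

lemma amenable_imp_no_F2:
  fixes U :: "'a::{topological_group_add, t2_space} set"
  assumes "amenable TYPE('a)" "U \<in> nhd_filter_e"
  shows "\<exists>\<alpha>\<in>near_translations U. \<not> F2_semi_regular_in UNIV (wobbling_of UNIV UNIV \<alpha>)"
proof -
  obtain \<alpha> m where \<alpha>: "\<alpha> \<in> near_translations U" and m: "mean_on bounded_funs m"
    "\<And>f g. f \<in> bounded_funs \<Longrightarrow> m (\<lambda>x. f (\<alpha> g x)) = m f"
    using amenable_imp_invariant_mean [OF assms] by blast
  have "\<alpha> ` UNIV \<subseteq> Bij UNIV" using near_translations_Bij [OF \<alpha>] by blast
  thus ?thesis using invariant_mean_no_F2 [OF _ m(1)] m(2) \<alpha> by blast
qed

text \<open>The cycle is (1), (3), (2), (1). For the last step, an amenable group has for every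
  \<open>U\<close> some \<open>\<alpha>\<close> whose wobbling group admits no free action of
  \<open>F2\<close>.\<close>

theorem corollary5p12:
  shows "(\<not> amenable TYPE('a::{topological_group_add, t2_space}) \<longleftrightarrow>
           (\<exists>U \<in> (nhd_filter_e :: 'a set set). \<forall>\<alpha> \<in> near_translations U.
              F2_semi_regular_in UNIV (wobbling_of UNIV UNIV \<alpha>))) \<and>
         (\<not> amenable TYPE('a) \<longleftrightarrow>
           (\<exists>U \<in> (nhd_filter_e :: 'a set set).
              F2_semi_regular_in (UNIV \<times> near_translations U) (wobbling_nhd U)))"
  using not_amenable_imp_F2 F2_wobbling_nhd_imp amenable_imp_no_F2 by blast

end
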